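(* Let $f\in\mathrm{Emb}(S^1,S^3)$ be a closed knot. Then in $\pi_1(\mathrm{Emb}(S^1,S^3),f)$ we have $$[\mathrm{Repar}(f)]=[\mathrm{Roll}_0(f)]*[\mathrm{Rot}(f)]=[\mathrm{Rot}(f)]*[\mathrm{Roll}_0(f)].$$
   Context: $S^1=\{z\in\mathbb C:|z|=1\}$, $S^3\subset\mathbb R^4$ is the unit sphere, and $\mathrm{Emb}(S^1,S^3)$ is the space of smooth embeddings with the $C^\infty$-topology. For $f\in\mathrm{Emb}(S^1,S^3)$ the following loops based at $f$ are defined, $t\in[0,1]$, $z\in S^1$. **Rotation loop:** $\mathrm{Rot}(f)(t)(z)=R_{2\pi t}f(z)$, where $$R_{2\pi t}=\begin{pmatrix}1&0&0&0\\0&\cos2\pi t&-\sin2\pi t&0\\0&\sin2\pi t&\cos2\pi t&0\\0&0&0&1\end{pmatrix}\in SO(4).$$ **Rolling loop:** let $T(z)=\frac{(df)_z(iz)}{\|(df)_z(iz)\|}$ be the unit tangent vector, let $N$ be a smooth unit normal vector field along $f$, with $N(z)\in T_{f(z)}S^3$, $N(z)\perp T(z)$ and $N(z)\perp f(z)$, and let $B(z)\in\mathbb R^4$ be the unit vector with $A(z):=[T(z),N(z),B(z),f(z)]\in SO(4)$ (columns). Set $$\mathrm{Roll}_N(f)(t)(z)=A(1)A(e^{2\pi it})^{-1}f(e^{2\pi it}z).$$ The framing number of $N$ is the linking number of $f$ and $\frac{f+\epsilon N}{\sqrt{1+\epsilon^2}}$ for small $\epsilon>0$; the homotopy class of $\mathrm{Roll}_N(f)$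 depends only on the framing number $n$ of $N$, and is denoted $[\mathrm{Roll}_n(f)]$. So $[\mathrm{Roll}_0(f)]$ is the class for any $N$ of framing number $0$. **Reparametrization loop:** $\mathrm{Repar}(f)(t)(z)=f(e^{2\pi it}z)$. *)

theory Defs
  imports "HOL-Analysis.Analysis" "HOL-Algebra.Group"
begin

section \<open>Smooth maps on the circle\<close>

abbreviation circle :: "complex set"
  where "circle \<equiv> sphere 0 1"

text \<open>
  The derivative along the unit tangent field of the circle: for \<open>z\<close> on the circle this is
  the differential of \<open>f\<close> at \<open>z\<close> applied to \<open>iz\<close>.  Only values of \<open>f\<close> on the circle matter.
\<close>

definition circle_deriv :: "(complex \<Rightarrow> 'a::real_normed_vector) \<Rightarrow> complex \<Rightarrow> 'a"
  where "circle_deriv f z = vector_derivative (\<lambda>\<theta>. f (z * cis \<theta>)) (at 0)"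

definition smooth_on_circle :: "(complex \<Rightarrow> 'a::real_normed_vector) \<Rightarrow> bool"
  where "smooth_on_circle f \<longleftrightarrow>
    (\<forall>k. \<forall>z\<in>circle. (\<lambda>\<theta>. (circle_deriv ^^ k) f (z * cis \<theta>)) differentiable (at 0))"


section \<open>The space of knots\<close>

text \<open>
  Since the circle is compact, a smooth embedding is the same as an injective smooth immersion.
  Maps are represented by functions on the plane that take a fixed dummy value off the circle.
\<close>

definition Emb :: "(complex \<Rightarrow> real ^ 4) set"
  where "Emb = {f \<in> extensional circle.
    smooth_on_circle f \<and> f ` circle \<subseteq> sphere 0 1 \<and> inj_on f circle \<and>
    (\<forall>z\<in>circle. circle_deriv f z \<noteq> 0)}"

text \<open>
  The \<open>C\<^sup>\<infinity>\<close>-topology: uniform convergence of finitely many derivatives at a time.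
\<close>

definition Emb_nbhd :: "(complex \<Rightarrow> real ^ 4) \<Rightarrow> nat \<Rightarrow> real \<Rightarrow> (complex \<Rightarrow> real ^ 4) set"
  where "Emb_nbhd f k e = {g \<in> Emb. \<forall>j\<le>k. \<forall>z\<in>circle.
    dist ((circle_deriv ^^ j) g z) ((circle_deriv ^^ j) f z) < e}"

definition Emb_topology :: "(complex \<Rightarrow> real ^ 4) topology"
  where "Emb_topology =
    topology (\<lambda>U. U \<subseteq> Emb \<and> (\<forall>f\<in>U. \<exists>k. \<exists>e>0. Emb_nbhd f k e \<subseteq> U))"

lemma openin_Emb_topology:
  "openin Emb_topology U \<longleftrightarrow> U \<subseteq> Emb \<and> (\<forall>f\<in>U. \<exists>k. \<exists>e>0. Emb_nbhd f k e \<subseteq> U)"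
proof -
  let ?L = "\<lambda>U. U \<subseteq> Emb \<and> (\<forall>f\<in>U. \<exists>k. \<exists>e>0. Emb_nbhd f k e \<subseteq> U)"
  have "?L (S \<inter> T)" if S: "?L S" and T: "?L T" for S T
  proof (intro conjI ballI)
    show "S \<inter> T \<subseteq> Emb"
      using S by blast
  next
    fix f assume f: "f \<in> S \<inter> T"
    obtain k d where kd: "d > 0" "Emb_nbhd f k d \<subseteq> S"
      using S f by blast
    obtain l e where le: "e > 0" "Emb_nbhd f l e \<subseteq> T"
      using T f by blast
    have "Emb_nbhd f (max k l) (min d e) \<subseteq> Emb_nbhd f k d \<inter> Emb_nbhd f l e"
      unfolding Emb_nbhd_def by force
    then have "Emb_nbhd f (max k l) (min d e) \<subseteq> S \<inter> T"
      using kd le by blast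
    moreover have "min d e > 0"
      using kd le by simp
    ultimately show "\<exists>k. \<exists>e>0. Emb_nbhd f k e \<subseteq> S \<inter> T"
      by blast
  qed
  moreover have "?L (\<Union>\<K>)" if "\<forall>K\<in>\<K>. ?L K" for \<K>
    using that by (meson Sup_least UnionE Union_upper subset_trans)
  ultimately have "istopology ?L"
    unfolding istopology_def by blast
  then show ?thesis
    by (simp add: Emb_topology_def topology_inverse')
qed

lemma topspace_Emb_topology: "topspace Emb_topology = Emb"
proof -
  have "Emb_nbhd f k e \<subseteq> Emb" for f k e
    by (auto simp: Emb_nbhd_def)
  then have "openin Emb_topology Emb"
    by (auto simp: openin_Emb_topology intro: exI[of _ 1])
  then show ?thesis
    by (meson openin_Emb_topology openin_subset openin_topspace subset_antisym)
qed


section \<open>The fundamental group\<close>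

definition based_loops :: "'a topology \<Rightarrow> 'a \<Rightarrow> (real \<Rightarrow> 'a) set"
  where "based_loops X x = {p. pathin X p \<and> p 0 = x \<and> p 1 = x}"

definition loop_homotopy :: "'a topology \<Rightarrow> 'a \<Rightarrow> ((real \<Rightarrow> 'a) \<times> (real \<Rightarrow> 'a)) set"
  where "loop_homotopy X x = {(p, q). p \<in> based_loops X x \<and> q \<in> based_loops X x \<and>
    homotopic_with (\<lambda>r. r 0 = x \<and> r 1 = x) (top_of_set {0..1}) X p q}"

definition loop_class :: "'a topology \<Rightarrow> 'a \<Rightarrow> (real \<Rightarrow> 'a) \<Rightarrow> (real \<Rightarrow> 'a) set"
  where "loop_class X x p = loop_homotopy X x `` {p}"

text \<open>
  The library operation \<open>+++\<close> has this definition, but it is restricted to a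
  type class of topological spaces, whose topology would be unrelated to \<open>X\<close> here.
\<close>

definition loop_join :: "(real \<Rightarrow> 'a) \<Rightarrow> (real \<Rightarrow> 'a) \<Rightarrow> real \<Rightarrow> 'a"
  where "loop_join p q = (\<lambda>t. if t \<le> 1 / 2 then p (2 * t) else q (2 * t - 1))"

definition fundamental_group :: "'a topology \<Rightarrow> 'a \<Rightarrow> (real \<Rightarrow> 'a) set monoid"
  where "fundamental_group X x =
    \<lparr>carrier = based_loops X x // loop_homotopy X x,
     mult = (\<lambda>P Q. \<Union>p\<in>P. \<Union>q\<in>Q. loop_class X x (loop_join p q)),
     one = loop_class X x (\<lambda>_. x)\<rparr>"

abbreviation pi1_Emb :: "(complex \<Rightarrow> real ^ 4) \<Rightarrow> (real \<Rightarrow> complex \<Rightarrow> real ^ 4) set monoid"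
  where "pi1_Emb \<equiv> fundamental_group Emb_topology"

abbreviation Emb_class ::
    "(complex \<Rightarrow> real ^ 4) \<Rightarrow> (real \<Rightarrow> complex \<Rightarrow> real ^ 4) \<Rightarrow> (real \<Rightarrow> complex \<Rightarrow> real ^ 4) set"
  where "Emb_class \<equiv> loop_class Emb_topology"


section \<open>Linking and framing numbers\<close>

text \<open>
  Stereographic projection from the pole \<open>p\<close> onto the hyperplane orthogonal to \<open>p\<close>.
\<close>

definition stereographic :: "real ^ 4 \<Rightarrow> real ^ 4 \<Rightarrow> real ^ 4"
  where "stereographic p x = (1 / (1 - x \<bullet> p)) *\<^sub>R (x - (x \<bullet> p) *\<^sub>R p)"

text \<open>
  The Gauss linking integral
  \<open>1/(4\<pi>) \<integral>\<integral> det(u', v', u - v) / |u - v|\<^sup>3\<close> of the projected curves \<open>u\<close> and \<open>v\<close>.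
  The 3-sphere is oriented such that a basis \<open>a, b, c\<close> of the tangent space at \<open>x\<close> is positive
  iff \<open>det(a, b, c, x) > 0\<close>.  At \<open>x = -p\<close> the projection is tangent to a positive multiple
  of the identity, so the determinant on the hyperplane is \<open>det(a, b, c, -p)\<close>.  This
  explains the minus sign.
\<close>

definition gauss_linking_integral ::
    "real ^ 4 \<Rightarrow> (complex \<Rightarrow> real ^ 4) \<Rightarrow> (complex \<Rightarrow> real ^ 4) \<Rightarrow> real"
  where "gauss_linking_integral p f g =
    (let u = stereographic p \<circ> f; v = stereographic p \<circ> g in
      - 1 / (4 * pi) *
        integral {0..2 * pi} (\<lambda>s. integral {0..2 * pi} (\<lambda>t.
          det (vector [circle_deriv u (cis s), circle_deriv v (cis t),
                       u (cis s) - v (cis t), p] :: real ^ 4 ^ 4)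
          / norm (u (cis s) - v (cis t)) ^ 3)))"

text \<open>
  For disjoint smooth closed curves in the 3-sphere, the integral is an integer that does not
  depend on the choice of the pole off the two curves (and such poles exist).
\<close>

definition has_linking_number ::
    "(complex \<Rightarrow> real ^ 4) \<Rightarrow> (complex \<Rightarrow> real ^ 4) \<Rightarrow> int \<Rightarrow> bool"
  where "has_linking_number f g n \<longleftrightarrow> f ` circle \<inter> g ` circle = {} \<and>
    (\<forall>p \<in> sphere 0 1 - (f ` circle \<union> g ` circle). gauss_linking_integral p f g = of_int n)"

definition unit_tangent :: "(complex \<Rightarrow> real ^ 4) \<Rightarrow> complex \<Rightarrow> real ^ 4"
  where "unit_tangent f z = (1 / norm (circle_deriv f z)) *\<^sub>R circle_deriv f z"

definition unit_normal_field :: "(complex \<Rightarrow> real ^ 4) \<Rightarrow> (complex \<Rightarrow> real ^ 4) \<Rightarrow> bool"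
  where "unit_normal_field f N \<longleftrightarrow> smooth_on_circle N \<and>
    (\<forall>z\<in>circle. norm (N z) = 1 \<and> orthogonal (N z) (unit_tangent f z) \<and> orthogonal (N z) (f z))"

definition push_off ::
    "(complex \<Rightarrow> real ^ 4) \<Rightarrow> (complex \<Rightarrow> real ^ 4) \<Rightarrow> real \<Rightarrow> complex \<Rightarrow> real ^ 4"
  where "push_off f N \<epsilon> z = (1 / sqrt (1 + \<epsilon>\<^sup>2)) *\<^sub>R (f z + \<epsilon> *\<^sub>R N z)"

definition has_framing_number ::
    "(complex \<Rightarrow> real ^ 4) \<Rightarrow> (complex \<Rightarrow> real ^ 4) \<Rightarrow> int \<Rightarrow> bool"
  where "has_framing_number f N n \<longleftrightarrow>
    (\<forall>\<^sub>F \<epsilon> in at_right 0. has_linking_number f (push_off f N \<epsilon>) n)"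


section \<open>The three loops\<close>

definition rotation :: "real \<Rightarrow> real ^ 4 ^ 4"
  where "rotation \<phi> = vector
    [vector [1, 0, 0, 0],
     vector [0, cos \<phi>, - sin \<phi>, 0],
     vector [0, sin \<phi>, cos \<phi>, 0],
     vector [0, 0, 0, 1]]"

definition Rot :: "(complex \<Rightarrow> real ^ 4) \<Rightarrow> real \<Rightarrow> complex \<Rightarrow> real ^ 4"
  where "Rot f t = (\<lambda>z\<in>circle. rotation (2 * pi * t) *v f z)"

text \<open>The library's \<open>vector\<close> lists the rows of a matrix, hence the transposition.\<close>

definition binormal ::
    "(complex \<Rightarrow> real ^ 4) \<Rightarrow> (complex \<Rightarrow> real ^ 4) \<Rightarrow> complex \<Rightarrow> real ^ 4"
  where "binormal f N z = (THE b. norm b = 1 \<and>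
    rotation_matrix (transpose (vector [unit_tangent f z, N z, b, f z])))"

definition frame ::
    "(complex \<Rightarrow> real ^ 4) \<Rightarrow> (complex \<Rightarrow> real ^ 4) \<Rightarrow> complex \<Rightarrow> real ^ 4 ^ 4"
  where "frame f N z = transpose (vector [unit_tangent f z, N z, binormal f N z, f z])"

definition Roll ::
    "(complex \<Rightarrow> real ^ 4) \<Rightarrow> (complex \<Rightarrow> real ^ 4) \<Rightarrow> real \<Rightarrow> complex \<Rightarrow> real ^ 4"
  where "Roll N f t = (\<lambda>z\<in>circle.
    (frame f N 1 ** matrix_inv (frame f N (cis (2 * pi * t)))) *v f (cis (2 * pi * t) * z))"

definition Repar :: "(complex \<Rightarrow> real ^ 4) \<Rightarrow> real \<Rightarrow> complex \<Rightarrow> real ^ 4"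
  where "Repar f t = (\<lambda>z\<in>circle. f (cis (2 * pi * t) * z))"

end

theory Submission
  imports Defs
begin

text \<open>
  Let \<open>A\<close> be the frame of \<open>f\<close>, a loop in \<open>SO(4)\<close>.  By definition
  \<open>Repar(t) = L(t) \<cdot> Roll(t)\<close> with \<open>L(t) = A(e\<^sup>2\<^sup>\<pi>\<^sup>i\<^sup>t) A(1)\<^sup>-\<^sup>1\<close>, so it suffices that \<open>L\<close> is homotopic to the
  rotation loop: the product of two loops acting pointwise is homotopic to their concatenation
  in either order, by sliding along the square \<open>(s, t) \<mapsto> Rot(s) \<cdot> Roll(t)\<close>.

  The homotopy class of \<open>L\<close> is found by stereographic projection to 3-space, where the knot is a
  curve \<open>U\<close> and its push-off a curve \<open>V\<close>.  Since the Gauss integral of \<open>(U(s) - V(t)) / |U(s) - V(t)|\<close>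
  vanishes, Stokes' theorem for the Hopf fibration lifts this map to a doubly periodic map \<open>\<Psi>\<close>
  into the unit spinors.  The function \<open>g(s, t) = det(\<Psi>(s, t), \<Psi>(t, s))\<close> is antisymmetric, and it does not
  vanish away from the diagonal because the chords \<open>U(s) - V(t)\<close> and \<open>U(t) - V(s)\<close> are nearly opposite.
  Hence \<open>t \<mapsto> g(t, t + \<pi>)\<close> changes sign under \<open>t \<mapsto> t + \<pi>\<close> and has odd winding number.  Deforming it
  towards the diagonal shows that the spinor describing the frame changes its sign along the
  knot, that is, the frame is the non-trivial loop.
\<close>

section \<open>Concatenation of loops\<close>

text \<open>The directions \<open>U s - U t\<close> of the knot alone are singular on the diagonal
  of the torus. Replacing one copy by a push-off \<open>V\<close> gives a map on the whole torus,
  and its value at \<open>(t, t)\<close> is minus the approximate normal: this is how framing and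
  spin meet in one object. Over a square a lift to unit spinors always exists. It can be made doubly
  periodic if the phases gained along the edges cancel, and the discrepancy is the total curvature,
  a multiple of the linking integral. This is where framing number 0 enters. A unit spinor up to
  sign is an oriented orthonormal frame of 3-space. \<open>\<Psi> (t, t)\<close> fixes one axis, and
  the relative phase of \<open>\<Psi> (t + \<eta>, t)\<close> fixes the angle of the tangent about
  it. A turn by an angle \<phi> costs a spinor only the phase \<phi>/2, so odd winding becomes a
  change of sign: the spinor path joins antipodal points of the 3-sphere, just like the lift of one
  full rotation. Frames in \<open>SO(4)\<close> become frames in 3-space by contracting the
  complement of a pole \<open>p\<close> to \<open>- p\<close>. The homotopies run through orthogonal
  matrices, which act on \<open>Emb\<close>.\<close>

lemma loop_homotopy_iff:
  "(p, q) \<in> loop_homotopy X x \<longleftrightarrow>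
    homotopic_with (\<lambda>r. r 0 = x \<and> r 1 = x) (top_of_set {0..1}) X p q"
  (is "_ \<longleftrightarrow> ?H")
proof
  assume ?H
  from homotopic_with_imp_continuous_maps[OF this] homotopic_with_imp_property[OF this] this
  show "(p, q) \<in> loop_homotopy X x"
    by (simp add: loop_homotopy_def based_loops_def pathin_def)
qed (simp add: loop_homotopy_def)

lemma loop_homotopyI:
  fixes h :: "real \<times> real \<Rightarrow> 'a"
  assumes "continuous_map (top_of_set ({0..1} \<times> {0..1})) X h"
    and "\<And>t. t \<in> {0..1} \<Longrightarrow> h (0, t) = p t" "\<And>t. t \<in> {0..1} \<Longrightarrow> h (1, t) = q t"
    and "\<And>k. k \<in> {0..1} \<Longrightarrow> h (k, 0) = x" "\<And>k. k \<in> {0..1} \<Longrightarrow> h (k, 1) = x"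
  shows "(p, q) \<in> loop_homotopy X x"
proof -
  \<comment> \<open>\<open>homotopic_with\<close> uses a product of two subspace topologies; on the
    square it is the Euclidean one, for which continuity facts are available.\<close>
  have eq: "prod_topology (top_of_set {0..1::real}) (top_of_set {0..1::real}) = top_of_set ({0..1} \<times> {0..1})"
    by (simp add: prod_topology_subtopology_eu)
  have "homotopic_with (\<lambda>r. r 0 = x \<and> r 1 = x) (top_of_set {0..1}) X p q"
  proof (subst homotopic_with)
    show "\<And>h k. (\<And>u. u \<in> topspace (top_of_set {0..1::real}) \<Longrightarrow> h u = k u) \<Longrightarrow>
      (h 0 = x \<and> h 1 = x) = (k 0 = x \<and> k 1 = x)" by simp
    show "\<exists>h. continuous_map (prod_topology (top_of_set {0..1}) (top_of_set {0..1})) X h \<and>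
        (\<forall>t\<in>topspace (top_of_set {0..1::real}). h (0::real, t) = p t) \<and>
        (\<forall>t\<in>topspace (top_of_set {0..1}). h (1, t) = q t) \<and>
        (\<forall>k\<in>{0..1}. h (k, 0) = x \<and> h (k, 1) = x)"
      unfolding eq by (rule exI[of _ h]) (simp add: assms)
  qed
  then show ?thesis by (simp add: loop_homotopy_iff)
qed

lemma equiv_loop_homotopy: "equiv (based_loops X x) (loop_homotopy X x)"
proof (rule equivI)
  show "loop_homotopy X x \<subseteq> based_loops X x \<times> based_loops X x"
    by (auto simp: loop_homotopy_def)
  show "refl_on (based_loops X x) (loop_homotopy X x)"
    by (auto simp: refl_on_def loop_homotopy_iff based_loops_def pathin_def)
  show "sym (loop_homotopy X x)"
    by (auto simp: sym_def loop_homotopy_iff homotopic_with_sym)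
  show "trans (loop_homotopy X x)"
    unfolding trans_def loop_homotopy_iff by (blast intro: homotopic_with_trans)
qed

text \<open>The two homotopies fit side by side because both are equal to \<open>x\<close> at every
  stage on the seam, the parameter 1/2.\<close>

lemma loop_join_homotopy:
  assumes "(p, p') \<in> loop_homotopy X x" "(q, q') \<in> loop_homotopy X x"
  shows "(loop_join p q, loop_join p' q') \<in> loop_homotopy X x"
proof -
  let ?I = "{0..1::real}"
  have eq: "prod_topology (top_of_set ?I) (top_of_set ?I) = top_of_set (?I \<times> ?I)"
    by (simp add: prod_topology_subtopology_eu)
  obtain h where h: "continuous_map (top_of_set (?I \<times> ?I)) X h"
      "\<And>t. h (0, t) = p t" "\<And>t. h (1, t) = p' t"
      "\<And>k. k \<in> ?I \<Longrightarrow> h (k, 0) = x \<and> h (k, 1) = x"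
    using assms(1) unfolding loop_homotopy_iff homotopic_with_def eq by auto
  obtain g where g: "continuous_map (top_of_set (?I \<times> ?I)) X g"
      "\<And>t. g (0, t) = q t" "\<And>t. g (1, t) = q' t"
      "\<And>k. k \<in> ?I \<Longrightarrow> g (k, 0) = x \<and> g (k, 1) = x"
    using assms(2) unfolding loop_homotopy_iff homotopic_with_def eq by auto
  define H where "H = (\<lambda>y. if snd y \<le> 1/2 then h (fst y, 2 * snd y) else g (fst y, 2 * snd y - 1))"
  have "continuous_map (top_of_set (?I \<times> ?I)) X H"
    unfolding H_def
  proof (rule continuous_map_cases_le)
    show "continuous_map (top_of_set (?I \<times> ?I)) euclideanreal snd"
      "continuous_map (top_of_set (?I \<times> ?I)) euclideanreal (\<lambda>x. 1/2)"
      by (auto intro!: continuous_intros)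
    have "continuous_map (subtopology (top_of_set (?I \<times> ?I)) {x \<in> topspace (top_of_set (?I \<times> ?I)). snd x \<le> 1 / 2})
      (top_of_set (?I \<times> ?I)) (\<lambda>y. (fst y, 2 * snd y))"
      by (auto simp: subtopology_subtopology intro!: continuous_intros)
    from continuous_map_compose[OF this h(1)]
    show "continuous_map (subtopology (top_of_set (?I \<times> ?I)) {x \<in> topspace (top_of_set (?I \<times> ?I)). snd x \<le> 1 / 2})
      X (\<lambda>y. h (fst y, 2 * snd y))" by (simp add: o_def)
    have "continuous_map (subtopology (top_of_set (?I \<times> ?I)) {x \<in> topspace (top_of_set (?I \<times> ?I)). 1 / 2 \<le> snd x})
      (top_of_set (?I \<times> ?I)) (\<lambda>y. (fst y, 2 * snd y - 1))"
      by (auto simp: subtopology_subtopology intro!: continuous_intros)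
    from continuous_map_compose[OF this g(1)]
    show "continuous_map (subtopology (top_of_set (?I \<times> ?I)) {x \<in> topspace (top_of_set (?I \<times> ?I)). 1 / 2 \<le> snd x})
      X (\<lambda>y. g (fst y, 2 * snd y - 1))" by (simp add: o_def)
    show "h (fst y, 2 * snd y) = g (fst y, 2 * snd y - 1)"
      if "y \<in> topspace (top_of_set (?I \<times> ?I))" "snd y = 1/2" for y
    proof -
      have "y = (fst y, 1/2)" "fst y \<in> ?I"
        using that by (auto simp: prod_eq_iff)
      then obtain k where "y = (k, 1/2)" "k \<in> ?I" by blast
      then show ?thesis using h(4)[of k] g(4)[of k] by simp
    qed
  qed
  then show ?thesis
    by (rule loop_homotopyI) (simp_all add: H_def loop_join_def h g)
qed

text \<open>The group product is a union over all representatives. By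
  \<open>loop_join_homotopy\<close> all members of this union coincide, so one pair of
  representatives determines it.\<close>

lemma mult_fundamental_group:
  assumes "p \<in> based_loops X x" "q \<in> based_loops X x"
  shows "loop_class X x p \<otimes>\<^bsub>fundamental_group X x\<^esub> loop_class X x q = loop_class X x (loop_join p q)"
proof -
  note eqv = equiv_loop_homotopy[of X x]
  have p: "p \<in> loop_class X x p" and q: "q \<in> loop_class X x q"
    using assms eqv by (auto simp: loop_class_def equiv_def refl_on_def)
  have "loop_class X x (loop_join p' q') = loop_class X x (loop_join p q)"
    if "p' \<in> loop_class X x p" "q' \<in> loop_class X x q" for p' q'
    using loop_join_homotopy[of p p' X x q q'] that equiv_class_eq[OF eqv]
    by (simp add: loop_class_def)
  then have "(\<Union>p'\<in>loop_class X x p. \<Union>q'\<in>loop_class X x q. loop_class X x (loop_join p' q'))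
      = loop_class X x (loop_join p q)"
    using p q by blast
  then show ?thesis
    by (simp add: fundamental_group_def)
qed

text \<open>An Eckmann-Hilton argument: \<open>\<Phi>\<close> restricts to \<open>p\<close> on both
  edges in the first direction and to \<open>q\<close> on both edges in the second, and the diagonal
  of the square deforms linearly, with fixed ends, onto either of the two edge paths between its
  corners.\<close>

lemma diagonal_homotopy_join:
  fixes \<Phi> :: "real \<times> real \<Rightarrow> 'a"
  assumes "continuous_map (top_of_set ({0..1} \<times> {0..1})) X \<Phi>"
    and "\<And>t. t \<in> {0..1} \<Longrightarrow> \<Phi> (t, 0) = p t" "\<And>t. t \<in> {0..1} \<Longrightarrow> \<Phi> (t, 1) = p t"
    and "\<And>t. t \<in> {0..1} \<Longrightarrow> \<Phi> (0, t) = q t" "\<And>t. t \<in> {0..1} \<Longrightarrow> \<Phi> (1, t) = q t"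
    and "\<And>t. t \<in> {0..1} \<Longrightarrow> d t = \<Phi> (t, t)" "\<Phi> (0, 0) = x" "\<Phi> (1, 1) = x"
  shows "(d, loop_join p q) \<in> loop_homotopy X x" "(d, loop_join q p) \<in> loop_homotopy X x"
proof -
  let ?I = "{0..1::real}"
  \<comment> \<open>\<open>(a, b)\<close> runs along \<open>(t, 0)\<close> and then
    \<open>(1, t)\<close>, whereas \<open>(b, a)\<close> runs along \<open>(0, t)\<close> and then
    \<open>(t, 1)\<close>.\<close>
  define a b where "a = (\<lambda>t::real. min (2 * t) 1)" and "b = (\<lambda>t::real. max 0 (2 * t - 1))"
  have ab: "a t \<in> ?I" "b t \<in> ?I" if "t \<in> ?I" for t using that by (auto simp: a_def b_def)
  have mem: "(1 - k) * t + k * c \<in> ?I" if "k \<in> ?I" "t \<in> ?I" "c \<in> ?I" for k t c :: real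
    using that convex_bound_le[of t 1 c "1 - k" k] by auto
  have *: "continuous_map (top_of_set (?I \<times> ?I)) (top_of_set (?I \<times> ?I))
      (\<lambda>y. ((1 - fst y) * snd y + fst y * m (snd y), (1 - fst y) * snd y + fst y * n (snd y)))"
    if "\<And>t. t \<in> ?I \<Longrightarrow> m t \<in> ?I" "\<And>t. t \<in> ?I \<Longrightarrow> n t \<in> ?I"
      "continuous_on UNIV m" "continuous_on UNIV n" for m n
  proof (subst continuous_map_subtopology_eu, intro conjI)
    show "continuous_on (?I \<times> ?I)
      (\<lambda>y. ((1 - fst y) * snd y + fst y * m (snd y), (1 - fst y) * snd y + fst y * n (snd y)))"
      by (intro continuous_intros continuous_on_compose2[OF that(3)] continuous_on_compose2[OF that(4)]) auto
  qed (use mem that(1,2) in \<open>auto simp: image_subset_iff simp del: atLeastAtMost_iff\<close>)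
  have cont: "continuous_on UNIV a" "continuous_on UNIV b"
    unfolding a_def b_def by (intro continuous_intros)+
  note c = *[OF ab cont] and c' = *[OF ab(2,1) cont(2,1)]
  have a: "a t = (if t \<le> 1/2 then 2 * t else 1)" and b: "b t = (if t \<le> 1/2 then 0 else 2 * t - 1)" for t
    by (auto simp: a_def b_def)
  have join: "loop_join p q t = \<Phi> (a t, b t)" "loop_join q p t = \<Phi> (b t, a t)" if "t \<in> ?I" for t
    using that assms(2)[of "2 * t"] assms(5)[of "2 * t - 1"] assms(3)[of "2 * t - 1"] assms(4)[of "2 * t"]
    unfolding a b loop_join_def by auto
  show "(d, loop_join p q) \<in> loop_homotopy X x"
    by (rule loop_homotopyI[OF continuous_map_compose[OF c assms(1)]])
      (simp_all add: join assms(6-8) a b)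
  show "(d, loop_join q p) \<in> loop_homotopy X x"
    by (rule loop_homotopyI[OF continuous_map_compose[OF c' assms(1)]])
      (simp_all add: join assms(6-8) a b)
qed

section \<open>The action of orthogonal matrices and rotations of the circle\<close>

lemma circle_mult_cis: "z \<in> circle \<Longrightarrow> z * cis t \<in> circle" "z \<in> circle \<Longrightarrow> cis t * z \<in> circle"
  by (simp_all add: norm_mult)

lemma circle_deriv_cong:
  assumes "\<And>z. z \<in> circle \<Longrightarrow> f z = g z" "z \<in> circle"
  shows "circle_deriv f z = circle_deriv g z"
proof -
  have "(\<lambda>\<theta>. f (z * cis \<theta>)) = (\<lambda>\<theta>. g (z * cis \<theta>))"
    using assms circle_mult_cis(1) by blast
  then show ?thesis by (simp add: circle_deriv_def)
qed

lemma smooth_on_circle_has_derivative: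
  assumes "smooth_on_circle f" "z \<in> circle"
  shows "((\<lambda>\<theta>. (circle_deriv ^^ k) f (z * cis \<theta>)) has_vector_derivative (circle_deriv ^^ Suc k) f z) (at 0)"
  using assms by (simp add: smooth_on_circle_def circle_deriv_def vector_derivative_works)

text \<open>Smoothness is defined through angular curves only. Continuity on the circle follows
  because \<open>w\<close> near \<open>z\<close> is \<open>z * cis (Arg (w / z))\<close>, and
  \<open>Arg\<close> is continuous near 1, far from its branch cut.\<close>

lemma smooth_on_circle_continuous:
  assumes "smooth_on_circle f"
  shows "continuous_on circle ((circle_deriv ^^ k) f)"
proof -
  let ?g = "(circle_deriv ^^ k) f"
  have "continuous (at z within circle) ?g" if z: "z \<in> circle" for z
  proof -
    have 1: "isCont (\<lambda>\<theta>. ?g (z * cis \<theta>)) 0"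
      using smooth_on_circle_has_derivative[OF assms z] has_vector_derivative_continuous by blast
    have 2: "isCont (\<lambda>w. Arg (w / z)) z"
      by (rule isCont_o2[OF _ continuous_at_Arg]) (use z in \<open>auto intro!: continuous_intros\<close>)
    have "z \<noteq> 0" using z by auto
    then have "isCont (\<lambda>w. ?g (z * cis (Arg (w / z)))) z"
      by (intro isCont_o2[OF 2]) (use 1 in simp)
    then have 3: "continuous (at z within circle) (\<lambda>w. ?g (z * cis (Arg (w / z))))"
      by (rule continuous_at_imp_continuous_at_within)
    have 4: "z * cis (Arg (w / z)) = w" if "w \<in> circle" for w
    proof -
      have "norm (w / z) = 1" using that z by (simp add: norm_divide)
      then have "cis (Arg (w / z)) = w / z"
        by (subst cis_Arg) (auto simp: sgn_div_norm simp del: norm_divide)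
      then show ?thesis using \<open>z \<noteq> 0\<close> by simp
    qed
    show ?thesis
      by (rule continuous_transform_within[OF 3 zero_less_one z]) (simp add: 4 del: mem_sphere_0)
  qed
  then show ?thesis by (simp add: continuous_on_eq_continuous_within)
qed

text \<open>Joint continuity suffices because the circle is compact: near a parameter
  \<open>y\<close> each derivative is uniformly close on the circle, and a basic neighbourhood
  involves only finitely many derivatives.\<close>

lemma continuous_map_Emb_topology:
  fixes G :: "'b::metric_space \<Rightarrow> complex \<Rightarrow> real ^ 4"
  assumes "\<And>y. y \<in> S \<Longrightarrow> G y \<in> Emb"
    and "\<And>k. continuous_on (S \<times> circle) (\<lambda>(y, z). (circle_deriv ^^ k) (G y) z)"
  shows "continuous_map (top_of_set S) Emb_topology G"
  unfolding continuous_map_def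
proof (intro conjI allI impI)
  show "G \<in> topspace (top_of_set S) \<rightarrow> topspace Emb_topology"
    using assms(1) by (simp add: topspace_Emb_topology)
  fix U assume U: "openin Emb_topology U"
  show "openin (top_of_set S) {x \<in> topspace (top_of_set S). G x \<in> U}"
  proof (subst openin_subopen, clarsimp)
    fix y assume y: "y \<in> S" "G y \<in> U"
    then obtain n e where ne: "e > 0" "Emb_nbhd (G y) n e \<subseteq> U"
      using U unfolding openin_Emb_topology by blast
    have "\<exists>X. open X \<and> y \<in> X \<and> (\<forall>x\<in>X \<inter> S. \<forall>z\<in>circle.
        dist ((circle_deriv ^^ k) (G x) z) ((circle_deriv ^^ k) (G y) z) < e)" for k
    proof -
      obtain X where "y \<in> X" "open X"
        "\<forall>x\<in>X \<inter> S. \<forall>z\<in>circle. dist ((circle_deriv ^^ k) (G x) z) ((circle_deriv ^^ k) (G y) z) \<le> e / 2"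
        using continuous_on_prod_compactE[OF assms(2)[of k], of y "e/2"] y ne(1) by auto
      moreover have "a \<le> e/2 \<Longrightarrow> a < e" for a using ne(1) by simp
      ultimately show ?thesis by blast
    qed
    then obtain X where X: "\<And>k. open (X k)" "\<And>k. y \<in> X k"
      "\<And>k x z. x \<in> X k \<inter> S \<Longrightarrow> z \<in> circle \<Longrightarrow>
        dist ((circle_deriv ^^ k) (G x) z) ((circle_deriv ^^ k) (G y) z) < e"
      by metis
    have "openin (top_of_set S) (S \<inter> (\<Inter>k\<le>n. X k))"
      using X(1) by (intro openin_open_Int open_INT) auto
    moreover have "G x \<in> U" if x: "x \<in> S \<inter> (\<Inter>k\<le>n. X k)" for x
    proof -
      have "G x \<in> Emb_nbhd (G y) n e"
        using assms(1) X(3) x by (auto simp: Emb_nbhd_def simp del: mem_sphere_0)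
      then show "G x \<in> U" using ne by blast
    qed
    ultimately show "\<exists>T. openin (top_of_set S) T \<and> y \<in> T \<and> T \<subseteq> {x \<in> S. G x \<in> U}"
      using X(2) y(1) by (intro exI[of _ "S \<inter> (\<Inter>k\<le>n. X k)"]) blast
  qed
qed

text \<open>The derivative along the circle commutes with linear maps and with rotations of the
  parameter. Since it sees only values on the circle, the induction may rewrite inside it by
  \<open>circle_deriv_cong\<close>.\<close>

lemma circle_deriv_matrix_rotate:
  fixes M :: "real ^ 4 ^ 4" and f :: "complex \<Rightarrow> real ^ 4"
  assumes "smooth_on_circle f" "z \<in> circle"
  shows "(circle_deriv ^^ k) (\<lambda>z\<in>circle. M *v f (cis \<tau> * z)) z = M *v (circle_deriv ^^ k) f (cis \<tau> * z)"
    and "((\<lambda>\<theta>. (circle_deriv ^^ k) (\<lambda>z\<in>circle. M *v f (cis \<tau> * z)) (z * cis \<theta>)) has_vector_derivative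
      M *v (circle_deriv ^^ Suc k) f (cis \<tau> * z)) (at 0)"
proof -
  let ?g = "\<lambda>z\<in>circle. M *v f (cis \<tau> * z)"
  have *: "((\<lambda>\<theta>. M *v (circle_deriv ^^ k) f (cis \<tau> * (z * cis \<theta>))) has_vector_derivative
      M *v (circle_deriv ^^ Suc k) f (cis \<tau> * z)) (at 0)" if "z \<in> circle" for z k
    using bounded_linear.has_vector_derivative[OF matrix_vector_mul_bounded_linear
        smooth_on_circle_has_derivative[OF assms(1), of "cis \<tau> * z" k]] that
    by (simp add: norm_mult mult.assoc)
  have 1: "\<forall>z\<in>circle. (circle_deriv ^^ k) ?g z = M *v (circle_deriv ^^ k) f (cis \<tau> * z)" for k
  proof (induction k)
    case (Suc k)
    show ?case
    proof
      fix z assume z: "z \<in> circle"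
      have "circle_deriv ((circle_deriv ^^ k) ?g) z = circle_deriv (\<lambda>z. M *v (circle_deriv ^^ k) f (cis \<tau> * z)) z"
        using Suc z by (intro circle_deriv_cong) blast+
      then show "(circle_deriv ^^ Suc k) ?g z = M *v (circle_deriv ^^ Suc k) f (cis \<tau> * z)"
        using vector_derivative_at[OF *[OF z, of k]] by (simp add: circle_deriv_def)
    qed
  qed simp
  then show "(circle_deriv ^^ k) ?g z = M *v (circle_deriv ^^ k) f (cis \<tau> * z)"
    using assms by blast
  have eq: "(\<lambda>\<theta>. (circle_deriv ^^ k) ?g (z * cis \<theta>)) = (\<lambda>\<theta>. M *v (circle_deriv ^^ k) f (cis \<tau> * (z * cis \<theta>)))"
    using 1[of k] circle_mult_cis(1)[OF assms(2)] by blast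
  show "((\<lambda>\<theta>. (circle_deriv ^^ k) ?g (z * cis \<theta>)) has_vector_derivative
      M *v (circle_deriv ^^ Suc k) f (cis \<tau> * z)) (at 0)"
    unfolding eq by (rule *[OF assms(2)])
qed

lemma matrix_rotate_Emb:
  fixes M :: "real ^ 4 ^ 4"
  assumes f: "f \<in> Emb" and M: "orthogonal_matrix M"
  shows "(\<lambda>z\<in>circle. M *v f (cis \<tau> * z)) \<in> Emb"
proof -
  let ?g = "\<lambda>z\<in>circle. M *v f (cis \<tau> * z)"
  have sm: "smooth_on_circle f" and f': "f ` circle \<subseteq> sphere 0 1" "inj_on f circle" "\<And>z. z \<in> circle \<Longrightarrow> circle_deriv f z \<noteq> 0"
    using f by (auto simp: Emb_def)
  have inj: "M *v x = M *v y \<longleftrightarrow> x = y" for x y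
    using M by (metis matrix_left_right_inverse matrix_vector_mul_assoc matrix_vector_mul_lid orthogonal_matrix_def)
  have n: "norm (M *v x) = norm x" for x
    using M orthogonal_transformation_matrix[of "(*v) M"]
    by (simp add: orthogonal_transformation matrix_of_matrix_vector_mul)
  have "smooth_on_circle ?g"
    unfolding smooth_on_circle_def
    using circle_deriv_matrix_rotate(2)[OF sm] by (metis differentiableI_vector)
  moreover have "?g ` circle \<subseteq> sphere 0 1"
    using f'(1) circle_mult_cis(2) by (auto simp: n image_subset_iff)
  moreover have "inj_on ?g circle"
  proof (rule inj_onI)
    fix x y assume xy: "x \<in> circle" "y \<in> circle" "?g x = ?g y"
    then have "f (cis \<tau> * x) = f (cis \<tau> * y)" by (simp add: inj)
    then have "cis \<tau> * x = cis \<tau> * y"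
      using f'(2) xy circle_mult_cis(2) by (meson inj_onD)
    then show "x = y" by simp
  qed
  moreover have "circle_deriv ?g z \<noteq> 0" if "z \<in> circle" for z
  proof -
    have "circle_deriv ?g z = M *v circle_deriv f (cis \<tau> * z)"
      using circle_deriv_matrix_rotate(1)[OF sm that, of 1 M \<tau>] by simp
    then show ?thesis using f'(3)[OF circle_mult_cis(2)[OF that]] inj[of _ 0] by (metis matrix_vector_mult_0_right)
  qed
  ultimately show ?thesis by (simp add: Emb_def)
qed

lemma bounded_bilinear_matrix_vector_mult:
  "bounded_bilinear (\<lambda>(M :: real ^ 'n ^ 'm) x. M *v x)"
proof -
  have "bilinear (\<lambda>(M :: real ^ 'n ^ 'm) x. M *v x)"
    unfolding bilinear_def
    by (intro conjI allI linearI) (simp_all add: matrix_vector_right_distrib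
        matrix_vector_mult_add_rdistrib scaleR_matrix_vector_assoc matrix_vector_mult_scaleR)
  then show ?thesis
    by (simp add: bilinear_conv_bounded_bilinear)
qed

lemmas continuous_on_matrix_vector_mult [continuous_intros] =
  bounded_bilinear.continuous_on[OF bounded_bilinear_matrix_vector_mult]

text \<open>\<open>Repar f\<close>, \<open>Rot f\<close>, \<open>Roll N f\<close> and all homotopies
  between them arise from this action of orthogonal matrices and parameter rotations, so homotopies
  of knots reduce to continuous families of matrices and angles.\<close>

lemma continuous_map_matrix_rotate:
  fixes M :: "'b::metric_space \<Rightarrow> real ^ 4 ^ 4" and \<tau> :: "'b \<Rightarrow> real"
  assumes f: "f \<in> Emb" and M: "\<And>y. y \<in> S \<Longrightarrow> orthogonal_matrix (M y)"
    and cont: "continuous_on S M" "continuous_on S \<tau>"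
  shows "continuous_map (top_of_set S) Emb_topology (\<lambda>y. \<lambda>z\<in>circle. M y *v f (cis (\<tau> y) * z))"
proof (rule continuous_map_Emb_topology)
  show "(\<lambda>z\<in>circle. M y *v f (cis (\<tau> y) * z)) \<in> Emb" if "y \<in> S" for y
    using matrix_rotate_Emb[OF f M[OF that]] .
  fix k
  have sm: "smooth_on_circle f" using f by (simp add: Emb_def)
  have "continuous_on (S \<times> circle) (\<lambda>x. M (fst x) *v (circle_deriv ^^ k) f (cis (\<tau> (fst x)) * snd x))"
    unfolding cis_conv_exp
    by (intro continuous_intros continuous_on_compose2[OF cont(1)] continuous_on_compose2[OF cont(2)]
        continuous_on_compose2[OF smooth_on_circle_continuous[OF sm, of k]]) (auto simp: norm_mult)
  then show "continuous_on (S \<times> circle)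
      (\<lambda>(y, z). (circle_deriv ^^ k) (\<lambda>z\<in>circle. M y *v f (cis (\<tau> y) * z)) z)"
    by (rule continuous_on_eq) (auto simp: circle_deriv_matrix_rotate(1)[OF sm])
qed

section \<open>Spinors and the Hopf map\<close>

text \<open>A vector \<open>(x, y, z)\<close> is represented by the pair \<open>(x, y + iz)\<close>.\<close>

type_synonym spinor = "complex \<times> complex"
type_synonym vec3 = "real \<times> complex"

text \<open>The Hopf fibration, as the vector of expectation values of the Pauli matrices. Over a
  unit vector its fibre in the unit spinors is a circle of phases.\<close>

definition hopf :: "spinor \<Rightarrow> vec3"
  where "hopf \<psi> = ((cmod (fst \<psi>))\<^sup>2 - (cmod (snd \<psi>))\<^sup>2, 2 * cnj (fst \<psi>) * snd \<psi>)"

definition herm :: "spinor \<Rightarrow> spinor \<Rightarrow> complex"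
  where "herm \<psi> \<phi> = cnj (fst \<psi>) * fst \<phi> + cnj (snd \<psi>) * snd \<phi>"

definition sdet :: "spinor \<Rightarrow> spinor \<Rightarrow> complex"
  where "sdet \<psi> \<phi> = fst \<psi> * snd \<phi> - snd \<psi> * fst \<phi>"

definition cscale :: "complex \<Rightarrow> spinor \<Rightarrow> spinor"
  where "cscale c \<psi> = (c * fst \<psi>, c * snd \<psi>)"

text \<open>The quaternionic structure: \<open>sperp \<psi>\<close> is Hermitian-orthogonal to
  \<open>\<psi>\<close> and lies over the opposite direction. Pairing with it gives
  \<open>sdet \<psi>\<close>.\<close>

definition sperp :: "spinor \<Rightarrow> spinor"
  where "sperp \<psi> = (- cnj (snd \<psi>), cnj (fst \<psi>))"

text \<open>Clifford multiplication: the traceless Hermitian matrix of the vector \<open>a\<close>,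
  whose square is \<open>(norm a)\<^sup>2\<close>.\<close>

definition pauli :: "vec3 \<Rightarrow> spinor \<Rightarrow> spinor"
  where "pauli a \<psi> = (of_real (fst a) * fst \<psi> + cnj (snd a) * snd \<psi>,
    snd a * fst \<psi> - of_real (fst a) * snd \<psi>)"

text \<open>The polarisation of the quadratic map \<open>hopf\<close>; twice it is the differential
  of \<open>hopf\<close>.\<close>

definition hopf2 :: "spinor \<Rightarrow> spinor \<Rightarrow> vec3"
  where "hopf2 \<psi> \<phi> = (Re (cnj (fst \<psi>) * fst \<phi>) - Re (cnj (snd \<psi>) * snd \<phi>),
    cnj (fst \<psi>) * snd \<phi> + cnj (fst \<phi>) * snd \<psi>)"

definition triple :: "vec3 \<Rightarrow> vec3 \<Rightarrow> vec3 \<Rightarrow> real"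
  where "triple a b c = fst a * Im (cnj (snd b) * snd c) + fst b * Im (cnj (snd c) * snd a)
    + fst c * Im (cnj (snd a) * snd b)"

lemma hopf_eq_hopf2: "hopf \<psi> = hopf2 \<psi> \<psi>"
  unfolding hopf_def hopf2_def cmod_power2 by (simp add: power2_eq_square)

lemma norm_spinor: "(norm \<psi>)\<^sup>2 = (cmod (fst \<psi>))\<^sup>2 + (cmod (snd \<psi>))\<^sup>2" for \<psi> :: spinor
  by (cases \<psi>) (simp add: norm_Pair)

lemma norm_vec3: "(norm a)\<^sup>2 = (fst a)\<^sup>2 + (cmod (snd a))\<^sup>2" for a :: vec3
  by (cases a) (simp add: norm_Pair)

lemmas spinor_defs = hopf_def herm_def sdet_def cscale_def sperp_def pauli_def hopf2_def triple_def
  norm_spinor norm_vec3 cmod_power2 inner_prod_def inner_complex_def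

lemma herm_self: "herm \<psi> \<psi> = of_real ((norm \<psi>)\<^sup>2)"
  unfolding spinor_defs complex_eq_iff by (simp add: power2_eq_square)

lemma norm_hopf: "norm (hopf \<psi>) = (norm \<psi>)\<^sup>2"
proof -
  have "(norm (hopf \<psi>))\<^sup>2 = ((norm \<psi>)\<^sup>2)\<^sup>2"
    unfolding spinor_defs by (simp add: power2_eq_square algebra_simps)
  then show ?thesis by (rule power2_eq_imp_eq) auto
qed

lemma hopf_cscale: "hopf (cscale c \<psi>) = (cmod c)\<^sup>2 *\<^sub>R hopf \<psi>"
  unfolding spinor_defs prod_eq_iff complex_eq_iff by (simp add: cmod_power2 power2_eq_square algebra_simps)

lemma norm_cscale: "norm (cscale c \<psi>) = cmod c * norm \<psi>"
proof -
  have "(norm (cscale c \<psi>))\<^sup>2 = (cmod c * norm \<psi>)\<^sup>2"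
    unfolding power_mult_distrib spinor_defs by (simp add: power2_eq_square algebra_simps)
  then show ?thesis by (rule power2_eq_imp_eq) auto
qed

text \<open>For unit spinors this is the squared sine of half the angle between the two directions,
  and \<open>norm_herm\<close> is the squared cosine. So \<open>sdet\<close> detects equal
  directions and \<open>herm\<close> antipodal ones.\<close>

lemma norm_sdet: "(cmod (sdet \<psi> \<phi>))\<^sup>2 = ((norm \<psi>)\<^sup>2 * (norm \<phi>)\<^sup>2 - hopf \<psi> \<bullet> hopf \<phi>) / 2"
  unfolding spinor_defs by (simp add: power2_eq_square field_simps)

lemma norm_herm: "(cmod (herm \<psi> \<phi>))\<^sup>2 = ((norm \<psi>)\<^sup>2 * (norm \<phi>)\<^sup>2 + hopf \<psi> \<bullet> hopf \<phi>) / 2"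
  unfolding spinor_defs by (simp add: power2_eq_square field_simps)

lemma unit_inner_eq_1: "a = b" if "norm a = 1" "norm b = 1" "a \<bullet> b = 1" for a b :: "'a::real_inner"
proof -
  have "(norm (a - b))\<^sup>2 = 0"
    using that by (simp add: power2_norm_eq_inner inner_diff inner_commute norm_eq_1)
  then show ?thesis by simp
qed

lemma sdet_eq_0:
  assumes "norm \<psi> = 1" "norm \<phi> = 1" "sdet \<psi> \<phi> = 0"
  shows "hopf \<psi> = hopf \<phi>"
proof (rule unit_inner_eq_1)
  show "hopf \<psi> \<bullet> hopf \<phi> = 1" using norm_sdet[of \<psi> \<phi>] assms by simp
qed (simp_all add: norm_hopf assms)

lemma herm_eq_0:
  assumes "norm \<psi> = 1" "norm \<phi> = 1" "herm \<psi> \<phi> = 0"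
  shows "hopf \<psi> = - hopf \<phi>"
proof (rule unit_inner_eq_1)
  show "hopf \<psi> \<bullet> - hopf \<phi> = 1" using norm_herm[of \<psi> \<phi>] assms by simp
qed (simp_all add: norm_hopf assms)

text \<open>\<open>\<psi>\<close> and \<open>sperp \<psi>\<close> are orthogonal and of equal norm,
  and \<open>herm\<close> and \<open>sdet\<close> are the coordinates with respect to them.\<close>

lemma spinor_expansion:
  "(norm \<psi>)\<^sup>2 *\<^sub>R \<phi> = cscale (herm \<psi> \<phi>) \<psi> + cscale (sdet \<psi> \<phi>) (sperp \<psi>)"
  unfolding spinor_defs prod_eq_iff complex_eq_iff by (simp add: power2_eq_square algebra_simps)

lemma same_hopf:
  assumes "norm \<psi> = 1" "norm \<phi> = 1" "hopf \<psi> = hopf \<phi>"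
  shows "\<phi> = cscale (herm \<psi> \<phi>) \<psi>" "cmod (herm \<psi> \<phi>) = 1"
proof -
  have 1: "hopf \<phi> \<bullet> hopf \<phi> = 1"
    using assms(2) by (metis norm_eq_1 norm_hopf one_power2)
  then have "sdet \<psi> \<phi> = 0"
    using norm_sdet[of \<psi> \<phi>] assms by simp
  then show "\<phi> = cscale (herm \<psi> \<phi>) \<psi>"
    using spinor_expansion[of \<psi> \<phi>] assms(1) by (simp add: cscale_def zero_prod_def)
  have "(cmod (herm \<psi> \<phi>))\<^sup>2 = 1"
    using norm_herm[of \<psi> \<phi>] assms 1 by simp
  then show "cmod (herm \<psi> \<phi>) = 1" by (simp add: power2_eq_1_iff) (metis norm_ge_zero neg_0_le_iff_le not_one_le_zero)
qed

text \<open>Up to radial vectors, which the triple product ignores, the differential of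
  \<open>hopf\<close> sees only the \<open>sperp\<close> components of its arguments. The
  pulled-back area form is therefore a multiple of their planar area form.\<close>

lemma triple_hopf:
  "triple (hopf \<psi>) (2 *\<^sub>R hopf2 \<psi> \<alpha>) (2 *\<^sub>R hopf2 \<psi> \<beta>) = 4 * (norm \<psi>)\<^sup>2 * Im (cnj (sdet \<psi> \<alpha>) * sdet \<psi> \<beta>)"
proof -
  obtain z1 z2 w1 w2 where "\<psi> = (Complex z1 z2, Complex w1 w2)" by (metis complex_surj surj_pair)
  moreover obtain a1 a2 b1 b2 where "\<alpha> = (Complex a1 a2, Complex b1 b2)" by (metis complex_surj surj_pair)
  moreover obtain c1 c2 d1 d2 where "\<beta> = (Complex c1 c2, Complex d1 d2)" by (metis complex_surj surj_pair)
  ultimately show ?thesis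
    unfolding spinor_defs by (simp add: power2_eq_square algebra_simps)
qed

text \<open>The form \<open>Im herm\<close> splits into a part along \<open>\<psi>\<close> and a
  part along \<open>sperp \<psi>\<close>. For derivatives of unit spinors the coefficients along
  \<open>\<psi>\<close> are imaginary, their product is real, and only the term of
  \<open>triple_hopf\<close> remains.\<close>

lemma Im_herm:
  "(norm \<psi>)\<^sup>2 * Im (herm \<alpha> \<beta>)
    = Im (cnj (herm \<psi> \<alpha>) * herm \<psi> \<beta>) + Im (cnj (sdet \<psi> \<alpha>) * sdet \<psi> \<beta>)"
  unfolding spinor_defs by (simp add: power2_eq_square algebra_simps)

lemma pauli_eigen:
  assumes "pauli a \<psi> = \<psi>"
  shows "hopf \<psi> = (norm \<psi>)\<^sup>2 *\<^sub>R a"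
proof -
  obtain h \<zeta> z w where [simp]: "a = (h, \<zeta>)" "\<psi> = (z, w)" by fastforce
  have 1: "of_real h * z + cnj \<zeta> * w = z" and 2: "\<zeta> * z - of_real h * w = w"
    using assms by (auto simp: pauli_def)
  have 3: "of_real h * cnj z + \<zeta> * cnj w = cnj z" and 4: "cnj \<zeta> * cnj z - of_real h * cnj w = cnj w"
    using arg_cong[OF 1, of cnj] arg_cong[OF 2, of cnj] by auto
  have "2 * cnj z * w = cnj z * (\<zeta> * z - of_real h * w) + (of_real h * cnj z + \<zeta> * cnj w) * w"
    unfolding 2 3 by simp
  then have "2 * cnj z * w = (z * cnj z + w * cnj w) * \<zeta>"
    by (simp add: algebra_simps)
  moreover have "cnj z * (of_real h * z + cnj \<zeta> * w) - (cnj \<zeta> * cnj z - of_real h * cnj w) * w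
      = cnj z * z - cnj w * w"
    unfolding 1 4 by simp
  then have "z * cnj z - w * cnj w = (z * cnj z + w * cnj w) * of_real h"
    by (simp add: algebra_simps)
  then have "complex_of_real ((cmod z)\<^sup>2 - (cmod w)\<^sup>2) = of_real (((cmod z)\<^sup>2 + (cmod w)\<^sup>2) * h)"
    by (simp add: complex_norm_square of_real_mult del: of_real_power)
  then have "(cmod z)\<^sup>2 - (cmod w)\<^sup>2 = ((cmod z)\<^sup>2 + (cmod w)\<^sup>2) * h"
    by (simp only: of_real_eq_iff)
  ultimately show ?thesis
    by (simp add: hopf_def norm_spinor scaleR_conv_of_real complex_norm_square del: of_real_power)
qed

lemma pauli_pauli: "pauli a (pauli a \<psi>) = (norm a)\<^sup>2 *\<^sub>R \<psi>"
  unfolding spinor_defs prod_eq_iff complex_eq_iff by (simp add: power2_eq_square algebra_simps)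

lemma pauli_add: "pauli a (\<psi> + \<phi>) = pauli a \<psi> + pauli a \<phi>"
  "pauli (a + b) \<psi> = pauli a \<psi> + pauli b \<psi>"
  "pauli a (c *\<^sub>R \<psi>) = c *\<^sub>R pauli a \<psi>" "pauli (c *\<^sub>R a) \<psi> = c *\<^sub>R pauli a \<psi>"
  by (simp_all add: pauli_def prod_eq_iff algebra_simps scaleR_conv_of_real)

lemma norm_proj: "(norm (\<psi> + pauli a \<psi>))\<^sup>2 = (1 + (norm a)\<^sup>2) * (norm \<psi>)\<^sup>2 + 2 * (a \<bullet> hopf \<psi>)"
  unfolding spinor_defs by (simp add: power2_eq_square algebra_simps)

text \<open>
  Half of \<open>\<psi> + pauli a \<psi>\<close> is the orthogonal projection of \<open>\<psi>\<close> to the spinors over the unit vector \<open>a\<close>.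
\<close>

definition nproj :: "vec3 \<Rightarrow> spinor \<Rightarrow> spinor"
  where "nproj a \<psi> = (1 / norm (\<psi> + pauli a \<psi>)) *\<^sub>R (\<psi> + pauli a \<psi>)"

text \<open>The projection degenerates only over the antipode, because the squared norm of
  \<open>\<psi> + pauli a \<psi>\<close> is \<open>2 + 2 * (a \<bullet> hopf \<psi>)\<close>. Its
  image is fixed by \<open>pauli a\<close>, whose square is the identity, and so lies over
  \<open>a\<close>.\<close>

lemma nproj:
  assumes a: "norm a = 1" and "norm \<psi> = 1" "hopf \<psi> \<noteq> - a"
  shows "\<psi> + pauli a \<psi> \<noteq> 0" "norm (nproj a \<psi>) = 1" "hopf (nproj a \<psi>) = a"
proof -
  show 0: "\<psi> + pauli a \<psi> \<noteq> 0"
  proof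
    assume "\<psi> + pauli a \<psi> = 0"
    then have "(- a) \<bullet> hopf \<psi> = 1" using norm_proj[of \<psi> a] assms by simp
    then have "- a = hopf \<psi>" by (rule unit_inner_eq_1[rotated 2]) (use assms in \<open>simp_all add: norm_hopf\<close>)
    then show False using assms by auto
  qed
  then show 1: "norm (nproj a \<psi>) = 1" by (simp add: nproj_def)
  have "pauli a (nproj a \<psi>) = nproj a \<psi>"
    using a by (simp add: nproj_def pauli_add pauli_pauli add.commute)
  from pauli_eigen[OF this] 1 show "hopf (nproj a \<psi>) = a" by simp
qed

text \<open>At least one of the two basis spinors does not lie over \<open>- a\<close>, and its
  projection is then a lift of \<open>a\<close>.\<close>

lemma hopf_surj:
  assumes "norm a = 1"
  obtains \<psi> where "norm \<psi> = 1" "hopf \<psi> = a"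
proof (cases "hopf (1, 0) = - a")
  case True
  then have "hopf (0, 1) \<noteq> - a" by (simp add: hopf_def flip: True)
  from nproj[OF assms _ this] that show ?thesis by (auto simp: norm_Pair)
next
  case False
  from nproj[OF assms _ this] that show ?thesis by (auto simp: norm_Pair)
qed

text \<open>Differentiating a normalised vector adds multiples of that vector; a triple product with
  it in first place ignores them.\<close>

lemma triple_scale: "triple (c *\<^sub>R a) (c *\<^sub>R b + x *\<^sub>R a) (c *\<^sub>R d + y *\<^sub>R a) = c ^ 3 * triple a b d"
  unfolding triple_def by (simp add: power3_eq_cube algebra_simps)

section \<open>Functions with continuous mixed derivatives\<close>

text \<open>The regularity that Stokes on a rectangle uses: both partials and a common mixed
  partial, but no pure second derivatives. The partials are carried as explicit functions because
  the curvature computation needs their form.\<close>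

definition mixed_C1 :: "(real \<times> real) set \<Rightarrow> (real \<times> real \<Rightarrow> 'a::real_normed_vector) \<Rightarrow>
    (real \<times> real \<Rightarrow> 'a) \<Rightarrow> (real \<times> real \<Rightarrow> 'a) \<Rightarrow> (real \<times> real \<Rightarrow> 'a) \<Rightarrow> bool"
  where "mixed_C1 S f f1 f2 f12 \<longleftrightarrow>
    continuous_on S f \<and> continuous_on S f1 \<and> continuous_on S f2 \<and> continuous_on S f12 \<and>
    (\<forall>s t. (s, t) \<in> S \<longrightarrow>
      ((\<lambda>x. f (x, t)) has_vector_derivative f1 (s, t)) (at s) \<and>
      ((\<lambda>y. f (s, y)) has_vector_derivative f2 (s, t)) (at t) \<and>
      ((\<lambda>y. f1 (s, y)) has_vector_derivative f12 (s, t)) (at t) \<and>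
      ((\<lambda>x. f2 (x, t)) has_vector_derivative f12 (s, t)) (at s))"

lemma mixed_C1D:
  assumes "mixed_C1 S f f1 f2 f12"
  shows "continuous_on S f" "continuous_on S f1" "continuous_on S f2" "continuous_on S f12"
    "(s, t) \<in> S \<Longrightarrow> ((\<lambda>x. f (x, t)) has_vector_derivative f1 (s, t)) (at s)"
    "(s, t) \<in> S \<Longrightarrow> ((\<lambda>y. f (s, y)) has_vector_derivative f2 (s, t)) (at t)"
    "(s, t) \<in> S \<Longrightarrow> ((\<lambda>y. f1 (s, y)) has_vector_derivative f12 (s, t)) (at t)"
    "(s, t) \<in> S \<Longrightarrow> ((\<lambda>x. f2 (x, t)) has_vector_derivative f12 (s, t)) (at s)"
  using assms unfolding mixed_C1_def by blast+

lemma mixed_C1_const: "mixed_C1 S (\<lambda>x. c) (\<lambda>x. 0) (\<lambda>x. 0) (\<lambda>x. 0)"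
  by (simp add: mixed_C1_def)

lemma mixed_C1_add:
  assumes "mixed_C1 S f f1 f2 f12" "mixed_C1 S g g1 g2 g12"
  shows "mixed_C1 S (\<lambda>x. f x + g x) (\<lambda>x. f1 x + g1 x) (\<lambda>x. f2 x + g2 x) (\<lambda>x. f12 x + g12 x)"
  using assms unfolding mixed_C1_def
  by (auto intro!: has_vector_derivative_add continuous_intros)

lemma mixed_C1_bilinear:
  assumes "bounded_bilinear B" "mixed_C1 S f f1 f2 f12" "mixed_C1 S g g1 g2 g12"
  shows "mixed_C1 S (\<lambda>x. B (f x) (g x)) (\<lambda>x. B (f x) (g1 x) + B (f1 x) (g x))
    (\<lambda>x. B (f x) (g2 x) + B (f2 x) (g x))
    (\<lambda>x. (B (f x) (g12 x) + B (f2 x) (g1 x)) + (B (f1 x) (g2 x) + B (f12 x) (g x)))"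
proof -
  note c = bounded_bilinear.continuous_on[OF assms(1)]
  note d = bounded_bilinear.has_vector_derivative[OF assms(1)]
  note f = mixed_C1D[OF assms(2)] and g = mixed_C1D[OF assms(3)]
  have "((\<lambda>x. B (f (x, t)) (g2 (x, t)) + B (f2 (x, t)) (g (x, t))) has_vector_derivative
      (B (f (s,t)) (g12 (s,t)) + B (f2 (s,t)) (g1 (s,t))) + (B (f1 (s,t)) (g2 (s,t)) + B (f12 (s,t)) (g (s,t)))) (at s)"
    if "(s, t) \<in> S" for s t
    using has_vector_derivative_add[OF d[OF f(5) g(8)] d[OF f(8) g(5)]] that by (simp add: algebra_simps)
  moreover have "((\<lambda>y. B (f (s, y)) (g1 (s, y)) + B (f1 (s, y)) (g (s, y))) has_vector_derivative
      (B (f (s,t)) (g12 (s,t)) + B (f2 (s,t)) (g1 (s,t))) + (B (f1 (s,t)) (g2 (s,t)) + B (f12 (s,t)) (g (s,t)))) (at t)"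
    if "(s, t) \<in> S" for s t
    using has_vector_derivative_add[OF d[OF f(6) g(7)] d[OF f(7) g(6)]] that by (simp add: algebra_simps)
  ultimately show ?thesis
    unfolding mixed_C1_def using f g
    by (auto intro!: d continuous_on_add c)
qed

lemma mixed_C1_compose_real:
  fixes g g' g'' :: "real \<Rightarrow> real"
  assumes f: "mixed_C1 S f f1 f2 f12" and im: "\<And>x. x \<in> S \<Longrightarrow> f x \<in> T"
    and g: "\<And>x. x \<in> T \<Longrightarrow> (g has_real_derivative g' x) (at x)"
    and g': "\<And>x. x \<in> T \<Longrightarrow> (g' has_real_derivative g'' x) (at x)"
    and g'': "continuous_on T g''"
  shows "mixed_C1 S (\<lambda>x. g (f x)) (\<lambda>x. g' (f x) * f1 x) (\<lambda>x. g' (f x) * f2 x)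
    (\<lambda>x. g' (f x) * f12 x + g'' (f x) * f2 x * f1 x)"
proof -
  note f = mixed_C1D[OF f]
  note f' = f(5-8)[unfolded has_real_derivative_iff_has_vector_derivative[symmetric]]
  have c: "continuous_on T g" "continuous_on T g'"
    using g g' by (meson DERIV_continuous_on has_field_derivative_at_within)+
  have c': "continuous_on S (\<lambda>x. g (f x))" "continuous_on S (\<lambda>x. g' (f x))" "continuous_on S (\<lambda>x. g'' (f x))"
    using im by (auto intro!: continuous_on_compose2[OF c(1) f(1)] continuous_on_compose2[OF c(2) f(1)]
        continuous_on_compose2[OF g'' f(1)])
  have 1: "((\<lambda>x. g (f (x, t))) has_real_derivative g' (f (s, t)) * f1 (s, t)) (at s)"
    "((\<lambda>y. g (f (s, y))) has_real_derivative g' (f (s, t)) * f2 (s, t)) (at t)"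
    "((\<lambda>x. g' (f (x, t))) has_real_derivative g'' (f (s, t)) * f1 (s, t)) (at s)"
    "((\<lambda>y. g' (f (s, y))) has_real_derivative g'' (f (s, t)) * f2 (s, t)) (at t)" if "(s, t) \<in> S" for s t
    by (rule DERIV_chain2[OF g[OF im[OF that]] f'(1)[OF that]] DERIV_chain2[OF g[OF im[OF that]] f'(2)[OF that]]
      DERIV_chain2[OF g'[OF im[OF that]] f'(1)[OF that]] DERIV_chain2[OF g'[OF im[OF that]] f'(2)[OF that]])+
  have 2: "((\<lambda>y. g' (f (s, y)) * f1 (s, y)) has_real_derivative
      g' (f (s, t)) * f12 (s, t) + g'' (f (s, t)) * f2 (s, t) * f1 (s, t)) (at t)"
    "((\<lambda>x. g' (f (x, t)) * f2 (x, t)) has_real_derivative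
      g' (f (s, t)) * f12 (s, t) + g'' (f (s, t)) * f2 (s, t) * f1 (s, t)) (at s)" if "(s, t) \<in> S" for s t
    using DERIV_mult[OF 1(4)[OF that] f'(3)[OF that]] DERIV_mult[OF 1(3)[OF that] f'(4)[OF that]]
    by (simp_all add: algebra_simps)
  show ?thesis
    unfolding mixed_C1_def has_real_derivative_iff_has_vector_derivative[symmetric]
    using 1 2 c' f by (auto intro!: continuous_intros)
qed

lemma mixed_C1_dilate:
  assumes "mixed_C1 S f f1 f2 f12" "\<And>x. x \<in> T \<Longrightarrow> k *\<^sub>R x \<in> S"
  shows "mixed_C1 T (\<lambda>x. f (k *\<^sub>R x)) (\<lambda>x. k *\<^sub>R f1 (k *\<^sub>R x)) (\<lambda>x. k *\<^sub>R f2 (k *\<^sub>R x)) (\<lambda>x. k *\<^sub>R k *\<^sub>R f12 (k *\<^sub>R x))"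
proof -
  note f = mixed_C1D[OF assms(1)]
  have c: "continuous_on T (\<lambda>x. h (k *\<^sub>R x))" if "continuous_on S h" for h :: "_ \<Rightarrow> 'a"
    by (rule continuous_on_compose2[OF that]) (intro continuous_intros, use assms(2) in blast)
  have d: "((\<lambda>x. h (k * x)) has_vector_derivative k *\<^sub>R h') (at s)"
    if "(h has_vector_derivative h') (at (k * s))" for h :: "_ \<Rightarrow> 'a" and h' s
  proof -
    have "((\<lambda>x. k * x) has_vector_derivative k) (at s)"
      unfolding has_real_derivative_iff_has_vector_derivative[symmetric] by (auto intro!: derivative_eq_intros)
    from vector_diff_chain_at[OF this that] show ?thesis by (simp add: o_def)
  qed
  have d': "((\<lambda>x. k *\<^sub>R h (k * x)) has_vector_derivative k *\<^sub>R k *\<^sub>R h') (at s)"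
    if "(h has_vector_derivative h') (at (k * s))" for h :: "_ \<Rightarrow> 'a" and h' s
    by (rule bounded_linear.has_vector_derivative[OF bounded_linear_scaleR_right d[OF that]])
  have m: "(k * s, k * t) \<in> S" if "(s, t) \<in> T" for s t using assms(2)[OF that] by simp
  show ?thesis
    unfolding mixed_C1_def
    using d[OF f(5)[OF m]] d[OF f(6)[OF m]] d'[OF f(7)[OF m]] d'[OF f(8)[OF m]]
    by (auto intro!: continuous_on_scaleR continuous_intros c f(1-4) simp del: scaleR_scaleR)
qed

text \<open>The factor \<open>1 / norm\<close> is treated as the power -1/2 of the squared norm,
  which is smooth away from zero. It is returned with its partials to show that the partials of the
  unit vector are scaled partials of \<open>f\<close> plus radial terms.\<close>

lemma mixed_C1_normalize:
  fixes f :: "real \<times> real \<Rightarrow> 'a::real_inner"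
  assumes f: "mixed_C1 S f f1 f2 f12" and nz: "\<And>x. x \<in> S \<Longrightarrow> f x \<noteq> 0"
  obtains r r1 r2 r12 where "mixed_C1 S r r1 r2 r12" "\<And>x. r x = 1 / norm (f x)"
    "mixed_C1 S (\<lambda>x. (1 / norm (f x)) *\<^sub>R f x) (\<lambda>x. r x *\<^sub>R f1 x + r1 x *\<^sub>R f x)
      (\<lambda>x. r x *\<^sub>R f2 x + r2 x *\<^sub>R f x)
      (\<lambda>x. (r x *\<^sub>R f12 x + r2 x *\<^sub>R f1 x) + (r1 x *\<^sub>R f2 x + r12 x *\<^sub>R f x))"
proof -
  have c: "continuous_on {0<..} (\<lambda>x::real. 3/4 * x powr (-5/2))"
    by (intro continuous_intros) auto
  have d: "((\<lambda>x. x powr (-1/2)) has_real_derivative -1/2 * x powr (-3/2)) (at x)"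
    "((\<lambda>x. -1/2 * x powr (-3/2)) has_real_derivative 3/4 * x powr (-5/2)) (at x)" if "x \<in> {0<..}" for x :: real
    using has_real_derivative_powr[of x "-1/2"] DERIV_cmult[OF has_real_derivative_powr[of x "-3/2"], of "-1/2"] that
    by simp_all
  obtain r1 r2 r12 where r: "mixed_C1 S (\<lambda>x. (f x \<bullet> f x) powr (-1/2)) r1 r2 r12"
    by (rule that[OF mixed_C1_compose_real[OF mixed_C1_bilinear[OF bounded_bilinear_inner f f] _ d c]])
      (simp add: nz)
  have eq: "(f x \<bullet> f x) powr (-1/2) = 1 / norm (f x)" for x
    using powr_half_sqrt[of "f x \<bullet> f x"] powr_minus_divide[of "f x \<bullet> f x" "1/2"]
    by (simp add: norm_eq_sqrt_inner)
  from mixed_C1_bilinear[OF bounded_bilinear_scaleR r f] r show ?thesis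
    unfolding eq by (rule that[rotated -1]) (rule refl)
qed

section \<open>Lifts through the Hopf map\<close>

lemma bounded_bilinear_pauli: "bounded_bilinear pauli"
proof -
  have "bilinear pauli" unfolding bilinear_def by (intro conjI allI linearI) (simp_all add: pauli_add)
  then show ?thesis by (simp add: bilinear_conv_bounded_bilinear)
qed

lemma bounded_bilinear_herm: "bounded_bilinear herm"
proof -
  have "bilinear herm" unfolding bilinear_def
    by (intro conjI allI linearI) (simp_all add: herm_def algebra_simps scaleR_conv_of_real)
  then show ?thesis by (simp add: bilinear_conv_bounded_bilinear)
qed

lemma bounded_bilinear_hopf2: "bounded_bilinear hopf2"
proof -
  have "bilinear hopf2" unfolding bilinear_def
    by (intro conjI allI linearI) (simp_all add: hopf2_def prod_eq_iff algebra_simps scaleR_conv_of_real)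
  then show ?thesis by (simp add: bilinear_conv_bounded_bilinear)
qed

lemma bounded_bilinear_cscale: "bounded_bilinear cscale"
proof -
  have "bilinear cscale" unfolding bilinear_def
    by (intro conjI allI linearI) (simp_all add: cscale_def prod_eq_iff algebra_simps scaleR_conv_of_real)
  then show ?thesis by (simp add: bilinear_conv_bounded_bilinear)
qed

lemma cnj_herm: "cnj (herm \<psi> \<phi>) = herm \<phi> \<psi>"
  by (simp add: herm_def algebra_simps)

lemma herm_cscale: "herm (cscale c \<psi>) \<phi> = cnj c * herm \<psi> \<phi>" "herm \<psi> (cscale c \<phi>) = c * herm \<psi> \<phi>"
  by (simp_all add: herm_def cscale_def algebra_simps)

lemma cscale_cscale: "cscale c (cscale d \<psi>) = cscale (c * d) \<psi>"
  by (simp add: cscale_def)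

text \<open>Differentiating \<open>herm (\<psi> x) (\<psi> x) = 1\<close> gives two terms that are
  conjugate to each other.\<close>

lemma herm_derivative_imaginary:
  assumes d: "(\<psi> has_vector_derivative \<psi>') (at t)" and "open I" "t \<in> I" "\<And>x. x \<in> I \<Longrightarrow> norm (\<psi> x) = 1"
  shows "Re (herm (\<psi> t) \<psi>') = 0"
proof -
  have "((\<lambda>x. herm (\<psi> x) (\<psi> x)) has_vector_derivative herm (\<psi> t) \<psi>' + herm \<psi>' (\<psi> t)) (at t)"
    by (rule bounded_bilinear.has_vector_derivative[OF bounded_bilinear_herm d d])
  moreover have "((\<lambda>x. herm (\<psi> x) (\<psi> x)) has_vector_derivative 0) (at t)"
    by (rule has_vector_derivative_transform_within_open[of "\<lambda>x. 1" _ _ I])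
      (use assms in \<open>auto simp: herm_self\<close>)
  ultimately have "herm (\<psi> t) \<psi>' + herm \<psi>' (\<psi> t) = 0"
    by (rule vector_derivative_unique_at)
  then have "Re (herm (\<psi> t) \<psi>' + cnj (herm (\<psi> t) \<psi>')) = 0"
    unfolding cnj_herm by simp
  then show ?thesis by simp
qed

lemma mixed_C1_nproj:
  assumes a: "mixed_C1 S a a1 a2 a12" and \<phi>: "mixed_C1 S \<phi> \<phi>1 \<phi>2 \<phi>12"
    and "\<And>x. x \<in> S \<Longrightarrow> norm (a x) = 1 \<and> norm (\<phi> x) = 1 \<and> hopf (\<phi> x) \<noteq> - a x"
  obtains \<psi>1 \<psi>2 \<psi>12 where "mixed_C1 S (\<lambda>x. nproj (a x) (\<phi> x)) \<psi>1 \<psi>2 \<psi>12"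
proof -
  note m = mixed_C1_add[OF \<phi> mixed_C1_bilinear[OF bounded_bilinear_pauli a \<phi>]]
  show ?thesis
    unfolding nproj_def by (rule mixed_C1_normalize[OF m], use nproj(1) assms(3) in blast, rule that[unfolded nproj_def], assumption)
qed

text \<open>The lift is transported along rays in steps so short that consecutive directions are
  never antipodal.\<close>

lemma mixed_C1_hopf_lift:
  assumes F: "mixed_C1 UNIV F F1 F2 F12" and unit: "\<And>x. norm (F x) = 1"
  obtains \<psi> \<psi>1 \<psi>2 \<psi>12 where "mixed_C1 (ball 0 R) \<psi> \<psi>1 \<psi>2 \<psi>12"
    "\<And>x. x \<in> ball 0 R \<Longrightarrow> norm (\<psi> x) = 1" "\<And>x. x \<in> ball 0 R \<Longrightarrow> hopf (\<psi> x) = F x"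
proof -
  have "uniformly_continuous_on (cball 0 R) F"
    using mixed_C1D(1)[OF F] by (intro compact_uniformly_continuous) (auto intro: continuous_on_subset)
  then obtain d where d: "d > 0" "\<And>x y. x \<in> cball 0 R \<Longrightarrow> y \<in> cball 0 R \<Longrightarrow> dist y x < d \<Longrightarrow> dist (F y) (F x) < 2"
    unfolding uniformly_continuous_on_def by (meson zero_less_numeral)
  obtain n :: nat where n: "n > 0" "R / n < d"
  proof -
    obtain n :: nat where "n > \<bar>R / d\<bar>" using reals_Archimedean2 by blast
    moreover from this have "n > 0" by (metis abs_ge_zero le_less_trans of_nat_0_less_iff)
    moreover have "R / n < d"
    proof -
      have "R / d < n" using \<open>n > \<bar>R / d\<bar>\<close> by linarith
      then show ?thesis using d(1) \<open>n > 0\<close> by (simp add: field_simps)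
    qed
    ultimately show ?thesis using that by blast
  qed
  have "k \<le> n \<Longrightarrow> \<exists>\<psi> \<psi>1 \<psi>2 \<psi>12. mixed_C1 (ball 0 R) \<psi> \<psi>1 \<psi>2 \<psi>12 \<and>
    (\<forall>x \<in> ball 0 R. norm (\<psi> x) = 1 \<and> hopf (\<psi> x) = F ((k / n) *\<^sub>R x))" for k
  proof (induction k)
    case 0
    obtain \<psi> where "norm \<psi> = 1" "hopf \<psi> = F 0"
      using hopf_surj[OF unit] by blast
    then show ?case
      using mixed_C1_const[of "ball 0 R" \<psi>] by (auto intro!: exI)
  next
    case (Suc k)
    then obtain \<phi> \<phi>1 \<phi>2 \<phi>12 where \<phi>: "mixed_C1 (ball 0 R) \<phi> \<phi>1 \<phi>2 \<phi>12"
      "\<And>x. x \<in> ball 0 R \<Longrightarrow> norm (\<phi> x) = 1" "\<And>x. x \<in> ball 0 R \<Longrightarrow> hopf (\<phi> x) = F ((k / n) *\<^sub>R x)"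
      by auto
    let ?a = "\<lambda>x. F ((Suc k / n) *\<^sub>R x)"
    \<comment> \<open>The new target is at distance less than 2 from the direction already lifted,
      whereas antipodal unit vectors have distance exactly 2.\<close>
    have na: "hopf (\<phi> x) \<noteq> - ?a x" if x: "x \<in> ball 0 R" for x
    proof
      assume *: "hopf (\<phi> x) = - ?a x"
      have le: "norm (c *\<^sub>R x) \<le> R" if "0 \<le> c" "c \<le> 1" for c :: real
        using x that mult_mono[of c 1 "norm x" R] by simp
      have "dist ((Suc k / n) *\<^sub>R x) ((k / n) *\<^sub>R x) = norm x / n"
        by (simp add: dist_norm field_simps flip: scaleR_left_diff_distrib diff_divide_distrib)
      also have "\<dots> < d"
        using x n by (smt (verit) divide_strict_right_mono mem_ball_0 of_nat_0_less_iff)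
      finally have "dist (?a x) (F ((k / n) *\<^sub>R x)) < 2"
        using n Suc.prems by (intro d(2)) (simp_all only: mem_cball_0, auto intro!: le simp del: norm_scaleR)
      moreover have "dist (?a x) (F ((k / n) *\<^sub>R x)) = norm (2 *\<^sub>R ?a x)"
        using * \<phi>(3)[OF x] by (simp add: dist_norm scaleR_2)
      ultimately show False by (simp add: unit)
    qed
    note a = mixed_C1_dilate[OF F, of "ball 0 R" "Suc k / n", OF UNIV_I]
    obtain \<psi>1 \<psi>2 \<psi>12 where "mixed_C1 (ball 0 R) (\<lambda>x. nproj (?a x) (\<phi> x)) \<psi>1 \<psi>2 \<psi>12"
      using mixed_C1_nproj[OF a \<phi>(1)] na unit \<phi>(2) by metis
    then show ?case
      using nproj(2,3)[OF unit \<phi>(2) na] by blast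
  qed
  from this[of n] n(1) that show ?thesis by auto
qed

text \<open>The connection form \<open>Im (herm \<psi> d\<psi>)\<close> has the curvature on the
  left. Its cross derivatives \<open>b2\<close> and \<open>b1\<close> share the term with
  \<open>\<psi>12\<close>, so their difference contains first derivatives only; the rest is Fubini
  and the fundamental theorem of calculus.\<close>

lemma stokes_spinor:
  fixes \<psi> :: "real \<times> real \<Rightarrow> spinor"
  assumes \<psi>: "mixed_C1 S \<psi> \<psi>1 \<psi>2 \<psi>12" and Q: "{0..L} \<times> {0..L} \<subseteq> S" and L: "0 \<le> L"
  shows "integral {0..L} (\<lambda>s. integral {0..L} (\<lambda>t. 2 * Im (herm (\<psi>1 (s, t)) (\<psi>2 (s, t))))) =
    integral {0..L} (\<lambda>t. Im (herm (\<psi> (L, t)) (\<psi>2 (L, t))) - Im (herm (\<psi> (0, t)) (\<psi>2 (0, t)))) -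
    integral {0..L} (\<lambda>s. Im (herm (\<psi> (s, L)) (\<psi>1 (s, L))) - Im (herm (\<psi> (s, 0)) (\<psi>1 (s, 0))))"
proof -
  note c = mixed_C1D(1-4)[OF \<psi>] and d = mixed_C1D(5-8)[OF \<psi>]
  note cc = continuous_on_subset[OF c(1) Q] continuous_on_subset[OF c(2) Q]
    continuous_on_subset[OF c(3) Q] continuous_on_subset[OF c(4) Q]
  define b1 where "b1 = (\<lambda>x. Im (herm (\<psi> x) (\<psi>12 x) + herm (\<psi>2 x) (\<psi>1 x)))"
  define b2 where "b2 = (\<lambda>x. Im (herm (\<psi> x) (\<psi>12 x) + herm (\<psi>1 x) (\<psi>2 x)))"
  note bd = bounded_bilinear.has_vector_derivative[OF bounded_bilinear_herm]
  have ImD: "((\<lambda>x. Im (f x)) has_vector_derivative Im f') F" if "(f has_vector_derivative f') F" for f f' F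
    by (rule bounded_linear.has_vector_derivative[OF bounded_linear_Im that])
  have I1: "integral {0..L} (\<lambda>t. b1 (s, t)) = Im (herm (\<psi> (s, L)) (\<psi>1 (s, L))) - Im (herm (\<psi> (s, 0)) (\<psi>1 (s, 0)))"
    if "s \<in> {0..L}" for s
  proof (rule integral_unique, rule fundamental_theorem_of_calculus[OF L])
    fix t assume "t \<in> {0..L}"
    then have "(s, t) \<in> S" using that Q by auto
    from ImD[OF bd[OF d(2)[OF this] d(3)[OF this]]]
    show "((\<lambda>t. Im (herm (\<psi> (s, t)) (\<psi>1 (s, t)))) has_vector_derivative b1 (s, t)) (at t within {0..L})"
      unfolding b1_def by (rule has_vector_derivative_at_within)
  qed
  have I2: "integral {0..L} (\<lambda>s. b2 (s, t)) = Im (herm (\<psi> (L, t)) (\<psi>2 (L, t))) - Im (herm (\<psi> (0, t)) (\<psi>2 (0, t)))"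
    if "t \<in> {0..L}" for t
  proof (rule integral_unique, rule fundamental_theorem_of_calculus[OF L])
    fix s assume "s \<in> {0..L}"
    then have "(s, t) \<in> S" using that Q by auto
    from ImD[OF bd[OF d(1)[OF this] d(4)[OF this]]]
    show "((\<lambda>s. Im (herm (\<psi> (s, t)) (\<psi>2 (s, t)))) has_vector_derivative b2 (s, t)) (at s within {0..L})"
      unfolding b2_def by (rule has_vector_derivative_at_within)
  qed
  have cb: "continuous_on ({0..L} \<times> {0..L}) b1" "continuous_on ({0..L} \<times> {0..L}) b2"
    unfolding b1_def b2_def
    by (intro continuous_intros bounded_bilinear.continuous_on[OF bounded_bilinear_herm] cc)+
  have box: "cbox (0, 0) (L, L) = {0..L} \<times> {0..L}" by (simp add: cbox_Pair_eq)
  have int1: "(\<lambda>t. b (s, t)) integrable_on {0..L}" if "continuous_on ({0..L} \<times> {0..L}) b" "s \<in> {0..L}" for b :: "_ \<Rightarrow> real" and s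
    by (intro integrable_continuous_real continuous_on_compose2[OF that(1)] continuous_intros) (use that(2) in auto)
  have int2: "(\<lambda>s. integral {0..L} (\<lambda>t. b (s, t))) integrable_on {0..L}" if "continuous_on ({0..L} \<times> {0..L}) b" for b :: "_ \<Rightarrow> real"
    using integral_integrable_2dim[of 0 0 L L b] that box by simp
  have "integral {0..L} (\<lambda>s. integral {0..L} (\<lambda>t. 2 * Im (herm (\<psi>1 (s, t)) (\<psi>2 (s, t)))))
    = integral {0..L} (\<lambda>s. integral {0..L} (\<lambda>t. b2 (s, t)) - integral {0..L} (\<lambda>t. b1 (s, t)))"
  proof (rule integral_cong)
    fix s assume s: "s \<in> {0..L}"
    have "2 * Im (herm \<alpha> \<beta>) = Im (herm \<alpha> \<beta>) - Im (herm \<beta> \<alpha>)" for \<alpha> \<beta>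
      unfolding cnj_herm[of \<alpha> \<beta>, symmetric] by simp
    note * = this
    have "2 * Im (herm (\<psi>1 (s, t)) (\<psi>2 (s, t))) = b2 (s, t) - b1 (s, t)" for t
      unfolding b1_def b2_def plus_complex.sel using *[of "\<psi>1 (s, t)" "\<psi>2 (s, t)"] by linarith
    then show "integral {0..L} (\<lambda>t. 2 * Im (herm (\<psi>1 (s, t)) (\<psi>2 (s, t))))
        = integral {0..L} (\<lambda>t. b2 (s, t)) - integral {0..L} (\<lambda>t. b1 (s, t))"
      using s by (simp add: integral_diff int1 cb)
  qed
  also have "\<dots> = integral {0..L} (\<lambda>s. integral {0..L} (\<lambda>t. b2 (s, t))) - integral {0..L} (\<lambda>s. integral {0..L} (\<lambda>t. b1 (s, t)))"
    by (intro integral_diff int2 cb)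
  also have "integral {0..L} (\<lambda>s. integral {0..L} (\<lambda>t. b2 (s, t))) = integral {0..L} (\<lambda>t. integral {0..L} (\<lambda>s. b2 (s, t)))"
    using integral_swap_continuous[of 0 0 L L "\<lambda>s t. b2 (s, t)"] cb(2) box by simp
  also have "\<dots> = integral {0..L} (\<lambda>t. Im (herm (\<psi> (L, t)) (\<psi>2 (L, t))) - Im (herm (\<psi> (0, t)) (\<psi>2 (0, t))))"
    by (rule integral_cong) (rule I2)
  also have "integral {0..L} (\<lambda>s. integral {0..L} (\<lambda>t. b1 (s, t))) =
    integral {0..L} (\<lambda>s. Im (herm (\<psi> (s, L)) (\<psi>1 (s, L))) - Im (herm (\<psi> (s, 0)) (\<psi>1 (s, 0))))"
    by (rule integral_cong) (rule I1)
  finally show ?thesis .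
qed

text \<open>Two lifts of one curve differ by a phase \<open>G\<close>, whose logarithmic derivative
  is \<open>\<i>\<close> times the difference of the two connection forms. Integrating that
  difference yields a continuous angle with a known total increment.\<close>

lemma relative_phase:
  fixes p q :: "real \<Rightarrow> spinor"
  assumes I: "open I" "{0..L} \<subseteq> I" "0 \<le> L"
    and p: "\<And>t. t \<in> I \<Longrightarrow> (p has_vector_derivative p' t) (at t)" "continuous_on I p'"
    and q: "\<And>t. t \<in> I \<Longrightarrow> (q has_vector_derivative q' t) (at t)" "continuous_on I q'"
    and unit: "\<And>t. t \<in> I \<Longrightarrow> norm (p t) = 1" "\<And>t. t \<in> I \<Longrightarrow> norm (q t) = 1"
    and hopf: "\<And>t. t \<in> {0..L} \<Longrightarrow> hopf (p t) = hopf (q t)"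
  obtains g \<alpha> where "continuous_on {0..L} \<alpha>" "\<alpha> 0 = 0"
    "\<alpha> L = integral {0..L} (\<lambda>t. Im (herm (q t) (q' t)) - Im (herm (p t) (p' t)))"
    "\<And>t. t \<in> {0..L} \<Longrightarrow> q t = cscale (cis (g + \<alpha> t)) (p t)"
proof -
  define b where "b = (\<lambda>t. Im (herm (q t) (q' t)) - Im (herm (p t) (p' t)))"
  define \<alpha> where "\<alpha> = (\<lambda>t. integral {0..t} b)"
  define G where "G = (\<lambda>t. herm (p t) (q t))"
  have "continuous_on I p" "continuous_on I q"
    using p(1) q(1) by (meson continuous_at_imp_continuous_on has_vector_derivative_continuous)+
  note pc = continuous_on_subset[OF this(1) I(2)] continuous_on_subset[OF p(2) I(2)]
  note qc = continuous_on_subset[OF \<open>continuous_on I q\<close> I(2)] continuous_on_subset[OF q(2) I(2)]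
  have cb: "continuous_on {0..L} b"
    unfolding b_def by (intro continuous_intros bounded_bilinear.continuous_on[OF bounded_bilinear_herm] pc qc)
  have d\<alpha>: "(\<alpha> has_vector_derivative b t) (at t within {0..L})" if "t \<in> {0..L}" for t
    unfolding \<alpha>_def by (rule integral_has_vector_derivative[OF cb that])
  have q_eq: "q t = cscale (G t) (p t)" and G1: "cmod (G t) = 1" if "t \<in> {0..L}" for t
    using same_hopf[OF unit hopf[OF that]] that I(2) unfolding G_def by blast+
  have dG: "(G has_vector_derivative \<i> * of_real (b t) * G t) (at t within {0..L})" if t: "t \<in> {0..L}" for t
  proof -
    have tI: "t \<in> I" using t I(2) by auto
    have 1: "(G has_vector_derivative herm (p t) (q' t) + herm (p' t) (q t)) (at t)"
      unfolding G_def by (rule bounded_bilinear.has_vector_derivative[OF bounded_bilinear_herm p(1)[OF tI] q(1)[OF tI]])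
    have hp: "herm (p t) (p' t) = \<i> * of_real (Im (herm (p t) (p' t)))"
      using herm_derivative_imaginary[OF p(1)[OF tI] I(1) tI unit(1)] by (simp add: complex_eq_iff)
    have hq: "herm (q t) (q' t) = \<i> * of_real (Im (herm (q t) (q' t)))"
      using herm_derivative_imaginary[OF q(1)[OF tI] I(1) tI unit(2)] by (simp add: complex_eq_iff)
    have GG: "G t * cnj (G t) = 1" using G1[OF t] complex_norm_square[of "G t"] by simp
    have "herm (p t) (q' t) = G t * herm (q t) (q' t)"
      unfolding q_eq[OF t] herm_cscale using GG by (simp flip: mult.assoc)
    moreover have "herm (p' t) (q t) = G t * cnj (herm (p t) (p' t))"
      unfolding cnj_herm by (subst q_eq[OF t]) (simp add: herm_cscale)
    ultimately have "herm (p t) (q' t) + herm (p' t) (q t) = \<i> * of_real (b t) * G t"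
      by (subst (asm) hp, subst (asm) hq) (simp add: b_def algebra_simps)
    then show ?thesis using 1 by (simp add: has_vector_derivative_at_within)
  qed
  \<comment> \<open>Dividing \<open>G\<close> by the phase predicted by \<open>\<alpha>\<close>
    leaves a constant of modulus 1, whose argument is \<open>g\<close>.\<close>
  have "((\<lambda>t. G t * cis (- \<alpha> t)) has_derivative (\<lambda>h. 0)) (at t within {0..L})" if t: "t \<in> {0..L}" for t
  proof -
    have "((\<lambda>t. cis (- \<alpha> t)) has_vector_derivative - \<i> * of_real (b t) * cis (- \<alpha> t)) (at t within {0..L})"
    proof -
      have "((\<lambda>t. - \<i> * of_real (\<alpha> t)) has_vector_derivative - \<i> * of_real (b t)) (at t within {0..L})"
        by (intro bounded_linear.has_vector_derivative[OF _ d\<alpha>[OF t]] bounded_linear_intros bounded_linear_of_real)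
      from field_vector_diff_chain_within[OF this, of exp] 
      have "((\<lambda>t. exp (- \<i> * of_real (\<alpha> t))) has_vector_derivative (- \<i> * of_real (b t)) * exp (- \<i> * of_real (\<alpha> t))) (at t within {0..L})"
        by (simp add: o_def DERIV_exp has_field_derivative_at_within)
      then show ?thesis by (simp add: cis_conv_exp)
    qed
    from has_vector_derivative_mult[OF dG[OF t] this]
    have "((\<lambda>t. G t * cis (- \<alpha> t)) has_vector_derivative 0) (at t within {0..L})"
      by (simp add: algebra_simps)
    then show ?thesis by (simp add: has_vector_derivative_def)
  qed
  then obtain c where c: "\<And>t. t \<in> {0..L} \<Longrightarrow> G t * cis (- \<alpha> t) = c"
    using has_derivative_zero_constant[of "{0..L}" "\<lambda>t. G t * cis (- \<alpha> t)"] by auto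
  have "\<alpha> 0 = 0" by (simp add: \<alpha>_def)
  have "cmod c = 1" using c[of 0] G1[of 0] I(3) by (auto simp: norm_mult)
  then have "c = cis (Arg c)"
    by (subst cis_Arg) (auto simp: sgn_div_norm)
  then obtain g where g: "c = cis g" by blast
  have Gt: "G t = cis (g + \<alpha> t)" if "t \<in> {0..L}" for t
  proof -
    have "G t = (G t * cis (- \<alpha> t)) * cis (\<alpha> t)" by (simp add: mult.assoc cis_mult)
    also have "\<dots> = cis (g + \<alpha> t)" unfolding c[OF that] g cis_mult ..
    finally show ?thesis .
  qed
  show ?thesis
  proof (rule that[of \<alpha> g])
    show "continuous_on {0..L} \<alpha>"
      using d\<alpha> by (meson continuous_on_eq_continuous_within has_vector_derivative_continuous)
    show "\<alpha> L = integral {0..L} (\<lambda>t. Im (herm (q t) (q' t)) - Im (herm (p t) (p' t)))"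
      by (simp add: \<alpha>_def b_def)
    show "q t = cscale (cis (g + \<alpha> t)) (p t)" if "t \<in> {0..L}" for t
      using q_eq[OF that] Gt[OF that] by simp
  qed (rule \<open>\<alpha> 0 = 0\<close>)
qed

text \<open>Reduction modulo \<open>L\<close> jumps at multiples of \<open>L\<close>, and
  \<open>match\<close> restores continuity there. The last conclusion describes the extension by
  translates in a form that survives a second extension in the other coordinate.\<close>

lemma continuous_periodic_extension:
  fixes f :: "real \<times> 'b::real_normed_vector \<Rightarrow> 'c::topological_space"
  assumes f: "continuous_on ({0..L} \<times> S) f" and L: "0 < L" and S: "closed S"
    and match: "\<And>y. y \<in> S \<Longrightarrow> f (L, y) = f (0, y)"
  obtains g where "continuous_on (UNIV \<times> S) g" "\<And>x y. g (x + L, y) = g (x, y)"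
    "\<And>x. \<exists>n::int. x + L * of_int n \<in> {0..L} \<and> (\<forall>y. g (x, y) = f (x + L * of_int n, y))"
proof -
  define m where "m = (\<lambda>x. x - L * of_int \<lfloor>x / L\<rfloor>)"
  define g where "g = (\<lambda>z. f (m (fst z), snd z))"
  have m: "m x \<in> {0..L}" for x
  proof -
    have "of_int \<lfloor>x / L\<rfloor> \<le> x / L" "x / L \<le> of_int \<lfloor>x / L\<rfloor> + 1" by linarith+
    from this[THEN mult_left_mono[of _ _ L]] show ?thesis using L by (simp add: m_def algebra_simps)
  qed
  have per: "m (x + L) = m x" for x
    using L by (simp add: m_def add_divide_distrib algebra_simps)
  \<comment> \<open>The formula is claimed on closed strips. At the right end the floor is already
    \<open>k + 1\<close>, and \<open>match\<close> identifies the two values.\<close>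
  have strip: "g z = f (fst z - L * of_int k, snd z)" if "z \<in> {L * of_int k .. L * (of_int k + 1)} \<times> S" for z k
  proof (cases "fst z = L * (of_int k + 1)")
    case True
    then have "\<lfloor>fst z / L\<rfloor> = k + 1" using L by simp
    then have "m (fst z) = 0" using True by (simp add: m_def)
    then show ?thesis using True match[of "snd z"] that by (auto simp: g_def algebra_simps)
  next
    case False
    have "L * of_int k \<le> fst z" "fst z \<le> L * (of_int k + 1)" using that by auto
    then have "of_int k \<le> fst z / L" "fst z / L < of_int k + 1" using L False
      by (auto simp: field_simps)
    then have "\<lfloor>fst z / L\<rfloor> = k" by linarith
    then show ?thesis by (simp add: g_def m_def)
  qed
  have cstrip: "continuous_on ({L * of_int k .. L * (of_int k + 1)} \<times> S) g" for k
  proof -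
    have "continuous_on ({L * of_int k .. L * (of_int k + 1)} \<times> S) (\<lambda>z. f (fst z - L * of_int k, snd z))"
      by (rule continuous_on_compose2[OF f]) (auto intro!: continuous_intros simp: algebra_simps)
    then show ?thesis by (rule continuous_on_eq) (simp only: strip)
  qed
  have "continuous (at z within UNIV \<times> S) g" if z: "z \<in> UNIV \<times> S" for z
  proof -
    define k where "k = \<lfloor>fst z / L\<rfloor>"
    \<comment> \<open>An open strip around \<open>z\<close> that is covered by the closed strips
      \<open>k - 1\<close> and \<open>k\<close>; this also handles a \<open>z\<close> on the seam
      between them.\<close>
    define T where "T = {L * (of_int k - 1) <..< L * (of_int k + 1)} \<times> (UNIV :: 'b set)"
    have "of_int k \<le> fst z / L" "fst z / L < of_int k + 1" unfolding k_def by linarith+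
    then have b: "L * of_int k \<le> fst z" "fst z < L * (of_int k + 1)" using L by (auto simp: field_simps)
    moreover have "L * (of_int k - 1) < L * of_int k" using L by simp
    ultimately have zT: "z \<in> T" by (auto simp: T_def mem_Times_iff)
    let ?U = "{L * of_int (k - 1) .. L * (of_int (k - 1) + 1)} \<times> S \<union> {L * of_int k .. L * (of_int k + 1)} \<times> S"
    have "continuous_on ?U g"
      by (intro continuous_on_closed_Un cstrip closed_Times S) auto
    moreover have "UNIV \<times> S \<inter> T - {z} = ?U \<inter> T - {z}"
      by (auto simp: T_def)
    then have "at z within UNIV \<times> S = at z within ?U"
      using zT by (intro at_within_nhd[of _ T]) (auto simp: T_def open_Times)
    moreover have "z \<in> ?U" using b z by (auto simp: mem_Times_iff)
    ultimately show ?thesis by (simp add: continuous_on_eq_continuous_within)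
  qed
  then have "continuous_on (UNIV \<times> S) g" by (simp add: continuous_on_eq_continuous_within)
  moreover have "\<exists>n::int. x + L * of_int n \<in> {0..L} \<and> (\<forall>y. g (x, y) = f (x + L * of_int n, y))" for x
    using m[of x] by (intro exI[of _ "- \<lfloor>x / L\<rfloor>"]) (simp add: g_def m_def)
  ultimately show ?thesis
    using that[of g] per by (simp add: g_def)
qed

lemma periodic_int:
  fixes f :: "real \<Rightarrow> 'a"
  assumes "\<And>x. f (x + L) = f x"
  shows "f (x + L * of_int n) = f x"
proof -
  have nat: "f (x + L * real k) = f x" for x and k :: nat
  proof (induction k)
    case (Suc k)
    then show ?case using assms[of "x + L * real k"] by (simp add: algebra_simps)
  qed simp
  show ?thesis
  proof (cases "n \<ge> 0")
    case True
    then show ?thesis using nat[of x "nat n"] by simp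
  next
    case False
    then show ?thesis using nat[of "x + L * of_int n" "nat (- n)"] by simp
  qed
qed

section \<open>The direction map of two curves and its spinor lift\<close>

lemma hopf2_commute: "hopf2 \<psi> \<phi> = hopf2 \<phi> \<psi>"
  by (simp add: hopf2_def algebra_simps)

lemma hopf_has_vector_derivative:
  assumes "(\<psi> has_vector_derivative \<psi>') (at t)"
  shows "((\<lambda>x. hopf (\<psi> x)) has_vector_derivative 2 *\<^sub>R hopf2 (\<psi> t) \<psi>') (at t)"
  using bounded_bilinear.has_vector_derivative[OF bounded_bilinear_hopf2 assms assms]
  by (simp add: hopf_eq_hopf2 hopf2_commute[of \<psi>'] scaleR_2)

text \<open>The mixed partial of \<open>U s - V t\<close> is zero, so no second derivatives of the
  curves appear.\<close>

lemma mixed_C1_difference: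
  assumes U: "\<And>s. (U has_vector_derivative U' s) (at s)" "continuous_on UNIV U'"
    and V: "\<And>t. (V has_vector_derivative V' t) (at t)" "continuous_on UNIV V'"
  shows "mixed_C1 UNIV (\<lambda>x. U (fst x) - V (snd x)) (\<lambda>x. U' (fst x)) (\<lambda>x. - V' (snd x)) (\<lambda>x. 0)"
proof -
  have c: "continuous_on UNIV U" "continuous_on UNIV V"
    using U(1) V(1) by (meson continuous_at_imp_continuous_on has_vector_derivative_continuous)+
  show ?thesis
    unfolding mixed_C1_def
    using has_vector_derivative_diff[OF U(1) has_vector_derivative_const]
      has_vector_derivative_diff[OF has_vector_derivative_const V(1)]
    by (auto intro!: continuous_intros continuous_on_compose2[OF c(1)] continuous_on_compose2[OF c(2)]
        continuous_on_compose2[OF U(2)] continuous_on_compose2[OF V(2)])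
qed

text \<open>The pullback of the area form of the sphere is twice the curvature of the lift.\<close>

lemma gauss_integrand_curvature:
  fixes U V :: "real \<Rightarrow> vec3"
  assumes U: "\<And>s. (U has_vector_derivative U' s) (at s)" "continuous_on UNIV U'"
    and V: "\<And>t. (V has_vector_derivative V' t) (at t)" "continuous_on UNIV V'"
    and disj: "\<And>s t. U s \<noteq> V t"
  obtains \<psi> \<psi>1 \<psi>2 \<psi>12 where "mixed_C1 (ball 0 R) \<psi> \<psi>1 \<psi>2 \<psi>12"
    "\<And>x. x \<in> ball 0 R \<Longrightarrow> norm (\<psi> x) = 1"
    "\<And>s t. (s, t) \<in> ball 0 R \<Longrightarrow> hopf (\<psi> (s, t)) = (1 / norm (U s - V t)) *\<^sub>R (U s - V t)"
    "\<And>s t. (s, t) \<in> ball 0 R \<Longrightarrow>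
      4 * Im (herm (\<psi>1 (s, t)) (\<psi>2 (s, t))) = - (triple (U s - V t) (U' s) (V' t) / norm (U s - V t) ^ 3)"
proof -
  let ?\<Phi> = "\<lambda>x. U (fst x) - V (snd x)"
  have nz: "?\<Phi> x \<noteq> 0" for x using disj by simp
  obtain r r1 r2 r12 where r: "\<And>x. r x = 1 / norm (?\<Phi> x)"
    and F: "mixed_C1 UNIV (\<lambda>x. (1 / norm (?\<Phi> x)) *\<^sub>R ?\<Phi> x) (\<lambda>x. r x *\<^sub>R U' (fst x) + r1 x *\<^sub>R ?\<Phi> x)
      (\<lambda>x. r x *\<^sub>R (- V' (snd x)) + r2 x *\<^sub>R ?\<Phi> x)
      (\<lambda>x. (r x *\<^sub>R 0 + r2 x *\<^sub>R U' (fst x)) + (r1 x *\<^sub>R (- V' (snd x)) + r12 x *\<^sub>R ?\<Phi> x))"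
    by (rule mixed_C1_normalize[OF mixed_C1_difference[OF U V] nz]) (rule that, assumption+)
  obtain \<psi> \<psi>1 \<psi>2 \<psi>12 where \<psi>: "mixed_C1 (ball 0 R) \<psi> \<psi>1 \<psi>2 \<psi>12"
    "\<And>x. x \<in> ball 0 R \<Longrightarrow> norm (\<psi> x) = 1" "\<And>x. x \<in> ball 0 R \<Longrightarrow> hopf (\<psi> x) = (1 / norm (?\<Phi> x)) *\<^sub>R ?\<Phi> x"
  proof (rule mixed_C1_hopf_lift[OF F, of R])
    show "norm ((1 / norm (?\<Phi> x)) *\<^sub>R ?\<Phi> x) = 1" for x using nz[of x] by simp
  qed (rule that, assumption+)
  have "4 * Im (herm (\<psi>1 x) (\<psi>2 x)) = - (triple (?\<Phi> x) (U' (fst x)) (V' (snd x)) / norm (?\<Phi> x) ^ 3)"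
    if x: "x \<in> ball 0 R" for x
  proof -
    obtain s t where [simp]: "x = (s, t)" by fastforce
    have st: "(s, t) \<in> ball 0 R" using x by simp
    define S1 S2 where "S1 = (\<lambda>y. (y, t)) -` ball (0 :: real \<times> real) R" and "S2 = (\<lambda>y. (s, y)) -` ball (0 :: real \<times> real) R"
    have op: "open S1" "open S2" unfolding S1_def S2_def
      by (intro open_vimage continuous_intros open_ball)+
    have mem: "s \<in> S1" "t \<in> S2" using st by (auto simp: S1_def S2_def)
    \<comment> \<open>The derivative of the unit direction is computed twice, from the normalised
      chord and from the Hopf map of the lift.\<close>
    have F1: "r x *\<^sub>R U' s + r1 x *\<^sub>R ?\<Phi> x = 2 *\<^sub>R hopf2 (\<psi> x) (\<psi>1 x)"
    proof (rule vector_derivative_unique_at)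
      show "((\<lambda>s. (1 / norm (U s - V t)) *\<^sub>R (U s - V t)) has_vector_derivative r x *\<^sub>R U' s + r1 x *\<^sub>R ?\<Phi> x) (at s)"
        using mixed_C1D(5)[OF F, of s t] by simp
      show "((\<lambda>s. (1 / norm (U s - V t)) *\<^sub>R (U s - V t)) has_vector_derivative 2 *\<^sub>R hopf2 (\<psi> x) (\<psi>1 x)) (at s)"
        using has_vector_derivative_transform_within_open[OF hopf_has_vector_derivative[OF mixed_C1D(5)[OF \<psi>(1) st]] op(1) mem(1)]
          \<psi>(3) by (auto simp: S1_def)
    qed
    have F2: "r x *\<^sub>R (- V' t) + r2 x *\<^sub>R ?\<Phi> x = 2 *\<^sub>R hopf2 (\<psi> x) (\<psi>2 x)"
    proof (rule vector_derivative_unique_at)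
      show "((\<lambda>t. (1 / norm (U s - V t)) *\<^sub>R (U s - V t)) has_vector_derivative r x *\<^sub>R (- V' t) + r2 x *\<^sub>R ?\<Phi> x) (at t)"
        using mixed_C1D(6)[OF F, of s t] by simp
      show "((\<lambda>t. (1 / norm (U s - V t)) *\<^sub>R (U s - V t)) has_vector_derivative 2 *\<^sub>R hopf2 (\<psi> x) (\<psi>2 x)) (at t)"
        using has_vector_derivative_transform_within_open[OF hopf_has_vector_derivative[OF mixed_C1D(6)[OF \<psi>(1) st]] op(2) mem(2)]
          \<psi>(3) by (auto simp: S2_def)
    qed
    have re: "Re (herm (\<psi> x) (\<psi>1 x)) = 0" "Re (herm (\<psi> x) (\<psi>2 x)) = 0"
      using herm_derivative_imaginary[OF mixed_C1D(5)[OF \<psi>(1) st] op(1) mem(1)]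
        herm_derivative_imaginary[OF mixed_C1D(6)[OF \<psi>(1) st] op(2) mem(2)] \<psi>(2)
      by (simp_all add: S1_def S2_def)
    have "4 * Im (herm (\<psi>1 x) (\<psi>2 x)) = 4 * Im (cnj (sdet (\<psi> x) (\<psi>1 x)) * sdet (\<psi> x) (\<psi>2 x))"
      using Im_herm[of "\<psi> x" "\<psi>1 x" "\<psi>2 x"] re \<psi>(2)[OF x] by simp
    also have "\<dots> = triple (hopf (\<psi> x)) (2 *\<^sub>R hopf2 (\<psi> x) (\<psi>1 x)) (2 *\<^sub>R hopf2 (\<psi> x) (\<psi>2 x))"
      using triple_hopf[of "\<psi> x" "\<psi>1 x" "\<psi>2 x"] \<psi>(2)[OF x] by simp
    also have "\<dots> = triple (r x *\<^sub>R ?\<Phi> x) (r x *\<^sub>R U' s + r1 x *\<^sub>R ?\<Phi> x) (r x *\<^sub>R (- V' t) + r2 x *\<^sub>R ?\<Phi> x)"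
      unfolding \<psi>(3)[OF x] F1[symmetric] F2[symmetric] r ..
    also have "\<dots> = r x ^ 3 * triple (?\<Phi> x) (U' s) (- V' t)"
      by (rule triple_scale)
    also have "\<dots> = - (triple (?\<Phi> x) (U' s) (V' t) / norm (?\<Phi> x) ^ 3)"
    proof -
      have "triple a b (- c) = - triple a b c" for a b c by (simp add: triple_def algebra_simps)
      then show ?thesis by (simp add: r power_divide)
    qed
    finally show ?thesis by simp
  qed
  note curv = this
  show ?thesis
  proof (rule that[OF \<psi>(1,2)])
    fix s t :: real assume st: "(s, t) \<in> ball 0 R"
    show "hopf (\<psi> (s, t)) = (1 / norm (U s - V t)) *\<^sub>R (U s - V t)"
      using \<psi>(3)[OF st] by simp
    show "4 * Im (herm (\<psi>1 (s, t)) (\<psi>2 (s, t))) = - (triple (U s - V t) (U' s) (V' t) / norm (U s - V t) ^ 3)"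
      using curv[OF st] by simp
  qed
qed

text \<open>On a square, opposite edges of the lift differ by phases \<open>g + \<alpha> t\<close>
  and \<open>k + \<beta> s\<close>. Stokes expresses the difference of the total increments of
  \<open>\<alpha>\<close> and \<open>\<beta>\<close> by the Gauss integral. When it vanishes, one
  phase function can remove both discrepancies at once.\<close>

theorem periodic_hopf_lift:
  fixes U V :: "real \<Rightarrow> vec3"
  assumes U: "\<And>s. (U has_vector_derivative U' s) (at s)" "continuous_on UNIV U'"
    and V: "\<And>t. (V has_vector_derivative V' t) (at t)" "continuous_on UNIV V'"
    and disj: "\<And>s t. U s \<noteq> V t"
    and per: "\<And>s. U (s + 2 * pi) = U s" "\<And>t. V (t + 2 * pi) = V t"
    and gauss: "integral {0..2 * pi} (\<lambda>s. integral {0..2 * pi} (\<lambda>t.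
      triple (U s - V t) (U' s) (V' t) / norm (U s - V t) ^ 3)) = 0"
  obtains \<Psi> :: "real \<times> real \<Rightarrow> spinor" where "continuous_on UNIV \<Psi>"
    "\<And>s t. \<Psi> (s + 2 * pi, t) = \<Psi> (s, t)" "\<And>s t. \<Psi> (s, t + 2 * pi) = \<Psi> (s, t)"
    "\<And>s t. norm (\<Psi> (s, t)) = 1"
    "\<And>s t. hopf (\<Psi> (s, t)) = (1 / norm (U s - V t)) *\<^sub>R (U s - V t)"
proof -
  \<comment> \<open>The radius 12 makes the open ball contain the square: as \<open>2 * pi\<close>
    is below 8, the squared norms are at most 128.\<close>
  let ?L = "2 * pi" and ?B = "ball (0 :: real \<times> real) 12"
  let ?F = "\<lambda>s t. (1 / norm (U s - V t)) *\<^sub>R (U s - V t)"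
  obtain \<psi> \<psi>1 \<psi>2 \<psi>12 where \<psi>: "mixed_C1 ?B \<psi> \<psi>1 \<psi>2 \<psi>12"
    and unit: "\<And>x. x \<in> ?B \<Longrightarrow> norm (\<psi> x) = 1"
    and hopf: "\<And>s t. (s, t) \<in> ?B \<Longrightarrow> hopf (\<psi> (s, t)) = ?F s t"
    and curv: "\<And>s t. (s, t) \<in> ?B \<Longrightarrow>
      4 * Im (herm (\<psi>1 (s, t)) (\<psi>2 (s, t))) = - (triple (U s - V t) (U' s) (V' t) / norm (U s - V t) ^ 3)"
    using gauss_integrand_curvature[OF U V disj] by blast
  have Q: "(s, t) \<in> ?B" if "s \<in> {0..?L}" "t \<in> {0..?L}" for s t
  proof -
    have "s \<le> 8" "t \<le> 8" using that pi_less_4 by auto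
    then have "s\<^sup>2 \<le> 8\<^sup>2" "t\<^sup>2 \<le> 8\<^sup>2" using that by (intro power_mono; simp)+
    then have "(norm (s, t))\<^sup>2 < 12\<^sup>2" by (simp add: norm_Pair)
    then have "norm (s, t) < 12" by (rule power2_less_imp_less) simp
    then show ?thesis by simp
  qed
  have Q': "{0..?L} \<times> {0..?L} \<subseteq> ?B" using Q by auto
  \<comment> \<open>Derivatives are two-sided, so the edges need open parameter sets on which both
    opposite edges stay inside the ball.\<close>
  define I where "I = (\<lambda>x. (0, x)) -` ?B \<inter> (\<lambda>x. (?L, x)) -` ?B"
  define J where "J = (\<lambda>x. (x, 0)) -` ?B \<inter> (\<lambda>x. (x, ?L)) -` ?B"
  have "open I" "open J"
    unfolding I_def J_def by (intro open_Int open_vimage continuous_intros open_ball)+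
  moreover have "{0..?L} \<subseteq> I" "{0..?L} \<subseteq> J"
  proof safe
    fix x assume "x \<in> {0..?L}"
    then show "x \<in> I" "x \<in> J"
      unfolding I_def J_def using Q[of 0 x] Q[of ?L x] Q[of x 0] Q[of x ?L] by (simp_all del: mem_ball_0)
  qed
  ultimately have IJ: "open I" "{0..?L} \<subseteq> I" "0 \<le> ?L" "open J" "{0..?L} \<subseteq> J"
    by simp_all
  note d = mixed_C1D[OF \<psi>]
  have perF: "?F (s + ?L) t = ?F s t" "?F s (t + ?L) = ?F s t" for s t
    by (simp_all add: per)
  obtain g \<alpha> where \<alpha>: "continuous_on {0..?L} \<alpha>" "\<alpha> 0 = 0"
    "\<alpha> ?L = integral {0..?L} (\<lambda>t. Im (herm (\<psi> (?L, t)) (\<psi>2 (?L, t))) - Im (herm (\<psi> (0, t)) (\<psi>2 (0, t))))"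
    "\<And>t. t \<in> {0..?L} \<Longrightarrow> \<psi> (?L, t) = cscale (cis (g + \<alpha> t)) (\<psi> (0, t))"
  proof (rule relative_phase[OF IJ(1-3), of "\<lambda>t. \<psi> (0, t)" "\<lambda>t. \<psi>2 (0, t)" "\<lambda>t. \<psi> (?L, t)" "\<lambda>t. \<psi>2 (?L, t)"])
    show "continuous_on I (\<lambda>t. \<psi>2 (0, t))" "continuous_on I (\<lambda>t. \<psi>2 (?L, t))"
      by (rule continuous_on_compose2[OF d(3)], auto intro!: continuous_intros simp: I_def)+
    show "hopf (\<psi> (0, t)) = hopf (\<psi> (?L, t))" if "t \<in> {0..?L}" for t
      using hopf[OF Q[of 0 t]] hopf[OF Q[of ?L t]] that perF(1)[of 0 t] by simp
  qed (auto simp: I_def intro!: d(6) unit)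
  obtain k \<beta> where \<beta>: "continuous_on {0..?L} \<beta>" "\<beta> 0 = 0"
    "\<beta> ?L = integral {0..?L} (\<lambda>s. Im (herm (\<psi> (s, ?L)) (\<psi>1 (s, ?L))) - Im (herm (\<psi> (s, 0)) (\<psi>1 (s, 0))))"
    "\<And>s. s \<in> {0..?L} \<Longrightarrow> \<psi> (s, ?L) = cscale (cis (k + \<beta> s)) (\<psi> (s, 0))"
  proof (rule relative_phase[OF IJ(4,5,3), of "\<lambda>t. \<psi> (t, 0)" "\<lambda>t. \<psi>1 (t, 0)" "\<lambda>t. \<psi> (t, ?L)" "\<lambda>t. \<psi>1 (t, ?L)"])
    show "continuous_on J (\<lambda>t. \<psi>1 (t, 0))" "continuous_on J (\<lambda>t. \<psi>1 (t, ?L))"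
      by (rule continuous_on_compose2[OF d(2)], auto intro!: continuous_intros simp: J_def)+
    show "hopf (\<psi> (t, 0)) = hopf (\<psi> (t, ?L))" if "t \<in> {0..?L}" for t
      using hopf[OF Q[of t 0]] hopf[OF Q[of t ?L]] that perF(2)[of t 0] by simp
  qed (auto simp: J_def intro!: d(5) unit)
  have "integral {0..?L} (\<lambda>s. integral {0..?L} (\<lambda>t. 2 * Im (herm (\<psi>1 (s, t)) (\<psi>2 (s, t)))))
    = integral {0..?L} (\<lambda>s. integral {0..?L} (\<lambda>t. (- 1 / 2) * (triple (U s - V t) (U' s) (V' t) / norm (U s - V t) ^ 3)))"
  proof (intro integral_cong)
    fix s t assume "s \<in> {0..?L}" "t \<in> {0..?L}"
    from curv[OF Q[OF this]] show "2 * Im (herm (\<psi>1 (s, t)) (\<psi>2 (s, t)))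
      = (- 1 / 2) * (triple (U s - V t) (U' s) (V' t) / norm (U s - V t) ^ 3)" by linarith
  qed
  also have "\<dots> = 0"
    unfolding integral_mult_right gauss by simp
  finally have ab: "\<alpha> ?L = \<beta> ?L"
    using stokes_spinor[OF \<psi> Q' IJ(3)] \<alpha>(3) \<beta>(3) by simp
  \<comment> \<open>The two summands interpolate the corrections of the jumps in the first and in
    the second variable. The term with \<open>\<alpha> ?L\<close> compensates what the first summand
    adds between bottom and top edge; in turn it is harmless for the first jump only because
    \<open>\<alpha> ?L = \<beta> ?L\<close>.\<close>
  define \<theta> where "\<theta> = (\<lambda>x. - (fst x / ?L) * (g + \<alpha> (snd x)) - (snd x / ?L) * (k + \<beta> (fst x) - (fst x / ?L) * \<alpha> ?L))"
  define f0 where "f0 = (\<lambda>x. cscale (cis (\<theta> x)) (\<psi> x))"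
  have c\<theta>: "continuous_on ({0..?L} \<times> {0..?L}) \<theta>"
    unfolding \<theta>_def by (intro continuous_intros continuous_on_compose2[OF \<alpha>(1)] continuous_on_compose2[OF \<beta>(1)]) auto
  have cf0: "continuous_on ({0..?L} \<times> {0..?L}) f0"
    unfolding f0_def cis_conv_exp
    by (intro bounded_bilinear.continuous_on[OF bounded_bilinear_cscale] continuous_intros c\<theta>
        continuous_on_subset[OF d(1) Q'])
  have m1: "f0 (?L, t) = f0 (0, t)" if "t \<in> {0..?L}" for t
    unfolding f0_def \<alpha>(4)[OF that] cscale_cscale cis_mult
    by (rule arg_cong[where f = "\<lambda>c. cscale (cis c) _"]) (simp add: \<theta>_def ab \<beta>(2))
  have m2: "f0 (s, ?L) = f0 (s, 0)" if "s \<in> {0..?L}" for s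
    unfolding f0_def \<beta>(4)[OF that] cscale_cscale cis_mult
    by (rule arg_cong[where f = "\<lambda>c. cscale (cis c) _"]) (simp add: \<theta>_def \<alpha>(2) field_simps)
  have L: "0 < ?L" by simp
  \<comment> \<open>Only the first coordinate is extended by the lemma, so the coordinates are
    swapped for the second application.\<close>
  obtain g1 where g1: "continuous_on (UNIV \<times> {0..?L}) g1" "\<And>x y. g1 (x + ?L, y) = g1 (x, y)"
    "\<And>x. \<exists>n::int. x + ?L * of_int n \<in> {0..?L} \<and> (\<forall>y. g1 (x, y) = f0 (x + ?L * of_int n, y))"
    using continuous_periodic_extension[OF cf0 L closed_atLeastAtMost m1] by blast
  have "continuous_on ({0..?L} \<times> UNIV) (\<lambda>z. g1 (snd z, fst z))"
    by (rule continuous_on_compose2[OF g1(1)]) (auto intro!: continuous_intros)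
  moreover have "g1 (x, ?L) = g1 (x, 0)" for x
    using g1(3)[of x] m2 by auto
  ultimately obtain g2 where g2: "continuous_on (UNIV \<times> UNIV) g2" "\<And>x y. g2 (x + ?L, y) = g2 (x, y)"
    "\<And>x. \<exists>n::int. x + ?L * of_int n \<in> {0..?L} \<and> (\<forall>y. g2 (x, y) = g1 (y, x + ?L * of_int n))"
    using continuous_periodic_extension[of ?L UNIV "\<lambda>z. g1 (snd z, fst z)"] L by auto
  have g2': "norm (g2 (t, s)) = 1 \<and> hopf (g2 (t, s)) = ?F s t" for s t
  proof -
    obtain n where n: "t + ?L * of_int n \<in> {0..?L}" "g2 (t, s) = g1 (s, t + ?L * of_int n)"
      using g2(3)[of t] by blast
    obtain m where m: "s + ?L * of_int m \<in> {0..?L}" "g1 (s, t + ?L * of_int n) = f0 (s + ?L * of_int m, t + ?L * of_int n)"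
      using g1(3)[of s] by blast
    have "norm (g2 (t, s)) = 1" "hopf (g2 (t, s)) = ?F (s + ?L * of_int m) (t + ?L * of_int n)"
      unfolding n(2) m(2) f0_def hopf_cscale norm_cscale hopf[OF Q[OF m(1) n(1)]] unit[OF Q[OF m(1) n(1)]]
      by simp_all
    moreover have "?F (s + ?L * of_int m) (t + ?L * of_int n) = ?F s t"
      using periodic_int[of "\<lambda>s. ?F s (t + ?L * of_int n)", OF perF(1)] periodic_int[of "\<lambda>t. ?F s t", OF perF(2)] by simp
    ultimately show ?thesis by simp
  qed
  show ?thesis
  proof (rule that[of "\<lambda>z. g2 (snd z, fst z)"])
    show "continuous_on UNIV (\<lambda>z. g2 (snd z, fst z))"
      by (rule continuous_on_compose2[OF g2(1)]) (auto intro!: continuous_intros)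
    show "g2 (snd (s + ?L, t), fst (s + ?L, t)) = g2 (snd (s, t), fst (s, t))" for s t
      using g2(3)[of t] g1(2) by auto
  qed (use g2' g2(2) in auto)
qed

section \<open>Winding numbers and the spin of the frame\<close>

text \<open>
  The rotation of 3-space given by a unit spinor takes the axes \<open>(1, 0)\<close> and \<open>(0, 1)\<close> to its images under
  \<open>hopf\<close> and \<open>hopf_frame\<close>.
\<close>

definition hopf_frame :: "spinor \<Rightarrow> vec3"
  where "hopf_frame \<psi> = (- 2 * Re (fst \<psi> * snd \<psi>), (cnj (fst \<psi>))\<^sup>2 - (snd \<psi>)\<^sup>2)"

lemma norm_hopf_frame: "norm (hopf_frame \<psi>) = (norm \<psi>)\<^sup>2"
proof -
  have "(norm (hopf_frame \<psi>))\<^sup>2 = ((norm \<psi>)\<^sup>2)\<^sup>2"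
    unfolding hopf_frame_def spinor_defs by (simp add: power2_eq_square algebra_simps)
  then show ?thesis by (rule power2_eq_imp_eq) auto
qed

lemma hopf_frame_orthogonal: "hopf \<psi> \<bullet> hopf_frame \<psi> = 0"
  unfolding hopf_frame_def spinor_defs by (simp add: power2_eq_square algebra_simps)

text \<open>The part of the Hopf image transverse to \<open>hopf \<psi>\<close> is turned about that
  axis by the relative phase \<open>\<phi>\<close> of the coefficients. The same turn of the frame
  vector costs the spinor only half the phase, which is how odd winding becomes a sign.\<close>

lemma hopf_expansion:
  assumes "cnj A * B = of_real (cmod A * cmod B) * cis \<phi>"
  shows "hopf (cscale A \<psi> + cscale B (sperp \<psi>)) =
    ((cmod A)\<^sup>2 - (cmod B)\<^sup>2) *\<^sub>R hopf \<psi> + (2 * cmod A * cmod B) *\<^sub>R hopf_frame (cscale (cis (- \<phi> / 2)) \<psi>)"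
proof -
  obtain z w where zw [simp]: "\<psi> = (z, w)" by fastforce
  define c where "c = cnj A * B"
  define r where "r = cmod A * cmod B"
  have 1: "hopf (cscale A \<psi> + cscale B (sperp \<psi>)) = ((cmod A)\<^sup>2 - (cmod B)\<^sup>2) *\<^sub>R hopf \<psi>
      + 2 *\<^sub>R (- 2 * Re (c * cnj z * cnj w), c * (cnj z)\<^sup>2 - cnj c * w\<^sup>2)"
    unfolding spinor_defs prod_eq_iff complex_eq_iff c_def
    by (simp add: cmod_power2 power2_eq_square algebra_simps)
  define u where "u = cis (- \<phi> / 2)"
  have u: "u * u = cis (- \<phi>)" by (simp add: cis_mult u_def)
  have u': "cnj u * cnj u = cis \<phi>"
    unfolding u_def by (simp add: cis_cnj cis_mult)
  have E: "(u * z) * (u * w) = (u * u) * (z * w)" "(cnj (u * z))\<^sup>2 = (cnj u * cnj u) * (cnj z)\<^sup>2"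
    "(u * w)\<^sup>2 = (u * u) * w\<^sup>2"
    by (simp_all add: power2_eq_square algebra_simps)
  have 2: "hopf_frame (cscale u \<psi>) = (- 2 * Re (cis (- \<phi>) * (z * w)), cis \<phi> * (cnj z)\<^sup>2 - cis (- \<phi>) * w\<^sup>2)"
    unfolding hopf_frame_def cscale_def zw prod.sel E u u' ..
  have 3: "Re (cis (- \<phi>) * (z * w)) = Re (cis \<phi> * cnj z * cnj w)" by (simp add: algebra_simps)
  have c: "c = of_real r * cis \<phi>"
    using assms by (simp add: c_def r_def)
  then have c': "cnj c = of_real r * cis (- \<phi>)"
    by (simp add: cis_cnj)
  have "r *\<^sub>R hopf_frame (cscale u \<psi>) = (- 2 * Re (c * cnj z * cnj w), c * (cnj z)\<^sup>2 - cnj c * w\<^sup>2)"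
    unfolding 2 3 c' unfolding c by (simp add: scaleR_conv_of_real algebra_simps)
  then have "2 *\<^sub>R (- 2 * Re (c * cnj z * cnj w), c * (cnj z)\<^sup>2 - cnj c * w\<^sup>2) = (2 * r) *\<^sub>R hopf_frame (cscale u \<psi>)"
    by (metis scaleR_scaleR)
  then show ?thesis unfolding 1 r_def u_def by (simp only: mult.assoc)
qed

section \<open>Winding numbers through continuous logarithms\<close>

lemma exp_eq_1_constant:
  fixes f :: "'a::topological_space \<Rightarrow> complex"
  assumes "connected S" "continuous_on S f" "\<And>x. x \<in> S \<Longrightarrow> exp (f x) = 1" "x \<in> S" "y \<in> S"
  shows "f x = f y"
proof -
  have "f constant_on S"
  proof (rule continuous_discrete_range_constant[OF assms(1,2)])
    fix x assume x: "x \<in> S"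
    have "2 * pi \<le> norm (f y - f x)" if y: "y \<in> S" "f y \<noteq> f x" for y
    proof -
      have "exp (f y) = exp (f x)" using assms(3) x y by simp
      then obtain n :: int where n: "f y = f x + of_int (2 * n) * pi * \<i>" unfolding exp_eq by blast
      then have "n \<noteq> 0" using y by auto
      then have "1 \<le> \<bar>real_of_int n\<bar>" by linarith
      moreover have "norm (f y - f x) = 2 * pi * \<bar>real_of_int n\<bar>"
        using n by (simp add: norm_mult abs_mult)
      ultimately show ?thesis by simp
    qed
    then show "\<exists>e>0. \<forall>y. y \<in> S \<and> f y \<noteq> f x \<longrightarrow> e \<le> norm (f y - f x)"
      by (intro exI[of _ "2 * pi"]) simp
  qed
  then show ?thesis using assms(4,5) by (auto simp: constant_on_def)
qed

lemma ex_continuous_logarithm: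
  fixes f :: "'a::real_normed_vector \<Rightarrow> complex"
  assumes "continuous_on S f" "contractible S" "\<And>z. z \<in> S \<Longrightarrow> f z \<noteq> 0"
  shows "\<exists>g. continuous_on S g \<and> (\<forall>x\<in>S. f x = exp (g x))"
  by (metis continuous_logarithm_on_contractible[OF assms])

definition winds :: "(real \<Rightarrow> complex) \<Rightarrow> int \<Rightarrow> bool"
  where "winds \<gamma> n \<longleftrightarrow> (\<exists>l. continuous_on {0..2 * pi} l \<and> (\<forall>t\<in>{0..2 * pi}. \<gamma> t = exp (l t)) \<and>
    l (2 * pi) - l 0 = 2 * of_int n * pi * \<i>)"

text \<open>A logarithm exists on the whole contractible rectangle. The difference of its values at
  \<open>t = 2 * pi\<close> and \<open>t = 0\<close> lies in the discrete set of periods of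
  \<open>exp\<close>, so it is constant in \<open>k\<close>.\<close>

lemma winds_homotopy:
  assumes h: "continuous_on ({0..2 * pi} \<times> {0..1}) h"
    and nz: "\<And>t k. t \<in> {0..2 * pi} \<Longrightarrow> k \<in> {0..1} \<Longrightarrow> h (t, k) \<noteq> 0"
    and per: "\<And>k. k \<in> {0..1} \<Longrightarrow> h (2 * pi, k) = h (0, k)"
    and w: "winds (\<lambda>t. h (t, 0::real)) n"
  shows "winds (\<lambda>t. h (t, 1)) n"
proof -
  have con: "contractible ({0..2 * pi} \<times> {0..1::real})"
    by (intro convex_imp_contractible convex_Times) auto
  have nz': "h x \<noteq> 0" if "x \<in> {0..2 * pi} \<times> {0..1}" for x
    using nz[of "fst x" "snd x"] that by (simp add: mem_Times_iff)
  obtain l where l: "continuous_on ({0..2 * pi} \<times> {0..1}) l"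
    "\<And>x. x \<in> {0..2 * pi} \<times> {0..1} \<Longrightarrow> h x = exp (l x)"
    using ex_continuous_logarithm[OF h con nz'] by blast
  obtain l0 where l0: "continuous_on {0..2 * pi} l0" "\<And>t. t \<in> {0..2 * pi} \<Longrightarrow> h (t, 0) = exp (l0 t)"
    "l0 (2 * pi) - l0 0 = 2 * of_int n * pi * \<i>"
    using w unfolding winds_def by blast
  have c: "continuous_on {0..2 * pi} (\<lambda>t. l (t, k))" if "k \<in> {0..1}" for k
    by (rule continuous_on_compose2[OF l(1)]) (use that in \<open>auto intro!: continuous_intros\<close>)
  have c': "continuous_on {0..1} (\<lambda>k. l (t, k))" if "t \<in> {0..2*pi}" for t
    by (rule continuous_on_compose2[OF l(1)]) (use that in \<open>auto intro!: continuous_intros\<close>)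
  have "l0 (2 * pi) - l (2 * pi, 0) = l0 0 - l (0, 0)"
  proof (rule exp_eq_1_constant[of "{0..2 * pi}" "\<lambda>t. l0 t - l (t, 0)"])
    show "continuous_on {0..2 * pi} (\<lambda>t. l0 t - l (t, 0))"
      by (intro continuous_intros l0(1) c) simp
    show "exp (l0 t - l (t, 0)) = 1" if "t \<in> {0..2 * pi}" for t
      using l0(2)[OF that] l(2)[of "(t, 0)"] that by (simp add: exp_diff)
  qed auto
  moreover have "l (2 * pi, 1) - l (0, 1) = l (2 * pi, 0) - l (0, 0)"
  proof (rule exp_eq_1_constant[of "{0..1}" "\<lambda>k. l (2 * pi, k) - l (0, k)"])
    show "continuous_on {0..1} (\<lambda>k. l (2 * pi, k) - l (0, k))"
      by (intro continuous_intros c') simp_all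
    show "exp (l (2 * pi, k) - l (0, k)) = 1" if "k \<in> {0..1}" for k
      using l(2)[of "(2 * pi, k)"] l(2)[of "(0, k)"] per[OF that] that by (simp add: exp_diff)
  qed auto
  ultimately have "l (2 * pi, 1) - l (0, 1) = 2 * of_int n * pi * \<i>"
    using l0(3) by algebra
  then show ?thesis
    unfolding winds_def using c[of 1] by (intro exI[of _ "\<lambda>t. l (t, 1)"]) (simp add: l(2))
qed

text \<open>The one-dimensional Borsuk-Ulam argument: a logarithm grows by the same odd multiple of
  \<open>pi * \<i>\<close> over each half period, so in total by an odd multiple of
  \<open>2 * pi * \<i>\<close>.\<close>

lemma winds_antiperiodic:
  assumes \<gamma>: "continuous_on {0..2 * pi} \<gamma>" "\<And>t. t \<in> {0..2 * pi} \<Longrightarrow> \<gamma> t \<noteq> 0"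
    and anti: "\<And>t. t \<in> {0..pi} \<Longrightarrow> \<gamma> (t + pi) = - \<gamma> t"
  obtains n where "odd n" "winds \<gamma> n"
proof -
  have con: "contractible {0..2 * pi}"
    by (intro convex_imp_contractible) auto
  obtain l where l: "continuous_on {0..2 * pi} l" "\<And>t. t \<in> {0..2 * pi} \<Longrightarrow> \<gamma> t = exp (l t)"
    using ex_continuous_logarithm[OF \<gamma>(1) con \<gamma>(2)] by blast
  define d where "d = (\<lambda>t. l (t + pi) - l t - \<i> * pi)"
  have d1: "exp (d t) = 1" if "t \<in> {0..pi}" for t
  proof -
    have "exp (l (t + pi)) = - exp (l t)" using anti[OF that] l(2)[of t] l(2)[of "t + pi"] that by auto
    then show ?thesis by (simp add: d_def exp_diff)
  qed
  have "d pi = d 0"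
  proof (rule exp_eq_1_constant[OF _ _ d1])
    show "continuous_on {0..pi} d"
      unfolding d_def by (intro continuous_intros continuous_on_compose2[OF l(1)]) auto
  qed auto
  moreover have "exp (d 0) = exp 0" using d1[of 0] by simp
  then obtain m :: int where "d 0 = 0 + of_int (2 * m) * pi * \<i>"
    unfolding exp_eq by blast
  ultimately have "l (2 * pi) - l 0 = 2 * of_int (2 * m + 1) * pi * \<i>"
    by (simp add: d_def algebra_simps)
  then have "winds \<gamma> (2 * m + 1)" unfolding winds_def using l by blast
  then show ?thesis using that[of "2 * m + 1"] by simp
qed

text \<open>Positive rescaling keeps the sign of the inner product with \<open>e\<close>, so
  \<open>e\<close> separates the two directions.\<close>

lemma normalized_eqD:
  fixes a b e :: "'a::real_inner"
  assumes "(1 / norm a) *\<^sub>R a = (1 / norm b) *\<^sub>R b" "e \<bullet> a > 0" "e \<bullet> b \<le> 0"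
  shows False
proof -
  have "e \<bullet> ((1 / norm a) *\<^sub>R a) > 0" using assms(2) by (cases "a = 0") auto
  moreover have "e \<bullet> ((1 / norm b) *\<^sub>R b) \<le> 0" using assms(3) by (simp add: divide_nonpos_nonneg)
  ultimately show False using assms(1) by simp
qed

lemma sdet_commute: "sdet \<psi> \<phi> = - sdet \<phi> \<psi>"
  by (simp add: sdet_def algebra_simps)

lemma continuous_on_herm [continuous_intros]:
  "continuous_on S f \<Longrightarrow> continuous_on S g \<Longrightarrow> continuous_on S (\<lambda>x. herm (f x) (g x))"
  by (rule bounded_bilinear.continuous_on[OF bounded_bilinear_herm])

lemma continuous_on_sdet [continuous_intros]:
  "continuous_on S f \<Longrightarrow> continuous_on S g \<Longrightarrow> continuous_on S (\<lambda>x. sdet (f x) (g x))"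
  unfolding sdet_def by (intro continuous_intros)

text \<open>\<open>far\<close> keeps \<open>sdet\<close> away from zero while two parameters move
  from opposite points to distance \<open>\<eta>\<close>; \<open>near\<close> does so for the last
  step to the diagonal, with \<open>e t\<close> as separating vector. What remains is the phase of
  \<open>\<Psi> (t + \<eta>, t)\<close> relative to \<open>\<Psi> (t, t)\<close>, which describes
  the frame given by the push-off direction and a short chord.\<close>

theorem spin_frame:
  fixes U V :: "real \<Rightarrow> vec3" and \<Psi> :: "real \<times> real \<Rightarrow> spinor"
  defines "F \<equiv> \<lambda>s t. (1 / norm (U s - V t)) *\<^sub>R (U s - V t)"
  assumes \<Psi>: "continuous_on UNIV \<Psi>"
    "\<And>s t. \<Psi> (s + 2 * pi, t) = \<Psi> (s, t)" "\<And>s t. \<Psi> (s, t + 2 * pi) = \<Psi> (s, t)"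
    "\<And>s t. norm (\<Psi> (s, t)) = 1" "\<And>s t. hopf (\<Psi> (s, t)) = F s t"
    and \<eta>: "0 < \<eta>" "\<eta> < pi"
    and far: "\<And>s \<delta>. \<delta> \<in> {\<eta>..2 * pi - \<eta>} \<Longrightarrow> (U s - U (s + \<delta>)) \<bullet> (U s - V (s + \<delta>)) > 0"
      "\<And>s \<delta>. \<delta> \<in> {\<eta>..2 * pi - \<eta>} \<Longrightarrow> (U s - U (s + \<delta>)) \<bullet> (U (s + \<delta>) - V s) < 0"
    and near: "\<And>t. e t \<bullet> (V t - U t) = 0" "\<And>t x. x \<in> {0<..\<eta>} \<Longrightarrow> e t \<bullet> (U (t + x) - U t) > 0"
      "\<And>t x. x \<in> {0<..\<eta>} \<Longrightarrow> e t \<bullet> (U (t - x) - U t) < 0"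
      "\<And>t k. k \<in> {0..1} \<Longrightarrow> e t \<bullet> (U (t + k * \<eta>) - V (t - (1 - k) * \<eta>)) > 0"
  obtains \<xi> where "continuous_on {0..2 * pi} \<xi>" "\<And>t. norm (\<xi> t) = 1" "\<xi> (2 * pi) = - \<xi> 0"
    "\<And>t. hopf (\<xi> t) = F t t"
    "\<And>t. t \<in> {0..2 * pi} \<Longrightarrow> \<exists>a. \<exists>b>0. F (t + \<eta>) t = a *\<^sub>R hopf (\<xi> t) + b *\<^sub>R hopf_frame (\<xi> t)"
proof -
  have c\<Psi>: "continuous_on S (\<lambda>x. \<Psi> (f x, g x))" if "continuous_on S f" "continuous_on S g"
    for S :: "'x::topological_space set" and f g
    by (rule continuous_on_compose2[OF \<Psi>(1)]) (auto intro!: continuous_intros that)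
  have per: "\<Psi> (2 * pi + s, t) = \<Psi> (s, t)" "\<Psi> (s, 2 * pi + t) = \<Psi> (s, t)" for s t
    using \<Psi>(2)[of s t] \<Psi>(3)[of s t] by (simp_all add: add.commute)
  have per0: "\<Psi> (2 * pi, t) = \<Psi> (0, t)" "\<Psi> (s, 2 * pi) = \<Psi> (s, 0)"
    "\<Psi> (2 * pi - s, t) = \<Psi> (- s, t)" "\<Psi> (s, 2 * pi - t) = \<Psi> (s, - t)" for s t
    using per(1)[of 0 t] per(2)[of s 0] per(1)[of "- s" t] per(2)[of s "- t"] by simp_all
  \<comment> \<open>\<open>sdet\<close> vanishes only over equal directions, so one vector
    \<open>v\<close> that separates the two chords is enough.\<close>
  have nz: "sdet (\<Psi> (a, b)) (\<Psi> (c, d)) \<noteq> 0" if "v \<bullet> (U a - V b) > 0" "v \<bullet> (U c - V d) \<le> 0" for a b c d v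
    using sdet_eq_0[OF \<Psi>(4,4)] normalized_eqD[OF _ that] unfolding \<Psi>(5) F_def by blast
  define g where "g = (\<lambda>s t. sdet (\<Psi> (s, t)) (\<Psi> (t, s)))"
  obtain n where n: "odd n" "winds (\<lambda>t. g t (t + pi)) n"
  proof (rule winds_antiperiodic)
    show "continuous_on {0..2 * pi} (\<lambda>t. g t (t + pi))"
      unfolding g_def by (intro continuous_intros c\<Psi>)
    show "g t (t + pi) \<noteq> 0" for t
      unfolding g_def using far[of pi t] \<eta> by (intro nz[of "U t - U (t + pi)"]) auto
    show "g (t + pi) (t + pi + pi) = - g t (t + pi)" for t
      using per[of t "t + pi"] per[of "t + pi" t] unfolding g_def sdet_commute[of "\<Psi> (t, t + pi)"]
      by (simp add: algebra_simps)
  qed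
  \<comment> \<open>The second parameter slides from \<open>t + pi\<close> to
    \<open>t + 2 * pi - \<eta>\<close>, which by periodicity is \<open>t - \<eta>\<close>. The chord
    between the two knot points is the separating vector.\<close>
  have "winds (\<lambda>t. g t (t + (1 - 1) * pi + 1 * (2 * pi - \<eta>))) n"
  proof (rule winds_homotopy[of "\<lambda>x. g (fst x) (fst x + (1 - snd x) * pi + snd x * (2 * pi - \<eta>))", simplified fst_conv snd_conv])
    show "continuous_on ({0..2 * pi} \<times> {0..1}) (\<lambda>x. g (fst x) (fst x + (1 - snd x) * pi + snd x * (2 * pi - \<eta>)))"
      unfolding g_def by (intro continuous_intros c\<Psi>)
    show "g t (t + (1 - k) * pi + k * (2 * pi - \<eta>)) \<noteq> 0" if "k \<in> {0..1}" for t k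
    proof -
      let ?d = "(1 - k) * pi + k * (2 * pi - \<eta>)"
      have "?d = pi + k * (pi - \<eta>)" by (simp add: algebra_simps)
      moreover have "0 \<le> k * (pi - \<eta>)" "k * (pi - \<eta>) \<le> 1 * (pi - \<eta>)"
        using that \<eta> by (auto intro: mult_right_mono)
      ultimately have "?d \<in> {\<eta>..2 * pi - \<eta>}" using \<eta> by (simp del: mult_1)
      from far[OF this, of t] show ?thesis
        unfolding g_def by (intro nz[of "U t - U (t + ?d)"]) (simp_all add: add.assoc)
    qed
    show "g (2 * pi) (2 * pi + (1 - k) * pi + k * (2 * pi - \<eta>)) = g 0 (0 + (1 - k) * pi + k * (2 * pi - \<eta>))" for k
      unfolding g_def add.assoc per per0 by simp
    show "winds (\<lambda>t. g t (t + (1 - 0) * pi + 0 * (2 * pi - \<eta>))) n" using n(2) by simp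
  qed
  moreover have "g t (t + (1 - 1) * pi + 1 * (2 * pi - \<eta>)) = sdet (\<Psi> (t + 0 * \<eta>, t - (1 - 0) * \<eta>)) (\<Psi> (t - (1 - 0) * \<eta>, t))" for t
    using per(2)[of t "t - \<eta>"] per(1)[of "t - \<eta>" t] by (simp add: g_def algebra_simps)
  ultimately have "winds (\<lambda>t. sdet (\<Psi> (t + 0 * \<eta>, t - (1 - 0) * \<eta>)) (\<Psi> (t - (1 - 0) * \<eta>, t))) n"
    by simp
  \<comment> \<open>From here the arguments are no longer swaps of each other:
    \<open>(t, t - \<eta>)\<close> and \<open>(t - \<eta>, t)\<close> move to
    \<open>(t + \<eta>, t)\<close> and \<open>(t, t)\<close>. Throughout, the first direction lies
    on the positive side of \<open>e t\<close> and the second does not.\<close>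
  then have "winds (\<lambda>t. sdet (\<Psi> (t + 1 * \<eta>, t - (1 - 1) * \<eta>)) (\<Psi> (t - (1 - 1) * \<eta>, t))) n"
  proof (rule winds_homotopy[of "\<lambda>x. sdet (\<Psi> (fst x + snd x * \<eta>, fst x - (1 - snd x) * \<eta>))
      (\<Psi> (fst x - (1 - snd x) * \<eta>, fst x))", simplified fst_conv snd_conv, rotated -1])
    show "continuous_on ({0..2 * pi} \<times> {0..1}) (\<lambda>x. sdet (\<Psi> (fst x + snd x * \<eta>, fst x - (1 - snd x) * \<eta>))
      (\<Psi> (fst x - (1 - snd x) * \<eta>, fst x)))"
      by (intro continuous_intros c\<Psi>)
    show "sdet (\<Psi> (t + k * \<eta>, t - (1 - k) * \<eta>)) (\<Psi> (t - (1 - k) * \<eta>, t)) \<noteq> 0" if k: "k \<in> {0..1}" for t k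
    proof (rule nz)
      show "e t \<bullet> (U (t + k * \<eta>) - V (t - (1 - k) * \<eta>)) > 0" by (rule near(4)[OF k])
      have "e t \<bullet> (U (t - (1 - k) * \<eta>) - U t) \<le> 0"
      proof (cases "k = 1")
        case False
        have "(1 - k) * \<eta> \<le> 1 * \<eta>" using k \<eta> by (intro mult_right_mono) auto
        then have "(1 - k) * \<eta> \<in> {0<..\<eta>}" using k \<eta> False by simp
        from near(3)[OF this, of t] show ?thesis by simp
      qed simp
      then show "e t \<bullet> (U (t - (1 - k) * \<eta>) - V t) \<le> 0"
        using near(1)[of t] by (simp add: inner_diff_right)
    qed
    show "sdet (\<Psi> (2 * pi + k * \<eta>, 2 * pi - (1 - k) * \<eta>)) (\<Psi> (2 * pi - (1 - k) * \<eta>, 2 * pi))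
      = sdet (\<Psi> (0 + k * \<eta>, 0 - (1 - k) * \<eta>)) (\<Psi> (0 - (1 - k) * \<eta>, 0))" for k
      by (simp add: per per0)
  qed
  then obtain lb where lb: "continuous_on {0..2 * pi} lb"
    "\<And>t. t \<in> {0..2 * pi} \<Longrightarrow> sdet (\<Psi> (t + \<eta>, t)) (\<Psi> (t, t)) = exp (lb t)"
    "lb (2 * pi) - lb 0 = 2 * of_int n * pi * \<i>"
    unfolding winds_def by auto
  \<comment> \<open>The \<open>herm\<close> coefficient has winding number 0: shrinking the offset
    to zero leads to the constant 1, and on the way \<open>e t\<close> rules out antipodal
    directions.\<close>
  have "winds (\<lambda>t. herm (\<Psi> (t, t)) (\<Psi> (t + 0 * \<eta>, t))) 0"
    unfolding winds_def by (intro exI[of _ "\<lambda>t. 0"]) (simp add: herm_self \<Psi>(4))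
  then have "winds (\<lambda>t. herm (\<Psi> (t, t)) (\<Psi> (t + 1 * \<eta>, t))) 0"
  proof (rule winds_homotopy[of "\<lambda>x. herm (\<Psi> (fst x, fst x)) (\<Psi> (fst x + snd x * \<eta>, fst x))", simplified fst_conv snd_conv, rotated -1])
    show "continuous_on ({0..2 * pi} \<times> {0..1}) (\<lambda>x. herm (\<Psi> (fst x, fst x)) (\<Psi> (fst x + snd x * \<eta>, fst x)))"
      by (intro continuous_intros c\<Psi>)
    show "herm (\<Psi> (t, t)) (\<Psi> (t + k * \<eta>, t)) \<noteq> 0" if k: "k \<in> {0..1}" for t k
    proof (cases "k = 0")
      case True
      then show ?thesis by (simp add: herm_self \<Psi>(4))
    next
      case False
      have "k * \<eta> \<le> 1 * \<eta>" using k \<eta> by (intro mult_right_mono) auto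
      then have "k * \<eta> \<in> {0<..\<eta>}" using k \<eta> False by simp
      from near(2)[OF this, of t] have pos: "e t \<bullet> (U (t + k * \<eta>) - V t) > 0"
        using near(1)[of t] by (simp add: inner_diff_right)
      show ?thesis
      proof
        assume "herm (\<Psi> (t, t)) (\<Psi> (t + k * \<eta>, t)) = 0"
        then have "F t t = - F (t + k * \<eta>) t" using herm_eq_0[OF \<Psi>(4,4)] \<Psi>(5) by simp
        moreover have "V t - U t = - (U t - V t)" by simp
        ultimately have "(1 / norm (U (t + k * \<eta>) - V t)) *\<^sub>R (U (t + k * \<eta>) - V t) = (1 / norm (V t - U t)) *\<^sub>R (V t - U t)"
          unfolding F_def by (simp only: norm_minus_cancel scaleR_minus_right minus_minus)
        from normalized_eqD[OF this pos] show False using near(1)[of t] by simp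
      qed
    qed
    show "herm (\<Psi> (2 * pi, 2 * pi)) (\<Psi> (2 * pi + k * \<eta>, 2 * pi)) = herm (\<Psi> (0, 0)) (\<Psi> (0 + k * \<eta>, 0))" for k
      by (simp add: per per0)
  qed
  then obtain la where la: "continuous_on {0..2 * pi} la"
    "\<And>t. t \<in> {0..2 * pi} \<Longrightarrow> herm (\<Psi> (t, t)) (\<Psi> (t + \<eta>, t)) = exp (la t)"
    "la (2 * pi) - la 0 = 0"
    unfolding winds_def by auto
  \<comment> \<open>An argument of the conjugated \<open>herm\<close> coefficient times the
    \<open>sdet\<close> coefficient; the summand \<open>pi\<close> pays for the order of the
    arguments of \<open>sdet\<close>, which is opposite to that in \<open>lb\<close>.\<close>
  define \<phi> where "\<phi> = (\<lambda>t. Im (lb t) - Im (la t) + pi)"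
  define \<xi> where "\<xi> = (\<lambda>t. cscale (cis (- \<phi> t / 2)) (\<Psi> (t, t)))"
  show ?thesis
  proof
    show "continuous_on {0..2 * pi} \<xi>"
      unfolding \<xi>_def \<phi>_def cis_conv_exp
      by (intro bounded_bilinear.continuous_on[OF bounded_bilinear_cscale] continuous_intros la lb c\<Psi>) simp
    show "norm (\<xi> t) = 1" "hopf (\<xi> t) = F t t" for t
      by (simp_all add: \<xi>_def norm_cscale hopf_cscale \<Psi>(4,5))
    have "\<phi> (2 * pi) = \<phi> 0 + 2 * pi * of_int n"
      using arg_cong[OF la(3), of Im] arg_cong[OF lb(3), of Im] by (simp add: \<phi>_def algebra_simps)
    then have "- \<phi> (2 * pi) / 2 = - \<phi> 0 / 2 + - (pi * of_int n)"
      by (simp add: field_simps)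
    then have "cis (- \<phi> (2 * pi) / 2) = cis (- \<phi> 0 / 2) * cis (- (pi * of_int n))"
      by (simp only: cis_mult)
    also have "cis (- (pi * of_int n)) = - 1"
    proof -
      obtain m where "n = 2 * m + 1" using n(1) by (rule oddE)
      then have "- (pi * of_int n) = 2 * pi * of_int (- m - 1) + pi"
        by (simp add: algebra_simps)
      moreover have "cis (2 * pi * of_int j) = 1" for j :: int
        by (simp add: complex_eq_iff)
      ultimately have "cis (- (pi * of_int n)) = cis pi"
        by (simp only: mult_1 flip: cis_mult)
      then show ?thesis by simp
    qed
    finally show "\<xi> (2 * pi) = - \<xi> 0"
      by (simp add: per0 \<xi>_def cscale_def)
    fix t assume t: "t \<in> {0..2 * pi}"
    let ?A = "herm (\<Psi> (t, t)) (\<Psi> (t + \<eta>, t))" and ?B = "sdet (\<Psi> (t, t)) (\<Psi> (t + \<eta>, t))"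
    have B: "?B = - exp (lb t)" using lb(2)[OF t] sdet_commute[of "\<Psi> (t, t)" "\<Psi> (t + \<eta>, t)"] by simp
    have "cnj ?A * ?B = - exp (cnj (la t) + lb t)"
      unfolding B la(2)[OF t] by (simp add: exp_add flip: exp_cnj)
    also have "\<dots> = exp (of_real (Re (la t) + Re (lb t)) + \<i> * of_real (\<phi> t))"
    proof -
      have "of_real (Re (la t) + Re (lb t)) + \<i> * of_real (\<phi> t) = (cnj (la t) + lb t) + \<i> * pi"
        by (simp add: complex_eq_iff \<phi>_def)
      then show ?thesis by (simp only: exp_add exp_pi_i') simp
    qed
    also have "\<dots> = of_real (cmod ?A * cmod ?B) * cis (\<phi> t)"
      unfolding B la(2)[OF t] by (simp add: exp_add cis_conv_exp exp_of_real)
    finally have "cnj ?A * ?B = of_real (cmod ?A * cmod ?B) * cis (\<phi> t)" .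
    from hopf_expansion[OF this, of "\<Psi> (t, t)"]
    have "F (t + \<eta>) t = ((cmod ?A)\<^sup>2 - (cmod ?B)\<^sup>2) *\<^sub>R hopf (\<Psi> (t, t)) + (2 * cmod ?A * cmod ?B) *\<^sub>R hopf_frame (\<xi> t)"
      using spinor_expansion[of "\<Psi> (t, t)" "\<Psi> (t + \<eta>, t)"] by (simp add: \<Psi>(4,5) \<xi>_def)
    moreover have "2 * cmod ?A * cmod ?B > 0" unfolding B la(2)[OF t] by simp
    ultimately show "\<exists>a. \<exists>b>0. F (t + \<eta>) t = a *\<^sub>R hopf (\<xi> t) + b *\<^sub>R hopf_frame (\<xi> t)"
      unfolding \<open>hopf (\<xi> t) = F t t\<close> \<Psi>(5) by blast
  qed
qed

section \<open>Coordinates on 4-space\<close>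

lemma vector_4 [simp]:
  "(vector [a, b, c, d] :: ('a::zero)^4) $ 1 = a" "(vector [a, b, c, d] :: ('a::zero)^4) $ 2 = b"
  "(vector [a, b, c, d] :: ('a::zero)^4) $ 3 = c" "(vector [a, b, c, d] :: ('a::zero)^4) $ 4 = d"
  unfolding vector_def by simp_all

lemma det_4: "det (A :: real^4^4) =
   A$1$1 * (A$2$2 * (A$3$3 * A$4$4 - A$3$4 * A$4$3) - A$2$3 * (A$3$2 * A$4$4 - A$3$4 * A$4$2) + A$2$4 * (A$3$2 * A$4$3 - A$3$3 * A$4$2))
 - A$1$2 * (A$2$1 * (A$3$3 * A$4$4 - A$3$4 * A$4$3) - A$2$3 * (A$3$1 * A$4$4 - A$3$4 * A$4$1) + A$2$4 * (A$3$1 * A$4$3 - A$3$3 * A$4$1))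
 + A$1$3 * (A$2$1 * (A$3$2 * A$4$4 - A$3$4 * A$4$2) - A$2$2 * (A$3$1 * A$4$4 - A$3$4 * A$4$1) + A$2$4 * (A$3$1 * A$4$2 - A$3$2 * A$4$1))
 - A$1$4 * (A$2$1 * (A$3$2 * A$4$3 - A$3$3 * A$4$2) - A$2$2 * (A$3$1 * A$4$3 - A$3$3 * A$4$1) + A$2$3 * (A$3$1 * A$4$2 - A$3$2 * A$4$1))"
proof -
  have f: "finite {2::4, 3, 4}" "1 \<notin> {2::4, 3, 4}" "finite {3::4, 4}" "2 \<notin> {3::4, 4}" "finite {4::4}" "3 \<notin> {4::4}"
    by auto
  show ?thesis
    unfolding det_def UNIV_4
    unfolding sum_over_permutations_insert[OF f(1,2)]
    unfolding sum_over_permutations_insert[OF f(3,4)]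
    unfolding sum_over_permutations_insert[OF f(5,6)]
    unfolding permutes_sing
    by (simp add: sign_swap_id permutation_swap_id sign_compose permutation_compose sign_id swap_id_eq Transposition.transpose_def algebra_simps)
qed

lemma inner_4: "x \<bullet> y = x$1 * y$1 + x$2 * y$2 + x$3 * y$3 + x$4 * y$4" for x y :: "real^4"
  by (simp add: inner_vec_def sum_4)

lemma vec_eq_4: "x = y \<longleftrightarrow> x$1 = y$1 \<and> x$2 = y$2 \<and> x$3 = y$3 \<and> x$4 = y$4" for x y :: "'a^4"
  by (simp add: vec_eq_iff forall_4)

text \<open>
  The coordinates of \<open>x\<close> in an orthonormal basis of the complement of the unit vector \<open>w\<close>,
  obtained from \<open>w\<close> by quaternion multiplication.
\<close>

definition chart :: "real^4 \<Rightarrow> real^4 \<Rightarrow> vec3"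
  where "chart w x = (w$4 * x$1 + w$3 * x$2 - w$2 * x$3 - w$1 * x$4,
    Complex (- w$3 * x$1 + w$4 * x$2 + w$1 * x$3 - w$2 * x$4)
      (w$2 * x$1 - w$1 * x$2 + w$4 * x$3 - w$3 * x$4))"

text \<open>The adjoint of \<open>chart w\<close>; for a unit vector \<open>w\<close> also its
  inverse on the complement of \<open>w\<close>.\<close>

definition unchart :: "real^4 \<Rightarrow> vec3 \<Rightarrow> real^4"
  where "unchart w a = fst a *\<^sub>R vector [w$4, w$3, - w$2, - w$1]
    + Re (snd a) *\<^sub>R vector [- w$3, w$4, w$1, - w$2] + Im (snd a) *\<^sub>R vector [w$2, - w$1, w$4, - w$3]"

lemma unchart_chart: "unchart w (chart w x) = (w \<bullet> w) *\<^sub>R x - (x \<bullet> w) *\<^sub>R w"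
  by (simp add: vec_eq_4 unchart_def chart_def inner_4 algebra_simps)

lemma chart_unchart: "chart w (unchart w a) = (w \<bullet> w) *\<^sub>R a"
  by (simp add: prod_eq_iff complex_eq_iff unchart_def chart_def inner_4 algebra_simps)

lemma unchart_inner: "unchart w a \<bullet> unchart w b = (w \<bullet> w) * (a \<bullet> b)"
  by (simp add: unchart_def inner_4 inner_prod_def inner_complex_def algebra_simps)

lemma unchart_orthogonal: "unchart w a \<bullet> w = 0"
  by (simp add: unchart_def inner_4 algebra_simps)

lemma chart_inner: "chart w x \<bullet> chart w y = (w \<bullet> w) * (x \<bullet> y) - (x \<bullet> w) * (y \<bullet> w)"
  by (simp add: chart_def inner_4 inner_prod_def inner_complex_def algebra_simps)

text \<open>For unit \<open>w\<close> the chart carries the orientation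
  \<open>det(a, b, c, w)\<close> of the complement to that of \<open>triple\<close>. As a polynomial
  identity this needs the factor \<open>w \<bullet> w\<close> for homogeneity.\<close>

lemma det_chart:
  "(w \<bullet> w) * det (vector [x, y, z, w] :: real^4^4) = triple (chart w x) (chart w y) (chart w z)"
  unfolding det_4 triple_def by (simp add: chart_def inner_4 algebra_simps)

lemma linear_chart: "bounded_linear (chart w)"
  unfolding linear_conv_bounded_linear[symmetric]
  by (rule linearI) (simp_all add: chart_def prod_eq_iff complex_eq_iff algebra_simps)

lemma linear_unchart: "bounded_linear (unchart w)"
  unfolding linear_conv_bounded_linear[symmetric]
  by (rule linearI) (simp_all add: unchart_def algebra_simps)

section \<open>Completing orthonormal triples to rotation matrices\<close>

definition cross4 :: "real^4 \<Rightarrow> real^4 \<Rightarrow> real^4 \<Rightarrow> real^4"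
  where "cross4 x y z = (\<chi> k. det (vector [x, y, axis k 1, z] :: real^4^4))"

lemma inner_cross4: "b \<bullet> cross4 x y z = det (vector [x, y, b, z] :: real^4^4)"
  unfolding inner_4 cross4_def det_4 by (simp add: axis_def algebra_simps)

lemma cross4_orthogonal: "x \<bullet> cross4 x y z = 0" "y \<bullet> cross4 x y z = 0" "z \<bullet> cross4 x y z = 0"
  unfolding inner_cross4 det_4 by (simp_all add: algebra_simps)

lemma continuous_on_cross4:
  assumes "continuous_on S x" "continuous_on S y" "continuous_on S z"
  shows "continuous_on S (\<lambda>s. cross4 (x s) (y s) (z s))"
  unfolding cross4_def det_4 vector_4
  by (intro continuous_on_vec_lambda continuous_intros assms)

lemma continuous_on_vector_4:
  fixes a b c d :: "'a::topological_space \<Rightarrow> 'b::{zero, topological_space}"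
  assumes "continuous_on S a" "continuous_on S b" "continuous_on S c" "continuous_on S d"
  shows "continuous_on S (\<lambda>s. vector [a s, b s, c s, d s] :: 'b^4)"
proof -
  have "continuous_on S (\<lambda>s. (vector [a s, b s, c s, d s] :: 'b^4) $ i)" for i
    using exhaust_4[of i] assms by (elim disjE) simp_all
  then have "continuous_on S (\<lambda>s. \<chi> i. (vector [a s, b s, c s, d s] :: 'b^4) $ i)"
    by (rule continuous_on_vec_lambda)
  then show ?thesis by simp
qed

definition orthonormal3 :: "real^4 \<Rightarrow> real^4 \<Rightarrow> real^4 \<Rightarrow> bool"
  where "orthonormal3 x y z \<longleftrightarrow> norm x = 1 \<and> norm y = 1 \<and> norm z = 1 \<and> x \<bullet> y = 0 \<and> x \<bullet> z = 0 \<and> y \<bullet> z = 0"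

definition frame4 :: "real^4 \<Rightarrow> real^4 \<Rightarrow> real^4 \<Rightarrow> real^4^4"
  where "frame4 x y z = transpose (vector [x, y, cross4 x y z, z])"

definition cross_vec :: "vec3 \<Rightarrow> vec3 \<Rightarrow> vec3"
  where "cross_vec a b = (Im (cnj (snd a) * snd b), \<i> * (of_real (fst a) * snd b - of_real (fst b) * snd a))"

lemma triple_eq_inner: "triple a b c = cross_vec a b \<bullet> c"
  by (simp add: triple_def cross_vec_def inner_prod_def inner_complex_def algebra_simps)

lemma lagrange_cross_vec: "cross_vec a b \<bullet> cross_vec a b = (a \<bullet> a) * (b \<bullet> b) - (a \<bullet> b)\<^sup>2"
  by (simp add: cross_vec_def inner_prod_def inner_complex_def power2_eq_square algebra_simps)

lemma inner_unchart: "x \<bullet> unchart w a = chart w x \<bullet> a"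
  by (simp add: unchart_def chart_def inner_4 inner_prod_def inner_complex_def algebra_simps)

text \<open>In the chart at \<open>z\<close> the vector is an ordinary cross product, whose length
  is given by Lagrange's identity.\<close>

lemma norm_cross4:
  assumes "orthonormal3 x y z"
  shows "norm (cross4 x y z) = 1"
proof -
  have xyz: "x \<bullet> x = 1" "y \<bullet> y = 1" "z \<bullet> z = 1" "x \<bullet> y = 0" "x \<bullet> z = 0" "y \<bullet> z = 0"
    using assms by (simp_all add: orthonormal3_def flip: norm_eq_1)
  let ?v = "cross_vec (chart z x) (chart z y)"
  have "b \<bullet> cross4 x y z = b \<bullet> unchart z ?v" for b
    using det_chart[of z x y b] xyz(3) by (simp add: inner_cross4 inner_unchart triple_eq_inner inner_commute)
  then have "cross4 x y z = unchart z ?v"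
    by (metis vector_eq_ldot)
  then have "cross4 x y z \<bullet> cross4 x y z = 1"
    by (simp add: unchart_inner xyz lagrange_cross_vec chart_inner)
  then show ?thesis unfolding norm_eq_1 .
qed

lemma rotation_matrix_columns:
  assumes "orthonormal3 x y z" "norm b = 1" "x \<bullet> b = 0" "y \<bullet> b = 0" "z \<bullet> b = 0"
  shows "orthogonal_matrix (transpose (vector [x, y, b, z]) :: real^4^4)"
  unfolding orthogonal_matrix_transpose
  unfolding orthogonal_matrix_orthonormal_rows row_def forall_4
  using assms by (simp add: orthonormal3_def orthogonal_def inner_commute)

lemma rotation_matrix_frame4:
  assumes "orthonormal3 x y z"
  shows "rotation_matrix (frame4 x y z)"
proof -
  have "det (frame4 x y z) = cross4 x y z \<bullet> cross4 x y z"
    unfolding frame4_def det_transpose inner_cross4 ..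
  also have "\<dots> = 1"
    using norm_cross4[OF assms] unfolding norm_eq_1 .
  finally show ?thesis
    using rotation_matrix_columns[OF assms norm_cross4[OF assms] cross4_orthogonal]
    unfolding rotation_matrix_def frame4_def by blast
qed

text \<open>Determinant 1 says that the two unit vectors \<open>b\<close> and
  \<open>cross4 x y z\<close> have inner product 1.\<close>

lemma cross4_unique:
  assumes "orthonormal3 x y z" "norm b = 1" "rotation_matrix (transpose (vector [x, y, b, z]) :: real^4^4)"
  shows "b = cross4 x y z"
proof (rule unit_inner_eq_1[OF assms(2) norm_cross4[OF assms(1)]])
  show "b \<bullet> cross4 x y z = 1"
    using assms(3) by (simp add: inner_cross4 rotation_matrix_def)
qed

text \<open>Replaces the definite description in \<open>binormal\<close> by a formula that is
  visibly continuous in the triple.\<close>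

lemma frame_eq_frame4:
  assumes "orthonormal3 (unit_tangent f z) (N z) (f z)"
  shows "frame f N z = frame4 (unit_tangent f z) (N z) (f z)"
proof -
  have "binormal f N z = cross4 (unit_tangent f z) (N z) (f z)"
    unfolding binormal_def
  proof (rule the_equality)
    show "norm (cross4 (unit_tangent f z) (N z) (f z)) = 1 \<and>
      rotation_matrix (transpose (vector [unit_tangent f z, N z, cross4 (unit_tangent f z) (N z) (f z), f z]))"
      using norm_cross4[OF assms] rotation_matrix_frame4[OF assms] unfolding frame4_def by blast
    show "b = cross4 (unit_tangent f z) (N z) (f z)" if "norm b = 1 \<and>
        rotation_matrix (transpose (vector [unit_tangent f z, N z, b, f z]))" for b
      using that by (intro cross4_unique[OF assms]) simp_all
  qed
  then show ?thesis unfolding frame_def frame4_def by (rule arg_cong)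
qed

lemma matrix_mul_columns:
  "Q ** transpose (vector [x, y, b, z]) = transpose (vector [Q *v x, Q *v y, Q *v b, Q *v z] :: real^4^4)"
  for Q :: "real^4^4"
proof -
  have "(Q ** transpose (vector [x, y, b, z])) $ i $ j = transpose (vector [Q *v x, Q *v y, Q *v b, Q *v z]) $ i $ j" for i j :: 4
    using exhaust_4[of j] by (elim disjE) (simp_all add: matrix_matrix_mult_def matrix_vector_mult_def transpose_def)
  then show ?thesis by (simp add: vec_eq_iff)
qed

lemma orthogonal_matrix_inner:
  fixes M :: "real^'n^'n"
  assumes "orthogonal_matrix M"
  shows "(M *v x) \<bullet> (M *v y) = x \<bullet> y"
  using assms orthogonal_transformation_matrix[of "(*v) M"]
  by (simp add: orthogonal_transformation_def matrix_of_matrix_vector_mul)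

lemma orthonormal3_orthogonal_matrix:
  assumes "orthogonal_matrix M" "orthonormal3 x y z"
  shows "orthonormal3 (M *v x) (M *v y) (M *v z)"
  using assms(2) unfolding orthonormal3_def norm_eq_1 orthogonal_matrix_inner[OF assms(1)] .

text \<open>A rotation preserves the properties that determine the completing vector, so by
  uniqueness it moves this vector along with the triple.\<close>

lemma frame4_equivariant:
  assumes Q: "rotation_matrix Q" and xyz: "orthonormal3 x y z"
  shows "frame4 (Q *v x) (Q *v y) (Q *v z) = Q ** frame4 x y z"
proof -
  have orth: "orthogonal_matrix Q" using Q by (simp add: rotation_matrix_def)
  have eq: "Q ** frame4 x y z = transpose (vector [Q *v x, Q *v y, Q *v cross4 x y z, Q *v z])"
    by (simp add: frame4_def matrix_mul_columns)
  have "rotation_matrix (Q ** frame4 x y z)"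
    using Q rotation_matrix_frame4[OF xyz] by (simp add: rotation_matrix_def orthogonal_matrix_mul det_mul)
  moreover have "norm (Q *v cross4 x y z) = 1"
    using norm_cross4[OF xyz] unfolding norm_eq_1 orthogonal_matrix_inner[OF orth] .
  ultimately have "Q *v cross4 x y z = cross4 (Q *v x) (Q *v y) (Q *v z)"
    using cross4_unique[OF orthonormal3_orthogonal_matrix[OF orth xyz]] unfolding eq by blast
  then show ?thesis unfolding eq unfolding frame4_def by simp
qed

lemma continuous_on_frame4:
  assumes "continuous_on S x" "continuous_on S y" "continuous_on S z"
  shows "continuous_on S (\<lambda>s. frame4 (x s) (y s) (z s))"
  unfolding frame4_def transpose_def
  by (intro continuous_on_vec_lambda continuous_on_component continuous_on_vector_4 continuous_on_cross4 assms)

section \<open>Loops of rotations that fix a given unit vector\<close>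

definition chart_matrix :: "real^4 \<Rightarrow> real^4^4"
  where "chart_matrix w = vector [vector [w$4, w$3, - w$2, - w$1], vector [- w$3, w$4, w$1, - w$2],
    vector [w$2, - w$1, w$4, - w$3], w]"

lemma chart_matrix_mult:
  "chart_matrix w *v x = vector [fst (chart w x), Re (snd (chart w x)), Im (snd (chart w x)), x \<bullet> w]"
  unfolding vec_eq_4 by (simp add: chart_matrix_def matrix_vector_mult_def sum_4 chart_def inner_4 algebra_simps)

lemma orthogonal_chart_matrix:
  assumes "norm w = 1"
  shows "orthogonal_matrix (chart_matrix w)"
proof -
  have "w \<bullet> w = 1" using assms by (simp add: norm_eq_1)
  then show ?thesis
    unfolding orthogonal_matrix_orthonormal_rows row_def forall_4 chart_matrix_def
    by (simp add: orthogonal_def inner_4 norm_eq_1 algebra_simps)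
qed

lemma chart_matrix_axis: "chart_matrix (vector [0, 0, 0, 1]) = mat 1"
  unfolding vec_eq_iff forall_4 by (simp add: chart_matrix_def mat_def)

lemma continuous_on_chart_matrix:
  assumes "continuous_on S w"
  shows "continuous_on S (\<lambda>s. chart_matrix (w s))"
  unfolding chart_matrix_def by (intro continuous_on_vector_4 continuous_intros assms)

lemma rotation_mult: "rotation \<phi> *v x = vector [x$1, cos \<phi> * x$2 - sin \<phi> * x$3, sin \<phi> * x$2 + cos \<phi> * x$3, x$4]"
  unfolding vec_eq_4 by (simp add: rotation_def matrix_vector_mult_def sum_4)

lemma rotation_matrix_rotation: "rotation_matrix (rotation \<phi>)"
proof -
  have sc: "sin \<phi> * sin \<phi> + cos \<phi> * cos \<phi> = 1" "cos \<phi> * cos \<phi> + sin \<phi> * sin \<phi> = 1"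
    using sin_cos_squared_add[of \<phi>] by (simp_all add: power2_eq_square)
  have "det (rotation \<phi>) = 1"
    unfolding det_4 by (simp add: rotation_def sc)
  moreover have "orthogonal_matrix (rotation \<phi>)"
    unfolding orthogonal_matrix_orthonormal_rows row_def forall_4
    by (simp add: rotation_def orthogonal_def inner_4 norm_eq_1 sc)
  ultimately show ?thesis by (simp add: rotation_matrix_def)
qed

lemma continuous_on_rotation:
  fixes \<phi> :: "'a::t2_space \<Rightarrow> real"
  assumes "continuous_on S \<phi>"
  shows "continuous_on S (\<lambda>s. rotation (\<phi> s))"
  unfolding rotation_def by (intro continuous_on_vector_4 continuous_intros assms)

text \<open>The rotation of the theorem, conjugated so that it fixes \<open>w\<close> in place of
  the fourth axis. In the chart at \<open>w\<close> it multiplies the complex coordinate by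
  \<open>cis \<phi>\<close>.\<close>

definition conj_rotation :: "real^4 \<Rightarrow> real \<Rightarrow> real^4^4"
  where "conj_rotation w \<phi> = transpose (chart_matrix w) ** rotation \<phi> ** chart_matrix w"

lemma rotation_matrix_conj_rotation:
  assumes "norm w = 1"
  shows "rotation_matrix (conj_rotation w \<phi>)"
proof -
  have o: "orthogonal_matrix (chart_matrix w)" using orthogonal_chart_matrix[OF assms] .
  have "det (chart_matrix w) = 1 \<or> det (chart_matrix w) = - 1" by (rule det_orthogonal_matrix[OF o])
  then show ?thesis
    using rotation_matrix_rotation[of \<phi>] o
    by (auto simp: rotation_matrix_def conj_rotation_def orthogonal_matrix_mul det_mul)
qed

lemma conj_rotation_mult:
  assumes "norm w = 1"
  shows "conj_rotation w \<phi> *v unchart w a = unchart w (fst a, cis \<phi> * snd a)" "conj_rotation w \<phi> *v w = w"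
proof -
  have ww: "w \<bullet> w = 1" using assms by (simp add: norm_eq_1)
  have 1: "transpose (chart_matrix w) *v vector [fst b, Re (snd b), Im (snd b), c] = unchart w b + c *\<^sub>R w" for b c
    unfolding vec_eq_4 by (simp add: chart_matrix_def transpose_def matrix_vector_mult_def sum_4 unchart_def algebra_simps)
  have 2: "chart_matrix w *v unchart w a = vector [fst a, Re (snd a), Im (snd a), 0]"
    by (simp add: chart_matrix_mult chart_unchart unchart_orthogonal ww)
  have 3: "chart_matrix w *v w = vector [0, 0, 0, 1]"
    by (simp add: chart_matrix_mult ww) (simp add: chart_def)
  have "conj_rotation w \<phi> *v unchart w a = transpose (chart_matrix w) *v
      vector [fst (fst a, cis \<phi> * snd a), Re (snd (fst a, cis \<phi> * snd a)), Im (snd (fst a, cis \<phi> * snd a)), 0]"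
    unfolding conj_rotation_def by (simp add: 2 rotation_mult algebra_simps flip: matrix_vector_mul_assoc)
  then show "conj_rotation w \<phi> *v unchart w a = unchart w (fst a, cis \<phi> * snd a)"
    unfolding 1 by simp
  have "conj_rotation w \<phi> *v w = transpose (chart_matrix w) *v vector [fst (0::vec3), Re (snd (0::vec3)), Im (snd (0::vec3)), 1]"
    unfolding conj_rotation_def by (simp add: 3 rotation_mult flip: matrix_vector_mul_assoc)
  then show "conj_rotation w \<phi> *v w = w"
    unfolding 1 by (simp add: unchart_def)
qed

lemma rotation_0: "rotation (2 * pi * of_int n) = mat 1"
  unfolding vec_eq_iff forall_4 by (simp add: rotation_def mat_def)

section \<open>Curves and nearby push-offs\<close>

lemma periodic_representative:
  obtains n :: int where "t + 2 * pi * of_int n \<in> {0..2 * pi}"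
proof -
  have "of_int \<lfloor>t / (2 * pi)\<rfloor> \<le> t / (2 * pi)" "t / (2 * pi) \<le> of_int \<lfloor>t / (2 * pi)\<rfloor> + 1" by linarith+
  from this[THEN mult_left_mono[of _ _ "2 * pi"]] show ?thesis
    by (intro that[of "- \<lfloor>t / (2 * pi)\<rfloor>"]) (simp add: algebra_simps)
qed

text \<open>On the compact slice at 0 the function has a positive minimum, and the tube lemma bounds
  its change by half of that for all small \<open>x\<close>.\<close>

lemma eventually_positive_compact:
  fixes G :: "real \<times> real \<Rightarrow> real"
  assumes "continuous_on ({0..r} \<times> K) G" "compact K" "0 < r" "\<And>t. t \<in> K \<Longrightarrow> G (0, t) > 0"
  obtains d where "d > 0" "d \<le> r" "\<And>x t. x \<in> {0..d} \<Longrightarrow> t \<in> K \<Longrightarrow> G (x, t) > 0"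
proof (cases "K = {}")
  case True
  then show ?thesis using that[of r] assms(3) by simp
next
  case False
  have "continuous_on K (\<lambda>t. G (0, t))"
    by (rule continuous_on_compose2[OF assms(1)]) (use assms(3) in \<open>auto intro!: continuous_intros\<close>)
  then obtain t0 where t0: "t0 \<in> K" "\<And>t. t \<in> K \<Longrightarrow> G (0, t0) \<le> G (0, t)"
    using continuous_attains_inf[OF assms(2) False] by blast
  define e where "e = G (0, t0) / 2"
  have e: "e > 0" "\<And>t. t \<in> K \<Longrightarrow> e < G (0, t)"
    using assms(4)[OF t0(1)] t0(2) unfolding e_def by force+
  have "continuous_on ({0..r} \<times> K) (\<lambda>(x, t). G (x, t))" using assms(1) by (simp add: case_prod_eta)
  moreover have "0 \<in> {0..r}" using assms(3) by simp
  ultimately obtain X where X: "0 \<in> X" "open X" "\<forall>x\<in>X \<inter> {0..r}. \<forall>t\<in>K. dist (G (x, t)) (G (0, t)) \<le> e"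
    using continuous_on_prod_compactE[OF _ assms(2) _ e(1), of "{0..r}" "\<lambda>(x, t). G (x, t)" 0] by (metis case_prod_conv)
  obtain d where d: "d > 0" "cball 0 d \<subseteq> X" using X open_contains_cball by blast
  show ?thesis
  proof (rule that[of "min d r"])
    fix x t assume x: "x \<in> {0..min d r}" and t: "t \<in> K"
    then have "x \<in> X" using d by (auto simp: subset_iff)
    moreover have "x \<in> {0..r}" using x by auto
    ultimately have "dist (G (x, t)) (G (0, t)) \<le> e" using X(3) t by blast
    then show "G (x, t) > 0" using e(2)[OF t] by (simp add: dist_real_def)
  qed (use d assms(3) in auto)
qed

text \<open>Supplies the hypotheses of \<open>spin_frame\<close> for
  \<open>V = U + \<epsilon> D\<close>. The scale \<open>\<eta>\<close> comes from the modulus of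
  continuity of \<open>U'\<close>; then \<open>\<epsilon>1\<close> makes the push-off negligible at
  that scale. Dividing the displacement by \<open>\<epsilon>\<close> keeps its direction under
  control up to \<open>\<epsilon> = 0\<close>, where it is the normal \<open>b\<close>.\<close>

lemma pushoff_estimates:
  fixes U U' a b :: "real \<Rightarrow> 'a::euclidean_space" and D :: "real \<Rightarrow> real \<Rightarrow> 'a"
  assumes dU: "\<And>t. (U has_vector_derivative U' t) (at t)" "continuous_on UNIV U'"
    and U': "\<And>t. U' t = \<mu> t *\<^sub>R a t" "\<And>t. \<mu> t > 0"
    and ab: "\<And>t. norm (a t) = 1" "\<And>t. norm (b t) = 1" "\<And>t. a t \<bullet> b t = 0"
      "continuous_on UNIV a" "continuous_on UNIV b"
    and per: "\<And>t. U (t + 2 * pi) = U t" "\<And>t. U' (t + 2 * pi) = U' t" "\<And>t. a (t + 2 * pi) = a t"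
      "\<And>t. b (t + 2 * pi) = b t" "\<And>\<epsilon> t. D \<epsilon> (t + 2 * pi) = D \<epsilon> t"
    and D: "continuous_on ({0..\<epsilon>0} \<times> {0..2 * pi}) (\<lambda>x. D (fst x) (snd x))" "\<epsilon>0 > 0"
      "\<And>t. D 0 t = \<nu> t *\<^sub>R b t" "\<And>t. \<nu> t > 0"
    and inj: "\<And>s \<delta>. \<delta> \<in> {0<..<2 * pi} \<Longrightarrow> U (s + \<delta>) \<noteq> U s"
  obtains \<eta> \<epsilon>1 where "0 < \<eta>" "\<eta> < pi" "0 < \<epsilon>1" "\<epsilon>1 \<le> \<epsilon>0"
    "\<And>t. norm ((1 / (\<eta> * \<mu> t)) *\<^sub>R (U (t + \<eta>) - U t) - a t) \<le> 1 / 16"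
    "\<And>\<epsilon> t. \<epsilon> \<in> {0<..\<epsilon>1} \<Longrightarrow> D \<epsilon> t \<noteq> 0"
    "\<And>\<epsilon> t. \<epsilon> \<in> {0<..\<epsilon>1} \<Longrightarrow> norm ((1 / norm (D \<epsilon> t)) *\<^sub>R D \<epsilon> t - b t) < 1 / 4"
    "\<And>\<epsilon> s \<delta>. \<epsilon> \<in> {0<..\<epsilon>1} \<Longrightarrow> \<delta> \<in> {\<eta>..2 * pi - \<eta>} \<Longrightarrow>
      (U s - U (s + \<delta>)) \<bullet> (U s - (U (s + \<delta>) + \<epsilon> *\<^sub>R D \<epsilon> (s + \<delta>))) > 0"
    "\<And>\<epsilon> s \<delta>. \<epsilon> \<in> {0<..\<epsilon>1} \<Longrightarrow> \<delta> \<in> {\<eta>..2 * pi - \<eta>} \<Longrightarrow>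
      (U s - U (s + \<delta>)) \<bullet> (U (s + \<delta>) - (U s + \<epsilon> *\<^sub>R D \<epsilon> s)) < 0"
    "\<And>\<epsilon> t. \<epsilon> \<in> {0<..\<epsilon>1} \<Longrightarrow> \<exists>e. e \<bullet> D \<epsilon> t = 0 \<and> (\<forall>x\<in>{0<..\<eta>}. e \<bullet> (U (t + x) - U t) > 0) \<and>
      (\<forall>x\<in>{0<..\<eta>}. e \<bullet> (U (t - x) - U t) < 0) \<and>
      (\<forall>k\<in>{0..1}. e \<bullet> (U (t + k * \<eta>) - (U (t - (1 - k) * \<eta>) + \<epsilon> *\<^sub>R D \<epsilon> (t - (1 - k) * \<eta>))) > 0)"
proof -
  note peri = periodic_int[where L = "2 * pi"]
  have cU: "continuous_on UNIV U"
    using dU(1) by (meson continuous_at_imp_continuous_on has_vector_derivative_continuous)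
  have nU': "norm (U' t) = \<mu> t" for t using U' ab(1) by (simp add: less_imp_le)
  have c\<mu>: "continuous_on UNIV \<mu>" using continuous_on_norm[OF dU(2)] nU' by simp
  have "{0..2*pi} \<noteq> {}" by simp
  then obtain t0 where t0: "t0 \<in> {0..2*pi}" "\<And>t. t \<in> {0..2*pi} \<Longrightarrow> \<mu> t0 \<le> \<mu> t"
    using continuous_attains_inf[of "{0..2*pi}" \<mu>] continuous_on_subset[OF c\<mu> subset_UNIV] compact_Icc by blast
  define m where "m = \<mu> t0"
  have m0: "m > 0" by (simp add: m_def U'(2))
  have \<mu>per: "\<mu> (t + 2 * pi) = \<mu> t" for t using nU'[of t] nU'[of "t + 2 * pi"] per(2)[of t] by simp
  have m: "m \<le> \<mu> t" for t
  proof -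
    obtain n :: int where "t + 2 * pi * of_int n \<in> {0..2 * pi}" by (rule periodic_representative)
    from t0(2)[OF this] show ?thesis unfolding peri[of \<mu>, OF \<mu>per] m_def .
  qed
  have uc: "uniformly_continuous_on {-pi..3*pi} U'"
    by (intro compact_uniformly_continuous continuous_on_subset[OF dU(2)]) auto
  \<comment> \<open>An error of 1/16 of the minimal speed \<open>m\<close> leaves room for the
    estimates below. The enlarged interval contains all windows of radius at most 1 around one
    period.\<close>
  obtain d where d: "d > 0" "\<And>x y. x \<in> {-pi..3*pi} \<Longrightarrow> y \<in> {-pi..3*pi} \<Longrightarrow> dist y x < d \<Longrightarrow> dist (U' y) (U' x) < m / 16"
    using uniformly_continuous_onE[OF uc, of "m / 16"] m0 by auto
  define \<eta> where "\<eta> = min (d / 2) 1"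
  have \<eta>: "0 < \<eta>" "\<eta> < d" "\<eta> \<le> 1" "\<eta> < pi" using d pi_gt3 by (auto simp: \<eta>_def)
  have dev: "norm (U' (t + x) - U' t) \<le> m / 16" if "\<bar>x\<bar> \<le> \<eta>" for t x
  proof -
    obtain n :: int where n: "t + 2 * pi * of_int n \<in> {0..2 * pi}" by (rule periodic_representative)
    have "dist (U' (t + 2 * pi * of_int n + x)) (U' (t + 2 * pi * of_int n)) < m / 16"
      using n that \<eta> pi_gt3 by (intro d(2)) (auto simp: dist_real_def)
    then show ?thesis
      using peri[of U', OF per(2), of "t + x" n] peri[of U', OF per(2), of t n] by (simp add: dist_norm algebra_simps)
  qed
  have chord: "norm (U (t + x) - U (t + y) - (x - y) *\<^sub>R U' t) \<le> \<bar>x - y\<bar> * (m / 16)"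
    if "\<bar>x\<bar> \<le> \<eta>" "\<bar>y\<bar> \<le> \<eta>" for t x y
  proof -
    have "norm (U (t + x) - U (t + y) - ((t + x) - (t + y)) *\<^sub>R U' t) \<le> norm ((t + x) - (t + y)) * (m / 16)"
    proof (rule vector_differentiable_bound_linearization)
      show "(U has_vector_derivative U' s) (at s within {t - \<eta>..t + \<eta>})" for s
        using dU(1) by (rule has_vector_derivative_at_within)
      show "closed_segment (t + y) (t + x) \<subseteq> {t - \<eta>..t + \<eta>}"
        using that by (auto simp: closed_segment_eq_real_ivl)
      show "norm (U' s - U' t) \<le> m / 16" if "s \<in> {t - \<eta>..t + \<eta>}" for s
        using dev[of "s - t" t] that by (simp add: abs_le_iff)
    qed (use \<eta> in auto)
    then show ?thesis by simp
  qed
  let ?K = "{0..2*pi} \<times> {\<eta>..2*pi - \<eta>}"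
  have "continuous_on ?K (\<lambda>x. norm (U (fst x) - U (fst x + snd x)))"
    by (intro continuous_intros continuous_on_compose2[OF cU]) auto
  moreover have "compact ?K" by (intro compact_Times) auto
  moreover have "?K \<noteq> {}" using \<eta> by auto
  ultimately obtain z where z: "z \<in> ?K"
    "\<And>x. x \<in> ?K \<Longrightarrow> norm (U (fst z) - U (fst z + snd z)) \<le> norm (U (fst x) - U (fst x + snd x))"
    using continuous_attains_inf[of ?K "\<lambda>x. norm (U (fst x) - U (fst x + snd x))"] by blast
  \<comment> \<open>The least length of a chord between parameters at cyclic distance at least
    \<open>\<eta>\<close>; it is positive by injectivity and compactness.\<close>
  define r where "r = norm (U (fst z) - U (fst z + snd z))"
  have r0: "r > 0" using inj[of "snd z" "fst z"] z(1) \<eta> by (auto simp: r_def)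
  have r: "r \<le> norm (U s - U (s + \<delta>))" if \<delta>: "\<delta> \<in> {\<eta>..2 * pi - \<eta>}" for s \<delta>
  proof -
    obtain n :: int where n: "s + 2 * pi * of_int n \<in> {0..2 * pi}" by (rule periodic_representative)
    have "r \<le> norm (U (s + 2 * pi * of_int n) - U ((s + \<delta>) + 2 * pi * of_int n))"
      using z(2)[of "(s + 2 * pi * of_int n, \<delta>)"] n \<delta> by (simp add: r_def algebra_simps)
    then show ?thesis unfolding peri[of U, OF per(1)] .
  qed
  let ?I = "{0..2 * pi}"
  have cb: "continuous_on S (\<lambda>x. b (snd x))" "continuous_on S (\<lambda>x. a (snd x))" for S :: "(real \<times> real) set"
    by (auto intro!: continuous_on_compose2[OF ab(4)] continuous_on_compose2[OF ab(5)] continuous_intros)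
  \<comment> \<open>Three thresholds for \<open>\<epsilon>\<close>: \<open>d1\<close> keeps the
    displacement below \<open>r\<close> and \<open>\<eta> * m / 2\<close>, \<open>d2\<close> keeps
    it almost orthogonal to the tangent, and \<open>d3\<close> keeps its direction within 1/4 of
    \<open>b\<close>.\<close>
  obtain d1 where d1: "d1 > 0" "d1 \<le> \<epsilon>0" "\<And>\<epsilon> t. \<epsilon> \<in> {0..d1} \<Longrightarrow> t \<in> ?I \<Longrightarrow> min r (\<eta> * m / 2) - \<epsilon> * norm (D \<epsilon> t) > 0"
  proof (rule eventually_positive_compact[of \<epsilon>0 ?I "\<lambda>x. min r (\<eta> * m / 2) - fst x * norm (D (fst x) (snd x))"])
    show "continuous_on ({0..\<epsilon>0} \<times> ?I) (\<lambda>x. min r (\<eta> * m / 2) - fst x * norm (D (fst x) (snd x)))"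
      by (intro continuous_intros D)
  qed (use D r0 \<eta> m0 in auto)
  obtain d2 where d2: "d2 > 0" "d2 \<le> \<epsilon>0" "\<And>\<epsilon> t. \<epsilon> \<in> {0..d2} \<Longrightarrow> t \<in> ?I \<Longrightarrow> norm (D \<epsilon> t) - 16 * \<bar>a t \<bullet> D \<epsilon> t\<bar> > 0"
  proof (rule eventually_positive_compact[of \<epsilon>0 ?I "\<lambda>x. norm (D (fst x) (snd x)) - 16 * \<bar>a (snd x) \<bullet> D (fst x) (snd x)\<bar>"])
    show "continuous_on ({0..\<epsilon>0} \<times> ?I) (\<lambda>x. norm (D (fst x) (snd x)) - 16 * \<bar>a (snd x) \<bullet> D (fst x) (snd x)\<bar>)"
      by (intro continuous_intros D cb)
    show "norm (D (fst (0, t)) (snd (0, t))) - 16 * \<bar>a (snd (0, t)) \<bullet> D (fst (0, t)) (snd (0, t))\<bar> > 0" for t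
      using D(4)[of t] by (simp add: D(3) ab)
  qed (use D in auto)
  obtain d3 where d3: "d3 > 0" "d3 \<le> \<epsilon>0" "\<And>\<epsilon> t. \<epsilon> \<in> {0..d3} \<Longrightarrow> t \<in> ?I \<Longrightarrow> norm (D \<epsilon> t) - 4 * norm (D \<epsilon> t - norm (D \<epsilon> t) *\<^sub>R b t) > 0"
  proof (rule eventually_positive_compact[of \<epsilon>0 ?I "\<lambda>x. norm (D (fst x) (snd x)) - 4 * norm (D (fst x) (snd x) - norm (D (fst x) (snd x)) *\<^sub>R b (snd x))"])
    show "continuous_on ({0..\<epsilon>0} \<times> ?I) (\<lambda>x. norm (D (fst x) (snd x)) - 4 * norm (D (fst x) (snd x) - norm (D (fst x) (snd x)) *\<^sub>R b (snd x)))"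
      by (intro continuous_intros D cb)
    show "norm (D (fst (0, t)) (snd (0, t))) - 4 * norm (D (fst (0, t)) (snd (0, t)) - norm (D (fst (0, t)) (snd (0, t))) *\<^sub>R b (snd (0, t))) > 0" for t
      using D(4)[of t] by (simp add: D(3) ab)
  qed (use D in auto)
  define \<epsilon>1 where "\<epsilon>1 = min d1 (min d2 d3)"
  have bounds: "\<epsilon> * norm (D \<epsilon> t) < r" "\<epsilon> * norm (D \<epsilon> t) < \<eta> * m / 2" "16 * \<bar>a t \<bullet> D \<epsilon> t\<bar> < norm (D \<epsilon> t)"
    "4 * norm (D \<epsilon> t - norm (D \<epsilon> t) *\<^sub>R b t) < norm (D \<epsilon> t)" if "\<epsilon> \<in> {0<..\<epsilon>1}" for \<epsilon> t
  proof -
    obtain n :: int where n: "t + 2 * pi * of_int n \<in> {0..2 * pi}" by (rule periodic_representative)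
    have "D \<epsilon> (t + 2 * pi * of_int n) = D \<epsilon> t" "a (t + 2 * pi * of_int n) = a t" "b (t + 2 * pi * of_int n) = b t"
      using peri[of "D \<epsilon>", OF per(5)] peri[of a, OF per(3)] peri[of b, OF per(4)] by simp_all
    then show "\<epsilon> * norm (D \<epsilon> t) < r" "\<epsilon> * norm (D \<epsilon> t) < \<eta> * m / 2" "16 * \<bar>a t \<bullet> D \<epsilon> t\<bar> < norm (D \<epsilon> t)"
      "4 * norm (D \<epsilon> t - norm (D \<epsilon> t) *\<^sub>R b t) < norm (D \<epsilon> t)"
      using d1(3)[OF _ n, of \<epsilon>] d2(3)[OF _ n, of \<epsilon>] d3(3)[OF _ n, of \<epsilon>] that by (auto simp: \<epsilon>1_def)
  qed
  have Dnz: "D \<epsilon> t \<noteq> 0" if "\<epsilon> \<in> {0<..\<epsilon>1}" for \<epsilon> t using bounds(3)[OF that, of t] by auto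
  show ?thesis
  proof (rule that[of \<eta> \<epsilon>1])
    show "0 < \<eta>" "\<eta> < pi" "0 < \<epsilon>1" "\<epsilon>1 \<le> \<epsilon>0" using \<eta> d1 d2 d3 by (auto simp: \<epsilon>1_def)
    fix \<epsilon> assume e1: "\<epsilon> \<in> {0<..\<epsilon>1}"
    then have e0: "\<epsilon> > 0" by simp
    show "D \<epsilon> t \<noteq> 0" for t by (rule Dnz[OF e1])
    show "norm ((1 / norm (D \<epsilon> t)) *\<^sub>R D \<epsilon> t - b t) < 1 / 4" for t
    proof -
      have "(1 / norm (D \<epsilon> t)) *\<^sub>R D \<epsilon> t - b t = (1 / norm (D \<epsilon> t)) *\<^sub>R (D \<epsilon> t - norm (D \<epsilon> t) *\<^sub>R b t)"
        using Dnz[OF e1, of t] by (simp add: scaleR_diff_right)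
      then have "norm ((1 / norm (D \<epsilon> t)) *\<^sub>R D \<epsilon> t - b t) = norm (D \<epsilon> t - norm (D \<epsilon> t) *\<^sub>R b t) / norm (D \<epsilon> t)"
        by simp
      also have "\<dots> < 1 / 4" using bounds(4)[OF e1, of t] Dnz[OF e1, of t] by (simp add: divide_less_eq)
      finally show ?thesis .
    qed
    fix s \<delta> assume \<delta>: "\<delta> \<in> {\<eta>..2 * pi - \<eta>}"
    let ?d = "U s - U (s + \<delta>)"
    \<comment> \<open>The displacement is shorter than the chord \<open>?d\<close> and therefore
      cannot change the sign of an inner product with \<open>?d\<close>.\<close>
    have small: "\<bar>?d \<bullet> (\<epsilon> *\<^sub>R D \<epsilon> t)\<bar> < ?d \<bullet> ?d" for t
    proof -
      have "\<bar>?d \<bullet> (\<epsilon> *\<^sub>R D \<epsilon> t)\<bar> \<le> norm ?d * (\<epsilon> * norm (D \<epsilon> t))"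
        using Cauchy_Schwarz_ineq2[of ?d "\<epsilon> *\<^sub>R D \<epsilon> t"] e0 by simp
      also have "\<dots> < norm ?d * norm ?d"
        using bounds(1)[OF e1, of t] r[OF \<delta>, of s] r0 by (intro mult_strict_left_mono) auto
      finally show ?thesis by (simp add: power2_norm_eq_inner flip: power2_eq_square)
    qed
    have "U s - (U (s + \<delta>) + \<epsilon> *\<^sub>R D \<epsilon> (s + \<delta>)) = ?d - \<epsilon> *\<^sub>R D \<epsilon> (s + \<delta>)"
      "U (s + \<delta>) - (U s + \<epsilon> *\<^sub>R D \<epsilon> s) = - ?d - \<epsilon> *\<^sub>R D \<epsilon> s" by simp_all
    then show "?d \<bullet> (U s - (U (s + \<delta>) + \<epsilon> *\<^sub>R D \<epsilon> (s + \<delta>))) > 0" "?d \<bullet> (U (s + \<delta>) - (U s + \<epsilon> *\<^sub>R D \<epsilon> s)) < 0"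
      using small[of s] small[of "s + \<delta>"] by (simp_all only: inner_diff_right inner_minus_right)
  next
    fix t
    have p: "\<eta> * \<mu> t > 0" using \<eta> U'(2) by simp
    have "(1 / (\<eta> * \<mu> t)) *\<^sub>R (U (t + \<eta>) - U t) - a t = (1 / (\<eta> * \<mu> t)) *\<^sub>R (U (t + \<eta>) - U (t + 0) - (\<eta> - 0) *\<^sub>R U' t)"
      using p by (auto simp: U'(1) scaleR_diff_right)
    then have "norm ((1 / (\<eta> * \<mu> t)) *\<^sub>R (U (t + \<eta>) - U t) - a t) = norm (U (t + \<eta>) - U (t + 0) - (\<eta> - 0) *\<^sub>R U' t) / (\<eta> * \<mu> t)"
      using p by simp
    also have "\<dots> \<le> (\<eta> * (m / 16)) / (\<eta> * \<mu> t)"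
      using chord[of \<eta> 0 t] \<eta> p by (intro divide_right_mono) auto
    also have "\<dots> \<le> 1 / 16" using m[of t] \<eta> U'(2)[of t] by (simp add: field_simps)
    finally show "norm ((1 / (\<eta> * \<mu> t)) *\<^sub>R (U (t + \<eta>) - U t) - a t) \<le> 1 / 16" .
  next
    fix \<epsilon> t assume e1: "\<epsilon> \<in> {0<..\<epsilon>1}"
    then have e0: "\<epsilon> > 0" by simp
    let ?D = "D \<epsilon> t"
    define u where "u = (1 / norm ?D) *\<^sub>R ?D"
    have u: "norm u = 1" "?D = norm ?D *\<^sub>R u" using Dnz[OF e1] by (simp_all add: u_def)
    have uu: "u \<bullet> u = 1" using u(1) by (simp add: norm_eq_1)
    define c where "c = a t \<bullet> u"
    have "\<bar>a t \<bullet> ?D\<bar> = norm ?D * \<bar>c\<bar>" by (subst u(2)) (simp add: c_def abs_mult)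
    then have c: "\<bar>c\<bar> < 1 / 16" using bounds(3)[OF e1, of t] Dnz[OF e1, of t] by simp
    then have c2: "c\<^sup>2 \<le> 1 / 16" using mult_mono[of "\<bar>c\<bar>" "1 / 16" "\<bar>c\<bar>" 1] by (simp add: power2_eq_square)
    \<comment> \<open>The tangent without its component along the displacement: exactly orthogonal
      to \<open>D \<epsilon> t\<close>, and still nearly tangent because \<open>c\<close> is below
      1/16 in absolute value.\<close>
    define e where "e = a t - c *\<^sub>R u"
    have eu: "e \<bullet> u = 0" by (simp add: e_def inner_diff_left c_def uu)
    have aa: "a t \<bullet> a t = 1" using ab(1) by (simp add: norm_eq_1)
    have ea: "e \<bullet> a t = 1 - c\<^sup>2" by (simp add: e_def inner_diff_left aa inner_commute[of u] c_def power2_eq_square)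
    have "e \<bullet> e = e \<bullet> (a t - c *\<^sub>R u)" by (simp add: e_def)
    also have "\<dots> = 1 - c\<^sup>2" unfolding inner_diff_right by (simp add: eu ea)
    finally have "e \<bullet> e = 1 - c\<^sup>2" .
    then have ne: "norm e \<le> 1" using zero_le_power2[of c] by (simp add: norm_eq_sqrt_inner)
    \<comment> \<open>Along \<open>e\<close> the curve advances at least with speed
      \<open>m / 2\<close>: the main term contributes at least \<open>15 * m / 16\<close> and the
      error at most \<open>m / 16\<close>.\<close>
    have inc: "e \<bullet> (U (t + x) - U (t + y)) \<ge> (x - y) * (m / 2)" if "\<bar>x\<bar> \<le> \<eta>" "\<bar>y\<bar> \<le> \<eta>" "y \<le> x" for x y
    proof -
      let ?R = "U (t + x) - U (t + y) - (x - y) *\<^sub>R U' t"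
      have "\<bar>e \<bullet> ?R\<bar> \<le> norm e * norm ?R" by (rule Cauchy_Schwarz_ineq2)
      also have "\<dots> \<le> 1 * (\<bar>x - y\<bar> * (m / 16))"
        by (intro mult_mono ne chord that) auto
      finally have "e \<bullet> ?R \<ge> - ((x - y) * (m / 16))" using that by simp
      moreover have "e \<bullet> (U (t + x) - U (t + y)) = (x - y) * (\<mu> t * (1 - c\<^sup>2)) + e \<bullet> ?R"
        by (simp add: inner_diff_right U' ea)
      moreover have "(x - y) * (m * (15 / 16)) \<le> (x - y) * (\<mu> t * (1 - c\<^sup>2))"
        using m[of t] c2 m0 that by (intro mult_left_mono mult_mono) auto
      moreover have "0 \<le> (x - y) * m" using that m0 by simp
      moreover have "(x - y) * (m * (15 / 16)) = (x - y) * m * (15 / 16)" "(x - y) * (m / 16) = (x - y) * m / 16"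
        "(x - y) * (m / 2) = (x - y) * m / 2" by simp_all
      ultimately show ?thesis by linarith
    qed
    show "\<exists>e. e \<bullet> D \<epsilon> t = 0 \<and> (\<forall>x\<in>{0<..\<eta>}. e \<bullet> (U (t + x) - U t) > 0) \<and>
      (\<forall>x\<in>{0<..\<eta>}. e \<bullet> (U (t - x) - U t) < 0) \<and>
      (\<forall>k\<in>{0..1}. e \<bullet> (U (t + k * \<eta>) - (U (t - (1 - k) * \<eta>) + \<epsilon> *\<^sub>R D \<epsilon> (t - (1 - k) * \<eta>))) > 0)"
    proof (intro exI[of _ e] conjI ballI)
      show "e \<bullet> D \<epsilon> t = 0" by (subst u(2)) (simp add: eu)
    next
      fix x assume x: "x \<in> {0<..\<eta>}"
      then have "x * (m / 2) > 0" using m0 by simp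
      moreover have "e \<bullet> (U (t + x) - U (t + 0)) \<ge> (x - 0) * (m / 2)" using x by (intro inc) auto
      moreover have "e \<bullet> (U (t + 0) - U (t + - x)) \<ge> (0 - - x) * (m / 2)" using x by (intro inc) auto
      ultimately show "e \<bullet> (U (t + x) - U t) > 0" "e \<bullet> (U (t - x) - U t) < 0"
        by (simp_all add: inner_diff_right)
    next
      fix k :: real assume k: "k \<in> {0..1}"
      have k': "\<bar>k * \<eta>\<bar> \<le> \<eta>" "\<bar>- ((1 - k) * \<eta>)\<bar> \<le> \<eta>"
        using k \<eta> by (auto simp: abs_mult mult_le_cancel_right1)
      \<comment> \<open>The two parameters are \<open>\<eta>\<close> apart for every
        \<open>k\<close>, so the knot advances by at least \<open>\<eta> * m / 2\<close> along
        \<open>e\<close>, strictly more than the push-off can take back.\<close>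
      have "e \<bullet> (U (t + k * \<eta>) - U (t + - ((1 - k) * \<eta>))) \<ge> (k * \<eta> - - ((1 - k) * \<eta>)) * (m / 2)"
        using k' k \<eta> by (intro inc) (auto simp: algebra_simps)
      then have "e \<bullet> (U (t + k * \<eta>) - U (t - (1 - k) * \<eta>)) \<ge> \<eta> * m / 2"
        by (simp add: algebra_simps)
      moreover have "\<bar>e \<bullet> (\<epsilon> *\<^sub>R D \<epsilon> (t - (1 - k) * \<eta>))\<bar> < \<eta> * m / 2"
      proof -
        have "\<bar>e \<bullet> (\<epsilon> *\<^sub>R D \<epsilon> (t - (1 - k) * \<eta>))\<bar> \<le> norm e * norm (\<epsilon> *\<^sub>R D \<epsilon> (t - (1 - k) * \<eta>))"
          by (rule Cauchy_Schwarz_ineq2)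
        also have "\<dots> \<le> 1 * norm (\<epsilon> *\<^sub>R D \<epsilon> (t - (1 - k) * \<eta>))"
          by (intro mult_right_mono ne) auto
        also have "\<dots> < \<eta> * m / 2" using bounds(2)[OF e1, of "t - (1 - k) * \<eta>"] e0 by simp
        finally show ?thesis .
      qed
      ultimately show "e \<bullet> (U (t + k * \<eta>) - (U (t - (1 - k) * \<eta>) + \<epsilon> *\<^sub>R D \<epsilon> (t - (1 - k) * \<eta>))) > 0"
        by (simp only: inner_diff_right inner_add_right)
    qed
  qed
qed

section \<open>Stereographic projection\<close>

text \<open>
  For unit vectors \<open>x \<noteq> p\<close> this reflection swaps \<open>x\<close> and \<open>p\<close>, because \<open>|x - p|\<^sup>2 = 2 (1 - x \<bullet> p)\<close>.  It is the isometric
  part of the differential of the stereographic projection at \<open>x\<close>.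
\<close>

definition reflect :: "real^4 \<Rightarrow> real^4 \<Rightarrow> real^4 \<Rightarrow> real^4"
  where "reflect x p w = w - (w \<bullet> (x - p) / (1 - x \<bullet> p)) *\<^sub>R (x - p)"

lemma unit_inner_less_1:
  fixes x p :: "'a::real_inner"
  assumes "norm x = 1" "norm p = 1" "x \<noteq> p"
  shows "x \<bullet> p < 1"
proof -
  have "x \<bullet> p \<le> 1" using norm_cauchy_schwarz[of x p] assms by simp
  moreover have "x \<bullet> p \<noteq> 1" using unit_inner_eq_1[OF assms(1,2)] assms(3) by blast
  ultimately show ?thesis by simp
qed

context
  fixes x p :: "real^4"
  assumes x: "norm x = 1" and p: "norm p = 1" and xp: "x \<noteq> p"
begin

lemma reflect_inner: "reflect x p v \<bullet> reflect x p w = v \<bullet> w"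
proof -
  have 1: "x \<bullet> x = 1" "p \<bullet> p = 1" using x p by (simp_all add: norm_eq_1)
  have nz: "1 - x \<bullet> p \<noteq> 0" using unit_inner_less_1[OF x p xp] by simp
  let ?u = "x - p" and ?c = "1 - x \<bullet> p"
  have uu: "?u \<bullet> ?u = 2 * ?c" by (simp add: inner_diff inner_commute 1)
  have "reflect x p v \<bullet> reflect x p w = v \<bullet> w - (w \<bullet> ?u / ?c) * (v \<bullet> ?u) - (v \<bullet> ?u / ?c) * (w \<bullet> ?u)
      + (v \<bullet> ?u / ?c) * (w \<bullet> ?u / ?c) * (?u \<bullet> ?u)"
    unfolding reflect_def inner_diff_left[of v] inner_diff_right[of _ w] by (simp add: inner_commute)
  also have "(v \<bullet> ?u / ?c) * (w \<bullet> ?u / ?c) * (?u \<bullet> ?u) = 2 * (w \<bullet> ?u / ?c) * (v \<bullet> ?u)"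
  proof -
    have "(b / c) * (a / c) * (2 * c) = 2 * (a / c) * b" if "c \<noteq> 0" for a b c :: real
      using that by simp
    then show ?thesis unfolding uu using nz by blast
  qed
  also have "v \<bullet> w - (w \<bullet> ?u / ?c) * (v \<bullet> ?u) - (v \<bullet> ?u / ?c) * (w \<bullet> ?u) + 2 * (w \<bullet> ?u / ?c) * (v \<bullet> ?u) = v \<bullet> w"
    by simp
  finally show ?thesis .
qed

lemma reflect_self: "reflect x p x = p" "reflect x p p = x"
proof -
  have "x \<bullet> (x - p) = 1 - x \<bullet> p" "p \<bullet> (x - p) = - (1 - x \<bullet> p)"
    using x p by (simp_all add: inner_diff_right inner_commute norm_eq_1)
  moreover have nz: "1 - x \<bullet> p \<noteq> 0" using unit_inner_less_1[OF x p xp] by simp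
  ultimately have "x \<bullet> (x - p) / (1 - x \<bullet> p) = 1" "p \<bullet> (x - p) / (1 - x \<bullet> p) = - 1"
    by (simp_all only: minus_divide_left[symmetric] divide_self[OF nz])
  then show "reflect x p x = p" "reflect x p p = x" unfolding reflect_def by simp_all
qed

text \<open>The reflection is self-adjoint and preserves inner products, hence an
  involution.\<close>

lemma reflect_reflect: "reflect x p (reflect x p w) = w"
proof -
  have "reflect x p (reflect x p w) \<bullet> v = w \<bullet> v" for v
  proof -
    have sym: "reflect x p a \<bullet> b = a \<bullet> reflect x p b" for a b
      by (simp add: reflect_def inner_diff_left inner_diff_right inner_commute)
    show ?thesis by (simp add: sym[of "reflect x p w"] reflect_inner)
  qed
  then show ?thesis by (metis vector_eq_rdot)
qed

lemma reflect_orthogonal: "w \<bullet> x = 0 \<Longrightarrow> reflect x p w \<bullet> p = 0"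
  using reflect_inner[of w x] by (simp add: reflect_self)

lemma orthonormal3_reflect:
  assumes "orthonormal3 v w x"
  shows "orthonormal3 (reflect x p v) (reflect x p w) p"
  using assms reflect_inner[of v v] reflect_inner[of w w] reflect_inner[of v w] reflect_orthogonal p
  by (simp add: orthonormal3_def norm_eq_1)

lemma orthonormal3_reflect':
  assumes "orthonormal3 v w p"
  shows "orthonormal3 (reflect x p v) (reflect x p w) x"
  using assms reflect_inner[of v v] reflect_inner[of w w] reflect_inner[of v w] reflect_inner[of v p] reflect_inner[of w p] x
  by (simp add: orthonormal3_def norm_eq_1 reflect_self)

end

lemma reflect_antipode:
  assumes "norm p = 1" "w \<bullet> p = 0"
  shows "reflect (- p) p w = w"
proof -
  have "w \<bullet> (- p - p) = 0" unfolding inner_diff_right inner_minus_right assms(2) by simp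
  then show ?thesis unfolding reflect_def by simp
qed

lemma continuous_on_reflect:
  assumes "continuous_on S x" "continuous_on S w" "\<And>s. s \<in> S \<Longrightarrow> x s \<bullet> p \<noteq> 1"
  shows "continuous_on S (\<lambda>s. reflect (x s) p (w s))"
  unfolding reflect_def using assms(3) by (intro continuous_intros assms(1,2)) auto

text \<open>Stereographic projection is conformal: its differential is a scaled reflection. The
  quotient rule takes this form because the velocity is tangent to the sphere.\<close>

lemma stereographic_has_vector_derivative:
  assumes g: "(g has_vector_derivative g') (at t)" and "norm (g t) = 1" "norm p = 1" "g t \<noteq> p" "g' \<bullet> g t = 0"
  shows "((\<lambda>t. stereographic p (g t)) has_vector_derivative (1 / (1 - g t \<bullet> p)) *\<^sub>R reflect (g t) p g') (at t)"
proof -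
  let ?c = "1 - g t \<bullet> p"
  have nz: "?c \<noteq> 0" using unit_inner_less_1[OF assms(2-4)] by simp
  have gp: "((\<lambda>t. g t \<bullet> p) has_vector_derivative g' \<bullet> p) (at t)"
    by (rule bounded_linear.has_vector_derivative[OF bounded_linear_inner_left g])
  then have gp': "((\<lambda>t. g t \<bullet> p) has_real_derivative g' \<bullet> p) (at t)"
    by (simp add: has_real_derivative_iff_has_vector_derivative)
  have 1: "((\<lambda>t. 1 / (1 - g t \<bullet> p)) has_real_derivative (g' \<bullet> p) / ?c\<^sup>2) (at t)"
    using nz by (auto intro!: derivative_eq_intros gp' simp: power2_eq_square)
  have 2: "((\<lambda>t. g t - (g t \<bullet> p) *\<^sub>R p) has_vector_derivative g' - (g' \<bullet> p) *\<^sub>R p) (at t)"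
    by (intro has_vector_derivative_diff g bounded_linear.has_vector_derivative[OF bounded_linear_scaleR_left gp])
  have "((\<lambda>t. stereographic p (g t)) has_vector_derivative
      (1 / ?c) *\<^sub>R (g' - (g' \<bullet> p) *\<^sub>R p) + ((g' \<bullet> p) / ?c\<^sup>2) *\<^sub>R (g t - (g t \<bullet> p) *\<^sub>R p)) (at t)"
    unfolding stereographic_def by (rule has_vector_derivative_scaleR[OF 1 2])
  moreover have "(1 / ?c) *\<^sub>R (g' - (g' \<bullet> p) *\<^sub>R p) + ((g' \<bullet> p) / ?c\<^sup>2) *\<^sub>R (g t - (g t \<bullet> p) *\<^sub>R p)
      = (1 / ?c) *\<^sub>R reflect (g t) p g'"
  proof -
    have "reflect (g t) p g' = g' + ((g' \<bullet> p) / ?c) *\<^sub>R (g t - p)"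
      using assms(5) by (simp add: reflect_def inner_diff_right)
    moreover have "((g' \<bullet> p) / ?c) *\<^sub>R (g t - p) = - (g' \<bullet> p) *\<^sub>R p + ((g' \<bullet> p) / ?c) *\<^sub>R (g t - (g t \<bullet> p) *\<^sub>R p)"
    proof -
      have "g t - p = - ?c *\<^sub>R p + (g t - (g t \<bullet> p) *\<^sub>R p)" by (simp add: algebra_simps)
      then have "((g' \<bullet> p) / ?c) *\<^sub>R (g t - p) = ((g' \<bullet> p) / ?c * - ?c) *\<^sub>R p + ((g' \<bullet> p) / ?c) *\<^sub>R (g t - (g t \<bullet> p) *\<^sub>R p)"
        by (metis scaleR_right_distrib scaleR_scaleR)
      moreover have "a / c * - c = - a" if "c \<noteq> 0" for a c :: real using that by simp
      ultimately show ?thesis using nz by metis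
    qed
    ultimately have "reflect (g t) p g' = (g' - (g' \<bullet> p) *\<^sub>R p) + ((g' \<bullet> p) / ?c) *\<^sub>R (g t - (g t \<bullet> p) *\<^sub>R p)"
      by simp
    then show ?thesis by (simp add: scaleR_right_distrib power2_eq_square)
  qed
  ultimately show ?thesis by simp
qed

text \<open>The difference quotient of the projected push-off, continuous up to \<open>\<epsilon> = 0\<close>.\<close>

definition pushoff_quotient :: "real^4 \<Rightarrow> real^4 \<Rightarrow> real^4 \<Rightarrow> real \<Rightarrow> real^4"
  where "pushoff_quotient p x n \<epsilon> = (1 / ((1 - x \<bullet> p) * (sqrt (1 + \<epsilon>\<^sup>2) - x \<bullet> p - \<epsilon> * (n \<bullet> p)))) *\<^sub>R
    ((1 - x \<bullet> p) *\<^sub>R (n - (n \<bullet> p) *\<^sub>R p) + (n \<bullet> p - \<epsilon> / (1 + sqrt (1 + \<epsilon>\<^sup>2))) *\<^sub>R (x - (x \<bullet> p) *\<^sub>R p))"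

lemma stereographic_pushoff:
  assumes "x \<bullet> p \<noteq> 1" "sqrt (1 + \<epsilon>\<^sup>2) - x \<bullet> p - \<epsilon> * (n \<bullet> p) \<noteq> 0"
  shows "stereographic p ((1 / sqrt (1 + \<epsilon>\<^sup>2)) *\<^sub>R (x + \<epsilon> *\<^sub>R n)) = stereographic p x + \<epsilon> *\<^sub>R pushoff_quotient p x n \<epsilon>"
proof -
  define w where "w = sqrt (1 + \<epsilon>\<^sup>2)"
  define c where "c = 1 - x \<bullet> p"
  define d where "d = w - x \<bullet> p - \<epsilon> * (n \<bullet> p)"
  have w0: "w > 0" unfolding w_def by (rule real_sqrt_gt_zero) (simp add: add_pos_nonneg)
  have ww: "w * w = 1 + \<epsilon> * \<epsilon>" unfolding w_def by (simp add: power2_eq_square)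
  have cd: "c \<noteq> 0" "d \<noteq> 0" using assms by (simp_all add: c_def d_def w_def)
  \<comment> \<open>Rationalising \<open>1 - sqrt (1 + \<epsilon>\<^sup>2)\<close> exposes a factor
    \<open>\<epsilon>\<close>; this is the origin of the fraction
    \<open>\<epsilon> / (1 + sqrt (1 + \<epsilon>\<^sup>2))\<close> in
    \<open>pushoff_quotient\<close>.\<close>
  have w1: "1 - w = - (\<epsilon> * (\<epsilon> / (1 + w)))"
  proof -
    have "(1 - w) * (1 + w) = - (\<epsilon> * \<epsilon>)" using ww by (simp add: algebra_simps)
    then show ?thesis using w0 by (simp add: field_simps)
  qed
  let ?x = "x - (x \<bullet> p) *\<^sub>R p" and ?n = "n - (n \<bullet> p) *\<^sub>R p"
  have "stereographic p ((1 / w) *\<^sub>R (x + \<epsilon> *\<^sub>R n)) = (1 / (1 - (1 / w) * (x \<bullet> p + \<epsilon> * (n \<bullet> p)))) *\<^sub>R ((1 / w) *\<^sub>R (?x + \<epsilon> *\<^sub>R ?n))"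
    unfolding stereographic_def by (simp add: inner_add_left algebra_simps)
  also have "\<dots> = (1 / d) *\<^sub>R (?x + \<epsilon> *\<^sub>R ?n)"
  proof -
    have "(1 / (1 - (1 / w) * (x \<bullet> p + \<epsilon> * (n \<bullet> p)))) * (1 / w) = 1 / d"
      using w0 cd by (simp add: d_def field_simps)
    then show ?thesis by (simp only: scaleR_scaleR)
  qed
  also have "\<dots> = (1 / c) *\<^sub>R ?x + \<epsilon> *\<^sub>R ((1 / (c * d)) *\<^sub>R (c *\<^sub>R ?n + (n \<bullet> p - \<epsilon> / (1 + w)) *\<^sub>R ?x))"
  proof -
    have "1 / d = 1 / c + \<epsilon> * (1 / (c * d)) * (n \<bullet> p - \<epsilon> / (1 + w))"
    proof -
      have "c - d = \<epsilon> * (n \<bullet> p - \<epsilon> / (1 + w))"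
        using w1 by (simp add: c_def d_def algebra_simps)
      then have "1 / c + \<epsilon> * (1 / (c * d)) * (n \<bullet> p - \<epsilon> / (1 + w)) = 1 / c + (c - d) / (c * d)"
        by simp
      also have "\<dots> = 1 / d" using cd by (simp add: field_simps)
      finally show ?thesis by simp
    qed
    moreover have "\<epsilon> * (1 / (c * d)) * c = \<epsilon> / d" using cd by simp
    moreover have "(1 / d) *\<^sub>R (?x + \<epsilon> *\<^sub>R ?n) = (1 / d) *\<^sub>R ?x + (\<epsilon> / d) *\<^sub>R ?n"
      by (simp only: scaleR_right_distrib scaleR_scaleR times_divide_eq_left mult_1_left)
    ultimately show ?thesis
      by (simp only: scaleR_right_distrib scaleR_left_distrib scaleR_scaleR mult.assoc add.assoc) (simp add: add.commute)
  qed
  finally show ?thesis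
    unfolding w_def[symmetric] by (simp add: stereographic_def pushoff_quotient_def c_def d_def flip: w_def)
qed

text \<open>The limit is the differential of the projection applied to \<open>n\<close>, in
  agreement with \<open>stereographic_has_vector_derivative\<close>.\<close>

lemma pushoff_quotient_0:
  assumes "norm x = 1" "norm p = 1" "x \<noteq> p" "n \<bullet> x = 0"
  shows "pushoff_quotient p x n 0 = (1 / (1 - x \<bullet> p)) *\<^sub>R reflect x p n"
proof -
  let ?c = "1 - x \<bullet> p"
  have nz: "?c \<noteq> 0" using unit_inner_less_1[OF assms(1-3)] by simp
  have "?c *\<^sub>R reflect x p n = ?c *\<^sub>R (n - (n \<bullet> p) *\<^sub>R p) + (n \<bullet> p) *\<^sub>R (x - (x \<bullet> p) *\<^sub>R p)"
  proof -
    have "reflect x p n = n + ((n \<bullet> p) / ?c) *\<^sub>R (x - p)"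
      using assms(4) by (simp add: reflect_def inner_diff_right)
    then have "?c *\<^sub>R reflect x p n = ?c *\<^sub>R n + (n \<bullet> p) *\<^sub>R (x - p)"
      using nz by (simp add: scaleR_right_distrib)
    then show ?thesis by (simp add: algebra_simps)
  qed
  then have "pushoff_quotient p x n 0 = (1 / (?c * ?c)) *\<^sub>R (?c *\<^sub>R reflect x p n)"
    by (simp add: pushoff_quotient_def)
  then show ?thesis using nz by simp
qed

text \<open>The length of the image determines the height \<open>x \<bullet> p\<close>, since its
  square is \<open>2 / c - 1\<close> with \<open>c = 1 - x \<bullet> p\<close>. At equal heights the
  scaling factors agree.\<close>

lemma stereographic_eq:
  assumes "norm x = 1" "norm y = 1" "norm p = 1" "x \<noteq> p" "y \<noteq> p" "stereographic p x = stereographic p y"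
  shows "x = y"
proof -
  let ?c = "1 - x \<bullet> p" and ?d = "1 - y \<bullet> p"
  have pos: "?c > 0" "?d > 0" using unit_inner_less_1 assms by fastforce+
  have n: "stereographic p z \<bullet> stereographic p z = (2 - (1 - z \<bullet> p)) / (1 - z \<bullet> p)" if "norm z = 1" "1 - z \<bullet> p > 0" for z
  proof -
    have "(z - (z \<bullet> p) *\<^sub>R p) \<bullet> (z - (z \<bullet> p) *\<^sub>R p) = 1 - (z \<bullet> p)\<^sup>2"
      using that(1) assms(3) by (simp add: inner_diff inner_commute norm_eq_1 power2_eq_square)
    also have "\<dots> = (1 - z \<bullet> p) * (2 - (1 - z \<bullet> p))" by (simp add: power2_eq_square algebra_simps)
    finally show ?thesis using that(2) by (simp add: stereographic_def)
  qed
  have "(2 - ?c) / ?c = (2 - ?d) / ?d"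
    using n[OF assms(1) pos(1)] n[OF assms(2) pos(2)] assms(6) by simp
  then have xy: "x \<bullet> p = y \<bullet> p" using pos by (simp add: field_simps)
  then have "x - (x \<bullet> p) *\<^sub>R p = y - (y \<bullet> p) *\<^sub>R p"
    using assms(6) pos by (simp add: stereographic_def)
  then show "x = y" using xy by simp
qed

lemma stereographic_orthogonal: "norm p = 1 \<Longrightarrow> stereographic p x \<bullet> p = 0"
  by (simp add: stereographic_def inner_diff_left norm_eq_1)

section \<open>Knots in the angle parameter and their linking integral\<close>

lemma smooth_on_circle_cis:
  assumes "smooth_on_circle g"
  shows "((\<lambda>t. g (cis t)) has_vector_derivative circle_deriv g (cis t)) (at t)"
    "continuous_on UNIV (\<lambda>t. circle_deriv g (cis t))"
proof -
  have 1: "((\<lambda>h. g (cis t * cis h)) has_vector_derivative circle_deriv g (cis t)) (at 0)"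
    using smooth_on_circle_has_derivative[OF assms, of "cis t" 0] by simp
  have 2: "((\<lambda>s. s - t) has_vector_derivative 1) (at t)"
    by (auto intro!: derivative_eq_intros)
  have "(((\<lambda>h. g (cis t * cis h)) \<circ> (\<lambda>s. s - t)) has_vector_derivative 1 *\<^sub>R circle_deriv g (cis t)) (at t)"
    by (rule vector_diff_chain_at[OF 2]) (use 1 in simp)
  then show "((\<lambda>t. g (cis t)) has_vector_derivative circle_deriv g (cis t)) (at t)"
    by (simp add: o_def cis_mult)
  show "continuous_on UNIV (\<lambda>t. circle_deriv g (cis t))"
    using smooth_on_circle_continuous[OF assms, of 1] unfolding cis_conv_exp
    by (auto intro!: continuous_on_compose2[of circle "circle_deriv g"] continuous_intros)
qed

lemma circle_deriv_cis:
  assumes "((\<lambda>t. g (cis t)) has_vector_derivative g') (at t)"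
  shows "circle_deriv g (cis t) = g'"
proof -
  have 2: "((\<lambda>s. t + s) has_vector_derivative 1) (at 0)"
    by (auto intro!: derivative_eq_intros)
  have "(((\<lambda>t. g (cis t)) \<circ> (\<lambda>s. t + s)) has_vector_derivative 1 *\<^sub>R g') (at 0)"
    by (rule vector_diff_chain_at[OF 2]) (use assms in simp)
  then have "((\<lambda>s. g (cis t * cis s)) has_vector_derivative g') (at 0)"
    by (simp add: o_def cis_mult)
  then show ?thesis unfolding circle_deriv_def by (rule vector_derivative_at)
qed

lemma triple_cyclic: "triple a b c = triple c a b"
  by (simp add: triple_def)

lemma norm_chart:
  assumes "norm w = 1" "x \<bullet> w = 0"
  shows "norm (chart w x) = norm x"
  using assms chart_inner[of w x x] by (simp add: norm_eq_sqrt_inner)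

lemma chart_inj:
  assumes "norm w = 1" "x \<bullet> w = 0" "y \<bullet> w = 0" "chart w x = chart w y"
  shows "x = y"
proof -
  have *: "unchart w (chart w z) = z" if "z \<bullet> w = 0" for z
    using unchart_chart[of w z] assms(1) that by (simp add: norm_eq_1)
  show ?thesis
    using arg_cong[OF assms(4), of "unchart w"] unfolding *[OF assms(2)] *[OF assms(3)] .
qed

lemma chart_linear:
  "chart w (x - y) = chart w x - chart w y" "chart w (x + y) = chart w x + chart w y"
  "chart w (c *\<^sub>R x) = c *\<^sub>R chart w x"
  by (simp_all add: chart_def prod_eq_iff complex_eq_iff algebra_simps)

text \<open>Both projected curves lie in the complement of \<open>p\<close>, where
  \<open>chart p\<close> is an isometry that turns the determinant with last row \<open>p\<close>
  into \<open>triple\<close>. The constant in front of the integral is nonzero, so vanishing carries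
  over.\<close>

lemma gauss_linking_integral_triple:
  fixes f g :: "complex \<Rightarrow> real^4"
  assumes p: "norm p = 1"
    and u: "\<And>t. ((\<lambda>t. stereographic p (f (cis t))) has_vector_derivative u' t) (at t)"
    and v: "\<And>t. ((\<lambda>t. stereographic p (g (cis t))) has_vector_derivative v' t) (at t)"
    and 0: "gauss_linking_integral p f g = 0"
  defines "U \<equiv> \<lambda>t. chart p (stereographic p (f (cis t)))" and "V \<equiv> \<lambda>t. chart p (stereographic p (g (cis t)))"
  shows "integral {0..2 * pi} (\<lambda>s. integral {0..2 * pi} (\<lambda>t.
      triple (U s - V t) (chart p (u' s)) (chart p (v' t)) / norm (U s - V t) ^ 3)) = 0"
proof -
  have "det (vector [circle_deriv (stereographic p \<circ> f) (cis s), circle_deriv (stereographic p \<circ> g) (cis t),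
        (stereographic p \<circ> f) (cis s) - (stereographic p \<circ> g) (cis t), p] :: real^4^4)
      / norm ((stereographic p \<circ> f) (cis s) - (stereographic p \<circ> g) (cis t)) ^ 3
    = triple (U s - V t) (chart p (u' s)) (chart p (v' t)) / norm (U s - V t) ^ 3" for s t
  proof -
    have d: "circle_deriv (stereographic p \<circ> f) (cis s) = u' s" "circle_deriv (stereographic p \<circ> g) (cis t) = v' t"
      by (rule circle_deriv_cis; simp add: u v)+
    let ?x = "stereographic p (f (cis s)) - stereographic p (g (cis t))"
    have UV: "U s - V t = chart p ?x"
      unfolding U_def V_def by (simp add: chart_linear)
    have "?x \<bullet> p = 0" using stereographic_orthogonal[OF p] by (simp add: inner_diff_left)
    from norm_chart[OF p this] have n: "norm (U s - V t) = norm ?x" unfolding UV .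
    have "det (vector [u' s, v' t, ?x, p] :: real^4^4) = triple (U s - V t) (chart p (u' s)) (chart p (v' t))"
      using det_chart[of p "u' s" "v' t" ?x] p triple_cyclic unfolding UV norm_eq_1 by simp
    then show ?thesis unfolding d n by simp
  qed
  then have "gauss_linking_integral p f g = - 1 / (4 * pi) * integral {0..2 * pi} (\<lambda>s. integral {0..2 * pi} (\<lambda>t.
      triple (U s - V t) (chart p (u' s)) (chart p (v' t)) / norm (U s - V t) ^ 3))"
    unfolding gauss_linking_integral_def Let_def by presburger
  then show ?thesis using 0 by simp
qed

lemma cis_periodic: "cis (t + 2 * pi) = cis t"
  by (simp add: complex_eq_iff)

lemma cis_eqD:
  assumes "cis (s + \<delta>) = cis s" "\<delta> \<in> {0<..<2 * pi}"
  shows False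
proof -
  have "cis s * cis \<delta> = cis s * 1" using assms(1) by (simp add: cis_mult)
  then have "cis \<delta> = 1" by (simp only: mult_left_cancel[OF cis_neq_zero])
  then have "cos \<delta> = 1" by (metis cis.sel(1) one_complex.sel(1))
  then obtain n :: int where "\<delta> = of_int n * 2 * pi" by (auto simp: cos_one_2pi_int)
  then show False using assms(2) by (auto simp: zero_less_mult_iff)
qed

lemma knot_orthonormal:
  assumes f: "f \<in> Emb" and N: "unit_normal_field f N" and z: "z \<in> circle"
  shows "orthonormal3 (unit_tangent f z) (N z) (f z)" "circle_deriv f z \<bullet> f z = 0"
proof -
  have sm: "smooth_on_circle f" and im: "f ` circle \<subseteq> sphere 0 1" and nz: "circle_deriv f z \<noteq> 0"
    using f z by (auto simp: Emb_def)
  have nf: "norm (f z) = 1" if "z \<in> circle" for z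
    using subsetD[OF im imageI[OF that]] by simp
  have "((\<lambda>h. f (z * cis h)) has_vector_derivative circle_deriv f z) (at 0)"
    using smooth_on_circle_has_derivative[OF sm z, of 0] by simp
  from bounded_bilinear.has_vector_derivative[OF bounded_bilinear_inner this this]
  have "((\<lambda>h. f (z * cis h) \<bullet> f (z * cis h)) has_vector_derivative f z \<bullet> circle_deriv f z + circle_deriv f z \<bullet> f z) (at 0)"
    by simp
  moreover have "f (z * cis h) \<bullet> f (z * cis h) = 1" for h
    using nf[OF circle_mult_cis(1)[OF z]] by (simp add: norm_eq_1)
  ultimately have "((\<lambda>h. 1::real) has_vector_derivative f z \<bullet> circle_deriv f z + circle_deriv f z \<bullet> f z) (at 0)"
    by simp
  from vector_derivative_unique_at[OF this has_vector_derivative_const]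
  show *: "circle_deriv f z \<bullet> f z = 0" by (simp add: inner_commute)
  then have "unit_tangent f z \<bullet> f z = 0" "norm (unit_tangent f z) = 1"
    using nz by (simp_all add: unit_tangent_def)
  then show "orthonormal3 (unit_tangent f z) (N z) (f z)"
    using N z nf[OF z] by (simp add: orthonormal3_def unit_normal_field_def orthogonal_def inner_commute)
qed

text \<open>The projected tangent \<open>a\<close> and normal \<open>b\<close> are not read off from
  the lift directly. What the lift describes are the chord quotient \<open>X\<close> and the
  push-off direction \<open>Y\<close>, and the bounds 1/16 and 1/4 are what
  \<open>perturbed_frame\<close> needs to pass from one pair to the other.\<close>

theorem knot_spin_frame:
  assumes f: "f \<in> Emb" and N: "unit_normal_field f N" and fr: "has_framing_number f N 0"
    and p: "norm p = 1" "p \<notin> f ` circle"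
  defines "a \<equiv> \<lambda>t. chart p (reflect (f (cis t)) p (unit_tangent f (cis t)))"
    and "b \<equiv> \<lambda>t. chart p (reflect (f (cis t)) p (N (cis t)))"
  obtains \<xi> X Y where "continuous_on {0..2 * pi} \<xi>" "\<And>t. norm (\<xi> t) = 1" "\<xi> (2 * pi) = - \<xi> 0"
    "continuous_on UNIV X" "continuous_on UNIV Y" "X (2 * pi) = X 0" "Y (2 * pi) = Y 0"
    "\<And>t. norm (X t - a t) \<le> 1 / 16" "\<And>t. norm (Y t - b t) < 1 / 4"
    "\<And>t. Y t = - hopf (\<xi> t)" "\<And>t. t \<in> {0..2 * pi} \<Longrightarrow> \<exists>c. \<exists>d>0. X t = c *\<^sub>R hopf (\<xi> t) + d *\<^sub>R hopf_frame (\<xi> t)"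
proof -
  have sm: "smooth_on_circle f" and inj: "inj_on f circle"
    and nz: "\<And>t. circle_deriv f (cis t) \<noteq> 0"
    using f by (auto simp: Emb_def)
  have smN: "smooth_on_circle N" using N by (simp add: unit_normal_field_def)
  define x where "x = (\<lambda>t. f (cis t))"
  define x' where "x' = (\<lambda>t. circle_deriv f (cis t))"
  define n where "n = (\<lambda>t. N (cis t))"
  define n' where "n' = (\<lambda>t. circle_deriv N (cis t))"
  have dx: "(x has_vector_derivative x' t) (at t)" and dn: "(n has_vector_derivative n' t) (at t)" for t
    unfolding x_def x'_def n_def n'_def by (rule smooth_on_circle_cis sm smN)+
  have cx': "continuous_on UNIV x'" "continuous_on UNIV n'"
    unfolding x'_def n'_def by (rule smooth_on_circle_cis sm smN)+
  have cx: "continuous_on UNIV x" "continuous_on UNIV n"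
    using dx dn by (meson continuous_at_imp_continuous_on has_vector_derivative_continuous)+
  have on: "orthonormal3 (unit_tangent f (cis t)) (n t) (x t)" "x' t \<bullet> x t = 0" for t
    using knot_orthonormal[OF f N, of "cis t"] by (simp_all add: x_def x'_def n_def)
  have nx: "norm (x t) = 1" "norm (n t) = 1" "n t \<bullet> x t = 0" "x t \<noteq> p" for t
    using on(1)[of t] p(2) by (auto simp: orthonormal3_def x_def)
  have xp: "x t \<bullet> p < 1" for t by (rule unit_inner_less_1[OF nx(1) p(1) nx(4)])
  have per: "x (t + 2 * pi) = x t" "x' (t + 2 * pi) = x' t" "n (t + 2 * pi) = n t" for t
    by (simp_all add: x_def x'_def n_def cis_periodic)
  have a_eq: "a t = chart p (reflect (x t) p (unit_tangent f (cis t)))" and b_eq: "b t = chart p (reflect (x t) p (n t))" for t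
    by (simp_all add: a_def b_def x_def n_def)
  define U where "U = (\<lambda>t. chart p (stereographic p (x t)))"
  define \<nu> where "\<nu> = (\<lambda>t. 1 / (1 - x t \<bullet> p))"
  define \<mu> where "\<mu> = (\<lambda>t. norm (x' t) * \<nu> t)"
  define u' where "u' = (\<lambda>t. \<nu> t *\<^sub>R reflect (x t) p (x' t))"
  define D where "D = (\<lambda>\<epsilon> t. chart p (pushoff_quotient p (x t) (n t) \<epsilon>))"
  have \<nu>: "\<nu> t > 0" "\<mu> t > 0" for t using xp[of t] nz by (simp_all add: \<nu>_def \<mu>_def x'_def)
  have neq: "norm (x' t) * \<nu> t \<noteq> 0" "1 - x t \<bullet> p \<noteq> 0" "x t \<bullet> p \<noteq> 1" "\<mu> t \<noteq> 0" for t
    using xp[of t] \<nu>[of t] nz[of t] by (simp_all add: \<mu>_def x'_def)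
  have du: "((\<lambda>t. stereographic p (x t)) has_vector_derivative u' t) (at t)" for t
    unfolding u'_def \<nu>_def by (rule stereographic_has_vector_derivative[OF dx nx(1) p(1) nx(4) on(2)])
  have dU: "(U has_vector_derivative chart p (u' t)) (at t)" for t
    unfolding U_def by (rule bounded_linear.has_vector_derivative[OF linear_chart du])
  have c\<nu>: "continuous_on UNIV \<nu>" unfolding \<nu>_def
    by (intro continuous_intros cx) (use neq in blast)
  have crefl: "continuous_on UNIV (\<lambda>t. reflect (x t) p (w t))" if "continuous_on UNIV w" for w
    by (intro continuous_on_reflect cx that) (use neq in blast)
  have cU': "continuous_on UNIV (\<lambda>t. chart p (u' t))"
    unfolding u'_def by (intro bounded_linear.continuous_on[OF linear_chart] continuous_intros c\<nu> crefl cx')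
  have ut: "unit_tangent f (cis t) = (1 / norm (x' t)) *\<^sub>R x' t" for t
    by (simp add: unit_tangent_def x'_def)
  have lin: "reflect y p (c *\<^sub>R w) = c *\<^sub>R reflect y p w" for y c w
    by (simp add: reflect_def scaleR_diff_right)
  have U'a: "chart p (u' t) = \<mu> t *\<^sub>R a t" for t
    using nz[of t] unfolding a_def u'_def \<mu>_def ut lin
    by (simp add: chart_linear x'_def x_def)
  have ab: "norm (a t) = 1" "norm (b t) = 1" "a t \<bullet> b t = 0" for t
  proof -
    have r: "orthonormal3 (reflect (x t) p (unit_tangent f (cis t))) (reflect (x t) p (n t)) p"
      by (rule orthonormal3_reflect[OF nx(1) p(1) nx(4) on(1)])
    then show "norm (a t) = 1" "norm (b t) = 1" "a t \<bullet> b t = 0"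
      using p(1) unfolding a_eq b_eq
      by (simp_all add: orthonormal3_def norm_chart chart_inner norm_eq_1)
  qed
  have ca: "continuous_on UNIV a"
  proof -
    have "continuous_on UNIV (\<lambda>t. (1 / \<mu> t) *\<^sub>R chart p (u' t))"
      unfolding \<mu>_def by (intro continuous_intros cU' c\<nu> cx') (use neq in blast)
    then show ?thesis by (simp add: U'a neq(4))
  qed
  have cb: "continuous_on UNIV b"
    using continuous_on_cong[of UNIV UNIV b "\<lambda>t. chart p (reflect (x t) p (n t))"]
    by (simp add: b_eq bounded_linear.continuous_on[OF linear_chart] crefl cx)
  have D0: "D 0 t = \<nu> t *\<^sub>R b t" for t
    unfolding D_def b_eq \<nu>_def pushoff_quotient_0[OF nx(1) p(1) nx(4) nx(3)]
    by (rule chart_linear(3))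
  have cxS: "continuous_on S (\<lambda>s. x (snd s))" "continuous_on S (\<lambda>s. n (snd s))" for S :: "(real \<times> real) set"
    by (auto intro!: continuous_on_compose2[OF cx(1)] continuous_on_compose2[OF cx(2)] continuous_intros)
  \<comment> \<open>Up to the positive factor \<open>sqrt (1 + \<epsilon>\<^sup>2)\<close> this is
    one minus the inner product of the push-off with the pole, so its positivity keeps the push-off
    away from \<open>p\<close>.\<close>
  let ?den = "\<lambda>\<epsilon> t. sqrt (1 + \<epsilon>\<^sup>2) - x t \<bullet> p - \<epsilon> * (n t \<bullet> p)"
  obtain \<epsilon>0 where \<epsilon>0: "\<epsilon>0 > 0" "\<And>\<epsilon> t. \<epsilon> \<in> {0..\<epsilon>0} \<Longrightarrow> t \<in> {0..2*pi} \<Longrightarrow> ?den \<epsilon> t > 0"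
  proof (rule eventually_positive_compact[of 1 "{0..2*pi}" "\<lambda>s. ?den (fst s) (snd s)"])
    show "continuous_on ({0..1} \<times> {0..2 * pi}) (\<lambda>s. ?den (fst s) (snd s))"
      by (intro continuous_intros cxS)
  qed (use xp in \<open>auto simp: less_imp_le\<close>)
  have den: "?den \<epsilon> t > 0" if \<epsilon>: "\<epsilon> \<in> {0..\<epsilon>0}" for \<epsilon> t
  proof -
    obtain k :: int where "t + 2 * pi * of_int k \<in> {0..2 * pi}" by (rule periodic_representative)
    from \<epsilon>0(2)[OF \<epsilon> this] show ?thesis
      unfolding periodic_int[of x "2 * pi", OF per(1)] periodic_int[of n "2 * pi", OF per(3)] .
  qed
  have cD: "continuous_on ({0..\<epsilon>0} \<times> {0..2*pi}) (\<lambda>s. D (fst s) (snd s))"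
  proof -
    have "(1 - x (snd s) \<bullet> p) * ?den (fst s) (snd s) \<noteq> 0" "1 + sqrt (1 + (fst s)\<^sup>2) \<noteq> 0" if "s \<in> {0..\<epsilon>0} \<times> {0..2*pi}" for s
    proof -
      have "fst s \<in> {0..\<epsilon>0}" using that by auto
      from den[OF this, of "snd s"] xp[of "snd s"]
      show "(1 - x (snd s) \<bullet> p) * ?den (fst s) (snd s) \<noteq> 0" by simp
      have "sqrt (1 + (fst s)\<^sup>2) \<ge> 0" by simp
      then show "1 + sqrt (1 + (fst s)\<^sup>2) \<noteq> 0" by linarith
    qed
    then show ?thesis
      unfolding D_def pushoff_quotient_def
      by (intro bounded_linear.continuous_on[OF linear_chart] continuous_intros cxS) auto
  qed
  have Uinj: "U (s + \<delta>) \<noteq> U s" if "\<delta> \<in> {0<..<2 * pi}" for s \<delta>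
  proof
    assume "U (s + \<delta>) = U s"
    then have "x (s + \<delta>) = x s"
      unfolding U_def
      by (intro stereographic_eq[OF nx(1) nx(1) p(1) nx(4) nx(4)] chart_inj[OF p(1)] stereographic_orthogonal p)
    then have "cis (s + \<delta>) = cis s" using inj unfolding x_def by (auto dest: inj_onD)
    then show False using cis_eqD that by blast
  qed
  have perU: "U (t + 2 * pi) = U t" "chart p (u' (t + 2 * pi)) = chart p (u' t)" "a (t + 2 * pi) = a t"
    "b (t + 2 * pi) = b t" "D \<epsilon> (t + 2 * pi) = D \<epsilon> t" for t \<epsilon>
    by (simp_all add: U_def u'_def \<nu>_def a_def b_def D_def per cis_periodic)
  show ?thesis
  proof (rule pushoff_estimates[OF dU cU' U'a \<nu>(2) ab ca cb perU cD \<epsilon>0(1) D0 \<nu>(1) Uinj])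
    fix \<eta> \<epsilon>1
    assume \<eta>: "0 < \<eta>" "\<eta> < pi" and \<epsilon>1: "0 < \<epsilon>1" "\<epsilon>1 \<le> \<epsilon>0"
      and cX: "\<And>t. norm ((1 / (\<eta> * \<mu> t)) *\<^sub>R (U (t + \<eta>) - U t) - a t) \<le> 1 / 16"
      and Dnz: "\<And>\<epsilon> t. \<epsilon> \<in> {0<..\<epsilon>1} \<Longrightarrow> D \<epsilon> t \<noteq> 0"
      and cY: "\<And>\<epsilon> t. \<epsilon> \<in> {0<..\<epsilon>1} \<Longrightarrow> norm ((1 / norm (D \<epsilon> t)) *\<^sub>R D \<epsilon> t - b t) < 1 / 4"
      and far: "\<And>\<epsilon> s \<delta>. \<epsilon> \<in> {0<..\<epsilon>1} \<Longrightarrow> \<delta> \<in> {\<eta>..2 * pi - \<eta>} \<Longrightarrow>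
        (U s - U (s + \<delta>)) \<bullet> (U s - (U (s + \<delta>) + \<epsilon> *\<^sub>R D \<epsilon> (s + \<delta>))) > 0"
        "\<And>\<epsilon> s \<delta>. \<epsilon> \<in> {0<..\<epsilon>1} \<Longrightarrow> \<delta> \<in> {\<eta>..2 * pi - \<eta>} \<Longrightarrow>
        (U s - U (s + \<delta>)) \<bullet> (U (s + \<delta>) - (U s + \<epsilon> *\<^sub>R D \<epsilon> s)) < 0"
      and near: "\<And>\<epsilon> t. \<epsilon> \<in> {0<..\<epsilon>1} \<Longrightarrow> \<exists>e. e \<bullet> D \<epsilon> t = 0 \<and> (\<forall>x\<in>{0<..\<eta>}. e \<bullet> (U (t + x) - U t) > 0) \<and>
        (\<forall>x\<in>{0<..\<eta>}. e \<bullet> (U (t - x) - U t) < 0) \<and>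
        (\<forall>k\<in>{0..1}. e \<bullet> (U (t + k * \<eta>) - (U (t - (1 - k) * \<eta>) + \<epsilon> *\<^sub>R D \<epsilon> (t - (1 - k) * \<eta>))) > 0)"
    \<comment> \<open>One \<open>\<epsilon>\<close> is wanted that is below
      \<open>\<epsilon>1\<close> and whose push-off has linking number 0;
      \<open>has_framing_number\<close> grants the latter only eventually.\<close>
    have "eventually (\<lambda>\<epsilon>. has_linking_number f (push_off f N \<epsilon>) 0 \<and> \<epsilon> \<in> {0<..<\<epsilon>1}) (at_right 0)"
      using fr \<epsilon>1 eventually_at_right_real[of 0 \<epsilon>1] unfolding has_framing_number_def by (intro eventually_conj) auto
    then obtain \<epsilon> where lk: "has_linking_number f (push_off f N \<epsilon>) 0" and e: "\<epsilon> \<in> {0<..<\<epsilon>1}"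
      using eventually_happens'[OF trivial_limit_at_right_real] by blast
    then have e1: "\<epsilon> \<in> {0<..\<epsilon>1}" and e0: "\<epsilon> \<in> {0..\<epsilon>0}" using \<epsilon>1 by auto
    define w where "w = sqrt (1 + \<epsilon>\<^sup>2)"
    have ww: "w > 0" "w\<^sup>2 = 1 + \<epsilon>\<^sup>2" unfolding w_def by (auto simp: add_pos_nonneg)
    define y where "y = (\<lambda>t. (1 / w) *\<^sub>R (x t + \<epsilon> *\<^sub>R n t))"
    define y' where "y' = (\<lambda>t. (1 / w) *\<^sub>R (x' t + \<epsilon> *\<^sub>R n' t))"
    have po: "push_off f N \<epsilon> (cis t) = y t" for t
      by (simp add: push_off_def y_def x_def n_def w_def)
    have dy: "(y has_vector_derivative y' t) (at t)" for t
      unfolding y_def y'_def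
      by (intro bounded_linear.has_vector_derivative[OF bounded_linear_scaleR_right] has_vector_derivative_add dx dn)
    have ny: "norm (y t) = 1" for t
    proof -
      have "(norm (x t + \<epsilon> *\<^sub>R n t))\<^sup>2 = w\<^sup>2"
        using nx(1,2,3)[of t] unfolding ww power2_norm_eq_inner
        by (simp add: inner_add norm_eq_1 inner_commute power2_eq_square)
      then have "norm (x t + \<epsilon> *\<^sub>R n t) = w" using ww(1) by (simp add: power2_eq_iff_nonneg)
      then show ?thesis using ww(1) by (simp add: y_def)
    qed
    have yp: "y t \<noteq> p" for t
    proof
      assume "y t = p"
      then have "w *\<^sub>R p = x t + \<epsilon> *\<^sub>R n t" using ww(1) by (auto simp: y_def)
      then have "w *\<^sub>R p \<bullet> p = (x t + \<epsilon> *\<^sub>R n t) \<bullet> p" by simp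
      then have "?den \<epsilon> t = 0" using p(1) unfolding w_def by (simp add: inner_add_left norm_eq_1)
      then show False using den[OF e0, of t] by simp
    qed
    have yy': "y' t \<bullet> y t = 0" for t
    proof -
      from bounded_bilinear.has_vector_derivative[OF bounded_bilinear_inner dy dy]
      have "((\<lambda>t. y t \<bullet> y t) has_vector_derivative y t \<bullet> y' t + y' t \<bullet> y t) (at t)" .
      moreover have "y t \<bullet> y t = 1" for t using ny by (simp add: norm_eq_1)
      ultimately have "((\<lambda>t. 1::real) has_vector_derivative y t \<bullet> y' t + y' t \<bullet> y t) (at t)" by simp
      from vector_derivative_unique_at[OF this has_vector_derivative_const] show ?thesis by (simp add: inner_commute)
    qed
    define V where "V = (\<lambda>t. chart p (stereographic p (y t)))"
    define v' where "v' = (\<lambda>t. (1 / (1 - y t \<bullet> p)) *\<^sub>R reflect (y t) p (y' t))"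
    have dv: "((\<lambda>t. stereographic p (y t)) has_vector_derivative v' t) (at t)" for t
      unfolding v'_def by (rule stereographic_has_vector_derivative[OF dy ny p(1) yp yy'])
    have dV: "(V has_vector_derivative chart p (v' t)) (at t)" for t
      unfolding V_def by (rule bounded_linear.has_vector_derivative[OF linear_chart dv])
    have cy: "continuous_on UNIV y" "continuous_on UNIV y'"
      unfolding y_def y'_def by (intro continuous_intros cx cx')+
    have yp1: "y t \<bullet> p \<noteq> 1" for t using unit_inner_less_1[OF ny p(1) yp, of t] by simp
    have cV': "continuous_on UNIV (\<lambda>t. chart p (v' t))"
      unfolding v'_def
      by (intro bounded_linear.continuous_on[OF linear_chart] continuous_intros continuous_on_reflect cy) (use yp1 in auto)
    have VU: "V t = U t + \<epsilon> *\<^sub>R D \<epsilon> t" for t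
    proof -
      have "stereographic p (y t) = stereographic p (x t) + \<epsilon> *\<^sub>R pushoff_quotient p (x t) (n t) \<epsilon>"
        unfolding y_def w_def using xp[of t] den[OF e0, of t] by (intro stereographic_pushoff) auto
      then show ?thesis
        unfolding V_def U_def D_def by (simp add: chart_linear(2) chart_linear)
    qed
    have disj: "U s \<noteq> V t" for s t
    proof
      assume "U s = V t"
      then have "x s = y t"
        unfolding U_def V_def
        by (intro stereographic_eq[OF nx(1) ny p(1) nx(4) yp] chart_inj[OF p(1)] stereographic_orthogonal p)
      moreover have "f ` circle \<inter> push_off f N \<epsilon> ` circle = {}" using lk by (simp add: has_linking_number_def)
      moreover have "x s \<in> f ` circle" "y t \<in> push_off f N \<epsilon> ` circle"
        unfolding x_def po[symmetric] by auto
      ultimately show False by auto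
    qed
    have perV: "V (t + 2 * pi) = V t" for t by (simp add: V_def y_def per)
    have "p \<notin> push_off f N \<epsilon> ` circle"
    proof
      assume "p \<in> push_off f N \<epsilon> ` circle"
      then obtain z where z: "z \<in> circle" "p = push_off f N \<epsilon> z" by blast
      then have "z = cis (Arg z)" by (subst cis_Arg) (auto simp: sgn_div_norm)
      then show False using z(2) po yp by metis
    qed
    then have "gauss_linking_integral p f (push_off f N \<epsilon>) = 0"
      using lk p by (simp add: has_linking_number_def)
    from gauss_linking_integral_triple[OF p(1) du[unfolded x_def] dv[folded po] this]
    have gauss: "integral {0..2 * pi} (\<lambda>s. integral {0..2 * pi} (\<lambda>t.
      triple (U s - V t) (chart p (u' s)) (chart p (v' t)) / norm (U s - V t) ^ 3)) = 0"
      unfolding po U_def V_def x_def .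
    obtain \<Psi> where \<Psi>: "continuous_on UNIV \<Psi>"
      "\<And>s t. \<Psi> (s + 2 * pi, t) = \<Psi> (s, t)" "\<And>s t. \<Psi> (s, t + 2 * pi) = \<Psi> (s, t)"
      "\<And>s t. norm (\<Psi> (s, t)) = 1" "\<And>s t. hopf (\<Psi> (s, t)) = (1 / norm (U s - V t)) *\<^sub>R (U s - V t)"
      using periodic_hopf_lift[OF dU cU' dV cV' disj perU(1) perV gauss] by blast
    \<comment> \<open>The separating vector is chosen for each \<open>t\<close> on its own; it is
      used pointwise only.\<close>
    have "\<exists>e. \<forall>t. e t \<bullet> D \<epsilon> t = 0 \<and> (\<forall>x\<in>{0<..\<eta>}. e t \<bullet> (U (t + x) - U t) > 0) \<and>
        (\<forall>x\<in>{0<..\<eta>}. e t \<bullet> (U (t - x) - U t) < 0) \<and>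
        (\<forall>k\<in>{0..1}. e t \<bullet> (U (t + k * \<eta>) - (U (t - (1 - k) * \<eta>) + \<epsilon> *\<^sub>R D \<epsilon> (t - (1 - k) * \<eta>))) > 0)"
      by (rule choice, rule allI, rule near[OF e1])
    then obtain e where e: "\<And>t. e t \<bullet> D \<epsilon> t = 0" "\<And>t x. x \<in> {0<..\<eta>} \<Longrightarrow> e t \<bullet> (U (t + x) - U t) > 0"
      "\<And>t x. x \<in> {0<..\<eta>} \<Longrightarrow> e t \<bullet> (U (t - x) - U t) < 0"
      "\<And>t k. k \<in> {0..1} \<Longrightarrow> e t \<bullet> (U (t + k * \<eta>) - V (t - (1 - k) * \<eta>)) > 0"
      unfolding VU by blast
    show ?thesis
    proof (rule spin_frame[OF \<Psi> \<eta> far(1)[OF e1, folded VU] far(2)[OF e1, folded VU] _ e(2,3,4)])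
      show "e t \<bullet> (V t - U t) = 0" for t using e(1)[of t] by (simp add: VU)
    next
      fix \<xi>
      assume \<xi>: "continuous_on {0..2 * pi} \<xi>" "\<And>t. norm (\<xi> t) = 1" "\<xi> (2 * pi) = - \<xi> 0"
        "\<And>t. hopf (\<xi> t) = (1 / norm (U t - V t)) *\<^sub>R (U t - V t)"
        "\<And>t. t \<in> {0..2 * pi} \<Longrightarrow> \<exists>a. \<exists>b>0. (1 / norm (U (t + \<eta>) - V t)) *\<^sub>R (U (t + \<eta>) - V t) = a *\<^sub>R hopf (\<xi> t) + b *\<^sub>R hopf_frame (\<xi> t)"
      define X where "X = (\<lambda>t. (1 / (\<eta> * \<mu> t)) *\<^sub>R (U (t + \<eta>) - U t))"
      \<comment> \<open>\<open>Y\<close> points from the knot to its push-off, whereas the lift was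
        built from \<open>U t - V t\<close>; hence the sign.\<close>
      define Y where "Y = (\<lambda>t. - hopf (\<xi> t))"
      have Y: "Y t = (1 / norm (V t - U t)) *\<^sub>R (V t - U t)" for t
        unfolding Y_def \<xi>(4) norm_minus_commute[of "U t"] by (simp flip: scaleR_minus_right)
      have Y2: "Y t = (1 / norm (D \<epsilon> t)) *\<^sub>R D \<epsilon> t" for t
        unfolding Y using e1 by (simp add: VU)
      have cUV: "continuous_on UNIV U" "continuous_on UNIV V"
        using dU dV by (meson continuous_at_imp_continuous_on has_vector_derivative_continuous)+
      have dn: "norm (V t - U t) \<noteq> 0" for t using disj[of t t] by auto
      have \<mu>per: "\<mu> (2 * pi) = \<mu> 0" using per(1)[of 0] per(2)[of 0] by (simp add: \<mu>_def \<nu>_def)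
      show ?thesis
      proof (rule that[OF \<xi>(1,2,3)])
        show "continuous_on UNIV X"
          unfolding X_def \<mu>_def
          by (intro continuous_intros continuous_on_compose2[OF cUV(1)] c\<nu> cx') (use neq(1) \<eta> in auto)
        show "continuous_on UNIV Y"
          unfolding Y by (intro continuous_intros cUV) (use dn in blast)
        show "X (2 * pi) = X 0" using perU(1)[of \<eta>] perU(1)[of 0] \<mu>per by (simp add: X_def add.commute)
        show "Y (2 * pi) = Y 0" using perV[of 0] perU(1)[of 0] by (simp add: Y)
        show "norm (X t - a t) \<le> 1 / 16" for t unfolding X_def by (rule cX)
        show "norm (Y t - b t) < 1 / 4" for t unfolding Y2 by (rule cY[OF e1])
        show "Y t = - hopf (\<xi> t)" for t by (simp add: Y_def)
        fix t assume t: "t \<in> {0..2 * pi}"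
        obtain c d where cd: "d > 0" "(1 / norm (U (t + \<eta>) - V t)) *\<^sub>R (U (t + \<eta>) - V t) = c *\<^sub>R hopf (\<xi> t) + d *\<^sub>R hopf_frame (\<xi> t)"
          using \<xi>(5)[OF t] by blast
        \<comment> \<open>The chord \<open>U (t + \<eta>) - U t\<close> is a difference of two
          vectors with directions known in the frame of \<open>\<xi> t\<close>. The subtracted one
          lies on the axis \<open>hopf (\<xi> t)\<close>, so the coefficient of
          \<open>hopf_frame\<close> stays positive.\<close>
        define k l m where "k = norm (U (t + \<eta>) - V t)" and "l = norm (U t - V t)" and "m = \<eta> * \<mu> t"
        have pos: "k > 0" "l > 0" "m > 0" using disj \<eta> \<nu>(2) by (simp_all add: k_def l_def m_def)
        have "U (t + \<eta>) - V t = k *\<^sub>R ((1 / k) *\<^sub>R (U (t + \<eta>) - V t))" using pos by simp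
        also have "\<dots> = k *\<^sub>R (c *\<^sub>R hopf (\<xi> t) + d *\<^sub>R hopf_frame (\<xi> t))" unfolding k_def cd(2) ..
        finally have 1: "U (t + \<eta>) - V t = (k * c) *\<^sub>R hopf (\<xi> t) + (k * d) *\<^sub>R hopf_frame (\<xi> t)"
          by (simp add: scaleR_right_distrib)
        have 2: "U t - V t = l *\<^sub>R hopf (\<xi> t)" unfolding \<xi>(4) using pos by (simp flip: l_def)
        have "U (t + \<eta>) - U t = (U (t + \<eta>) - V t) - (U t - V t)" by simp
        also have "\<dots> = (k * c - l) *\<^sub>R hopf (\<xi> t) + (k * d) *\<^sub>R hopf_frame (\<xi> t)"
          unfolding 1 2 by (simp add: scaleR_left_diff_distrib)
        finally have "X t = ((k * c - l) / m) *\<^sub>R hopf (\<xi> t) + (k * d / m) *\<^sub>R hopf_frame (\<xi> t)"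
          unfolding X_def m_def[symmetric] by (simp add: scaleR_right_distrib)
        moreover have "k * d / m > 0" using pos cd(1) by simp
        ultimately show "\<exists>c. \<exists>d>0. X t = c *\<^sub>R hopf (\<xi> t) + d *\<^sub>R hopf_frame (\<xi> t)" by blast
      qed
    qed
  qed
qed

section \<open>Homotopies of frames\<close>

lemma bounded_bilinear_matrix_matrix_mult:
  "bounded_bilinear (\<lambda>(M :: real^'n^'m) (P :: real^'k^'n). M ** P)"
proof -
  have "bilinear (\<lambda>(M :: real^'n^'m) (P :: real^'k^'n). M ** P)"
    unfolding bilinear_def
    by (intro conjI allI linearI)
      (simp_all add: vec_eq_iff matrix_matrix_mult_def sum_distrib_left sum.distrib algebra_simps)
  then show ?thesis
    by (simp add: bilinear_conv_bounded_bilinear)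
qed

lemmas continuous_on_matrix_matrix_mult =
  bounded_bilinear.continuous_on[OF bounded_bilinear_matrix_matrix_mult]

lemma continuous_on_transpose:
  "continuous_on S A \<Longrightarrow> continuous_on S (\<lambda>s. transpose (A s) :: real^'n^'m)"
  unfolding transpose_def by (intro continuous_on_vec_lambda continuous_on_component)

lemma orthogonal_matrix_mult_transpose:
  assumes "orthogonal_matrix (A :: real^'n^'n)"
  shows "A ** transpose A = mat 1" "transpose A ** A = mat 1" "matrix_inv A = transpose A"
proof -
  show 1: "A ** transpose A = mat 1" "transpose A ** A = mat 1"
    using assms by (simp_all add: orthogonal_matrix_def)
  then have "A ** matrix_inv A = mat 1 \<and> matrix_inv A ** A = mat 1"
    unfolding matrix_inv_def by (rule someI[where P = "\<lambda>B. A ** B = mat 1 \<and> B ** A = mat 1", OF conjI])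
  then have "transpose A ** (A ** matrix_inv A) = transpose A" by simp
  then show "matrix_inv A = transpose A" by (simp add: matrix_mul_assoc 1)
qed

lemma homotopic_loopsI:
  fixes h :: "real \<times> real \<Rightarrow> 'a::topological_space"
  assumes "continuous_on ({0..1} \<times> {0..1}) h" "\<And>k t. k \<in> {0..1} \<Longrightarrow> t \<in> {0..1} \<Longrightarrow> h (k, t) \<in> S"
    "\<And>t. t \<in> {0..1} \<Longrightarrow> h (0, t) = p t" "\<And>t. t \<in> {0..1} \<Longrightarrow> h (1, t) = q t"
    "\<And>k. k \<in> {0..1} \<Longrightarrow> h (k, 1) = h (k, 0)"
  shows "homotopic_loops S p q"
  unfolding homotopic_loops
  by (rule exI[of _ h]) (use assms in \<open>auto simp: pathstart_def pathfinish_def\<close>)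

text \<open>Multiplying each stage from the right by the inverse of its initial matrix turns a free
  homotopy of loops into one based at the identity.\<close>

lemma homotopic_loops_based:
  fixes A B :: "real \<Rightarrow> real^4^4"
  assumes "homotopic_loops {M. orthogonal_matrix M} A B"
  shows "homotopic_paths {M. orthogonal_matrix M} (\<lambda>t. A t ** transpose (A 0)) (\<lambda>t. B t ** transpose (B 0))"
proof -
  obtain h :: "real \<times> real \<Rightarrow> real^4^4" where h: "continuous_on ({0..1} \<times> {0..1}) h"
    "h \<in> ({0..1} \<times> {0..1}) \<rightarrow> {M. orthogonal_matrix M}"
    "\<forall>t\<in>{0..1}. h (0, t) = A t" "\<forall>t\<in>{0..1}. h (1, t) = B t"
    "\<forall>k\<in>{0..1}. pathfinish (h \<circ> Pair k) = pathstart (h \<circ> Pair k)"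
    using assms unfolding homotopic_loops by blast
  have o: "orthogonal_matrix (h (k, t))" if "k \<in> {0..1}" "t \<in> {0..1}" for k t
    using h(2) that by blast
  have e: "h (k, 1) = h (k, 0)" if "k \<in> {0..1}" for k
    using h(5) that by (simp add: pathstart_def pathfinish_def)
  have A01: "A 1 = A 0" using e[of 0] h(3) by simp
  show ?thesis
    unfolding homotopic_paths
  proof (intro exI[of _ "\<lambda>x. h x ** transpose (h (fst x, 0))"] conjI ballI)
    show "continuous_on ({0..1} \<times> {0..1}) (\<lambda>x. h x ** transpose (h (fst x, 0)))"
      by (intro continuous_on_matrix_matrix_mult continuous_on_transpose h(1) continuous_on_compose2[OF h(1)] continuous_intros) auto
    show "(\<lambda>x. h x ** transpose (h (fst x, 0))) \<in> ({0..1} \<times> {0..1}) \<rightarrow> {M. orthogonal_matrix M}"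
      using o by (auto intro!: orthogonal_matrix_mul)
    fix k :: real assume k: "k \<in> {0..1}"
    show "pathstart ((\<lambda>x. h x ** transpose (h (fst x, 0))) \<circ> Pair k) = pathstart (\<lambda>t. A t ** transpose (A 0))"
      "pathfinish ((\<lambda>x. h x ** transpose (h (fst x, 0))) \<circ> Pair k) = pathfinish (\<lambda>t. A t ** transpose (A 0))"
      using o[OF k, of 0] o[of 0 0] h(3) A01 e[OF k] by (simp_all add: pathstart_def pathfinish_def orthogonal_matrix_mult_transpose)
  qed (use h(3,4) in simp_all)
qed

text \<open>The fixed vector travels through the connected 3-sphere from \<open>p\<close> to the
  fourth axis, where the chart matrix is the identity. All stages are loops based at the
  identity.\<close>

lemma homotopic_conj_rotation:
  assumes p: "norm p = 1"
  shows "homotopic_paths {M. orthogonal_matrix M} (\<lambda>t. conj_rotation p (2 * pi * t)) (\<lambda>t. rotation (2 * pi * t))"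
proof -
  let ?e = "vector [0, 0, 0, 1] :: real^4"
  have e: "norm ?e = 1" by (simp add: norm_eq_1 inner_4)
  have "path_connected (sphere (0::real^4) 1)" by (rule path_connected_sphere) simp
  moreover have "p \<in> sphere 0 1" "?e \<in> sphere 0 1" using p e by simp_all
  ultimately obtain w where w: "path w" "path_image w \<subseteq> sphere 0 1" "pathstart w = p" "pathfinish w = ?e"
    unfolding path_connected_def by blast
  have nw: "norm (w k) = 1" if "k \<in> {0..1}" for k
  proof -
    have "w k \<in> sphere 0 1" using w(2) imageI[OF that, of w] unfolding path_image_def by blast
    then show ?thesis by simp
  qed
  have cw: "continuous_on {0..1} w" using w(1) by (simp add: path_def)
  have r: "rotation 0 = mat 1" "rotation (2 * pi) = mat 1"
    using rotation_0[of 0] rotation_0[of 1] by simp_all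
  have c0: "conj_rotation x 0 = mat 1" "conj_rotation x (2 * pi) = mat 1" if "norm x = 1" for x
    using orthogonal_matrix_mult_transpose(2)[OF orthogonal_chart_matrix[OF that]]
    by (simp_all add: conj_rotation_def r)
  show ?thesis
    unfolding homotopic_paths
  proof (intro exI[of _ "\<lambda>x. conj_rotation (w (fst x)) (2 * pi * snd x)"] conjI ballI)
    show "continuous_on ({0..1} \<times> {0..1}) (\<lambda>x. conj_rotation (w (fst x)) (2 * pi * snd x))"
      unfolding conj_rotation_def
      by (intro continuous_on_matrix_matrix_mult continuous_on_transpose continuous_on_chart_matrix
          continuous_on_rotation continuous_on_compose2[OF cw] continuous_intros) auto
    show "(\<lambda>x. conj_rotation (w (fst x)) (2 * pi * snd x)) \<in> {0..1} \<times> {0..1} \<rightarrow> {M. orthogonal_matrix M}"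
      using rotation_matrix_conj_rotation nw by (auto simp: rotation_matrix_def)
    show "conj_rotation (w (fst (0, t))) (2 * pi * snd (0, t)) = conj_rotation p (2 * pi * t)" for t :: real
      using w(3) by (simp add: pathstart_def)
    show "conj_rotation (w (fst (1, t))) (2 * pi * snd (1, t)) = rotation (2 * pi * t)" for t :: real
      using w(4) by (simp add: pathfinish_def conj_rotation_def chart_matrix_axis transpose_mat)
  qed (use c0 nw p in \<open>simp_all add: pathstart_def pathfinish_def\<close>)
qed

section \<open>Free homotopies of orthonormal triples\<close>

definition orthonormal_triples :: "((real^4) \<times> (real^4) \<times> (real^4)) set"
  where "orthonormal_triples = {(x, y, z). orthonormal3 x y z}"

lemma homotopic_loops_frame4:
  assumes "homotopic_loops orthonormal_triples \<gamma> \<delta>"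
  shows "homotopic_loops {M. orthogonal_matrix M} (\<lambda>t. frame4 (fst (\<gamma> t)) (fst (snd (\<gamma> t))) (snd (snd (\<gamma> t))))
    (\<lambda>t. frame4 (fst (\<delta> t)) (fst (snd (\<delta> t))) (snd (snd (\<delta> t))))"
proof -
  have "homotopic_loops {M. orthogonal_matrix M} ((\<lambda>a. frame4 (fst a) (fst (snd a)) (snd (snd a))) \<circ> \<gamma>)
    ((\<lambda>a. frame4 (fst a) (fst (snd a)) (snd (snd a))) \<circ> \<delta>)"
  proof (rule homotopic_loops_continuous_image[OF assms])
    show "continuous_on orthonormal_triples (\<lambda>a. frame4 (fst a) (fst (snd a)) (snd (snd a)))"
      by (intro continuous_on_frame4 continuous_intros)
    show "(\<lambda>a. frame4 (fst a) (fst (snd a)) (snd (snd a))) \<in> orthonormal_triples \<rightarrow> {M. orthogonal_matrix M}"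
      using rotation_matrix_frame4 by (auto simp: orthonormal_triples_def rotation_matrix_def)
  qed
  then show ?thesis by (simp add: o_def)
qed

text \<open>Inner products with \<open>a\<close> and \<open>b\<close> change by at most 1/4. If
  \<open>X = c *\<^sub>R Y\<close>, comparison along \<open>a\<close> forces the modulus of
  \<open>c\<close> to be at least 3, comparison along \<open>b\<close> at most 1/3.\<close>

lemma perturbed_frame:
  fixes a b X Y :: "'a::real_inner"
  assumes ab: "norm a = 1" "norm b = 1" "a \<bullet> b = 0" and X: "norm (X - a) \<le> 1 / 4" and Y: "norm (Y - b) \<le> 1 / 4"
  shows "Y \<noteq> 0" "X - (X \<bullet> Y / (Y \<bullet> Y)) *\<^sub>R Y \<noteq> 0"
proof -
  have 1: "a \<bullet> a = 1" "b \<bullet> b = 1" using ab by (simp_all add: norm_eq_1)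
  have bd: "\<bar>(Z - u) \<bullet> v\<bar> \<le> 1 / 4" if "norm (Z - u) \<le> 1 / 4" "norm v = 1" for Z u v :: 'a
    using Cauchy_Schwarz_ineq2[of "Z - u" v] that by simp
  have b: "\<bar>X \<bullet> a - 1\<bar> \<le> 1 / 4" "\<bar>X \<bullet> b\<bar> \<le> 1 / 4" "\<bar>Y \<bullet> a\<bar> \<le> 1 / 4" "\<bar>Y \<bullet> b - 1\<bar> \<le> 1 / 4"
    using bd[OF X ab(1)] bd[OF X ab(2)] bd[OF Y ab(1)] bd[OF Y ab(2)]
    by (simp_all only: inner_diff_left 1 ab(3) inner_commute[of b a] diff_0_right)
  then show "Y \<noteq> 0" by auto
  show "X - (X \<bullet> Y / (Y \<bullet> Y)) *\<^sub>R Y \<noteq> 0"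
  proof
    define c where "c = X \<bullet> Y / (Y \<bullet> Y)"
    assume "X - (X \<bullet> Y / (Y \<bullet> Y)) *\<^sub>R Y = 0"
    then have "X = c *\<^sub>R Y" by (simp add: c_def)
    then have c: "X \<bullet> a = c * (Y \<bullet> a)" "X \<bullet> b = c * (Y \<bullet> b)" by simp_all
    have "3 / 4 \<le> \<bar>X \<bullet> a\<bar>" using b(1) by linarith
    also have "\<dots> \<le> \<bar>c\<bar> * (1 / 4)" unfolding c abs_mult by (intro mult_left_mono b) auto
    finally have "3 \<le> \<bar>c\<bar>" by simp
    have "3 / 4 \<le> \<bar>Y \<bullet> b\<bar>" using b(4) by linarith
    then have "\<bar>c\<bar> * (3 / 4) \<le> \<bar>c\<bar> * \<bar>Y \<bullet> b\<bar>" by (intro mult_left_mono) auto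
    also have "\<dots> \<le> 1 / 4" using b(2) by (simp add: c abs_mult)
    finally show False using \<open>3 \<le> \<bar>c\<bar>\<close> by simp
  qed
qed

lemma orthonormal3_unchart:
  assumes "norm p = 1" "norm a = 1" "norm b = 1" "a \<bullet> b = 0"
  shows "orthonormal3 (unchart p a) (unchart p b) (- p)"
  using assms by (simp add: orthonormal3_def norm_eq_1 unchart_inner unchart_orthogonal)

lemma continuous_on_unchart:
  "continuous_on S a \<Longrightarrow> continuous_on S (\<lambda>s. unchart p (a s))"
  by (rule bounded_linear.continuous_on[OF linear_unchart])

lemma hopf_minus: "hopf (- \<psi>) = hopf \<psi>" "hopf_frame (- \<psi>) = hopf_frame \<psi>"
  by (simp_all add: hopf_def hopf_frame_def)

lemma continuous_on_hopf:
  assumes "continuous_on S \<psi>"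
  shows "continuous_on S (\<lambda>s. hopf (\<psi> s))" "continuous_on S (\<lambda>s. hopf_frame (\<psi> s))"
  unfolding hopf_def hopf_frame_def by (intro continuous_intros assms)+

text \<open>Spinor paths from \<open>\<xi>\<close> to \<open>-\<xi>\<close> are homotopic because the 3-sphere is simply connected.\<close>

lemma homotopic_loops_spinor:
  fixes \<xi> :: "real \<Rightarrow> spinor"
  assumes p: "norm p = 1" and \<xi>: "continuous_on {0..2 * pi} \<xi>" "\<And>t. norm (\<xi> t) = 1" "\<xi> (2 * pi) = - \<xi> 0"
  shows "homotopic_loops orthonormal_triples
    (\<lambda>t. (unchart p (hopf_frame (\<xi> (2 * pi * t))), unchart p (- hopf (\<xi> (2 * pi * t))), - p))
    (\<lambda>t. (conj_rotation p (2 * pi * t) *v unchart p (hopf_frame (\<xi> 0)),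
      conj_rotation p (2 * pi * t) *v unchart p (- hopf (\<xi> 0)), conj_rotation p (2 * pi * t) *v (- p)))"
proof -
  obtain z w where zw: "\<xi> 0 = (z, w)" by fastforce
  \<comment> \<open>Along this path \<open>hopf\<close> and \<open>hopf_frame\<close> turn by the
    angle \<open>2 * pi * t\<close>, while the phases move at half that speed. At
    \<open>t = 1\<close> both phases are -1, so the path ends at \<open>- \<xi> 0\<close>.\<close>
  define s where "s = (\<lambda>t. (cis (- pi * t) * z, cis (pi * t) * w))"
  have sc: "simply_connected (sphere (0::spinor) 1)"
    by (rule simply_connected_sphere) simp
  have ns: "norm (s t) = 1" for t
  proof -
    have "(norm (s t))\<^sup>2 = (norm (\<xi> 0))\<^sup>2" unfolding norm_spinor zw s_def by (simp add: norm_mult)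
    then show ?thesis using \<xi>(2)[of 0] norm_ge_zero[of "s t"] by (simp add: power2_eq_1_iff)
  qed
  have ps: "path s" unfolding path_def s_def cis_conv_exp by (intro continuous_intros)
  have px: "path (\<lambda>t. \<xi> (2 * pi * t))" unfolding path_def
    by (rule continuous_on_compose2[OF \<xi>(1)]) (auto intro!: continuous_intros simp: mult_le_cancel_left2)
  have "cis (- pi) = - 1" by (simp add: complex_eq_iff)
  then have "s 0 = \<xi> 0" "s 1 = - \<xi> 0" by (simp_all add: s_def zw)
  then have "pathstart s = pathstart (\<lambda>t. \<xi> (2 * pi * t))" "pathfinish s = pathfinish (\<lambda>t. \<xi> (2 * pi * t))"
    using \<xi>(3) by (simp_all add: pathstart_def pathfinish_def)
  moreover have "path_image s \<subseteq> sphere 0 1" "path_image (\<lambda>t. \<xi> (2 * pi * t)) \<subseteq> sphere 0 1"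
    using ns \<xi>(2) by (simp_all add: path_image_def image_subset_iff)
  ultimately have "homotopic_paths (sphere 0 1) (\<lambda>t. \<xi> (2 * pi * t)) s"
    using sc[unfolded simply_connected_eq_homotopic_paths] px ps by blast
  then obtain h where h: "continuous_on ({0..1} \<times> {0..1}) h" "h \<in> ({0..1} \<times> {0..1}) \<rightarrow> sphere 0 1"
    "\<forall>t\<in>{0..1}. h (0, t) = \<xi> (2 * pi * t)" "\<forall>t\<in>{0..1}. h (1, t) = s t"
    "\<forall>k\<in>{0..1::real}. pathstart (h \<circ> Pair k) = pathstart (\<lambda>t. \<xi> (2 * pi * t)) \<and>
      pathfinish (h \<circ> Pair k) = pathfinish (\<lambda>t. \<xi> (2 * pi * t))"
    unfolding homotopic_paths by blast
  have hopf_s: "hopf (s t) = (fst (hopf (\<xi> 0)), cis (2 * pi * t) * snd (hopf (\<xi> 0)))"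
    "hopf_frame (s t) = (fst (hopf_frame (\<xi> 0)), cis (2 * pi * t) * snd (hopf_frame (\<xi> 0)))" for t
  proof -
    have c: "cis (2 * pi * t) = cis (pi * t) * cis (pi * t)" by (simp add: cis_mult mult.assoc)
    have c': "cis (- pi * t) * cis (pi * t) = 1" by (simp add: cis_mult)
    have cc: "cnj (cis (- pi * t)) = cis (pi * t)" by (simp add: cis_cnj)
    show "hopf (s t) = (fst (hopf (\<xi> 0)), cis (2 * pi * t) * snd (hopf (\<xi> 0)))"
      unfolding hopf_def s_def zw fst_conv snd_conv complex_cnj_mult cc c by (simp add: norm_mult)
    have "(cis (- pi * t) * z) * (cis (pi * t) * w) = (cis (- pi * t) * cis (pi * t)) * (z * w)" by (simp only: mult_ac)
    also have "\<dots> = z * w" unfolding c' by simp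
    finally have e: "(cis (- pi * t) * z) * (cis (pi * t) * w) = z * w" .
    have e2: "(cis (pi * t) * cnj z)\<^sup>2 - (cis (pi * t) * w)\<^sup>2 = cis (pi * t) * cis (pi * t) * ((cnj z)\<^sup>2 - w\<^sup>2)"
      by (simp only: power2_eq_square right_diff_distrib mult_ac)
    show "hopf_frame (s t) = (fst (hopf_frame (\<xi> 0)), cis (2 * pi * t) * snd (hopf_frame (\<xi> 0)))"
      unfolding hopf_frame_def s_def zw fst_conv snd_conv complex_cnj_mult cc c e e2 ..
  qed
  have rot: "unchart p (hopf_frame (s t)) = conj_rotation p (2 * pi * t) *v unchart p (hopf_frame (\<xi> 0))"
    "unchart p (- hopf (s t)) = conj_rotation p (2 * pi * t) *v unchart p (- hopf (\<xi> 0))"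
    "- p = conj_rotation p (2 * pi * t) *v (- p)" for t
    using conj_rotation_mult(2)[OF p, of "2 * pi * t"]
      linear_neg[OF matrix_vector_mul_linear, of "conj_rotation p (2 * pi * t)" p]
    by (simp_all add: conj_rotation_mult(1)[OF p] hopf_s uminus_prod_def)
  have nh: "norm (h (k, t)) = 1" if "k \<in> {0..1}" "t \<in> {0..1}" for k t
  proof -
    have "h (k, t) \<in> sphere 0 1" using h(2) that by blast
    then show ?thesis by simp
  qed
  show ?thesis
  proof (rule homotopic_loopsI[of "\<lambda>x. (unchart p (hopf_frame (h x)), unchart p (- hopf (h x)), - p)"])
    show "continuous_on ({0..1} \<times> {0..1}) (\<lambda>x. (unchart p (hopf_frame (h x)), unchart p (- hopf (h x)), - p))"
      by (intro continuous_intros continuous_on_unchart continuous_on_hopf h(1))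
    show "(unchart p (hopf_frame (h (k, t))), unchart p (- hopf (h (k, t))), - p) \<in> orthonormal_triples"
      if "k \<in> {0..1}" "t \<in> {0..1}" for k t
      using orthonormal3_unchart[OF p, of "hopf_frame (h (k, t))" "- hopf (h (k, t))"] nh[OF that]
        hopf_frame_orthogonal[of "h (k, t)"]
      by (simp add: orthonormal_triples_def norm_hopf norm_hopf_frame inner_commute)
    \<comment> \<open>The ends of each spinor path differ by a sign only, and \<open>hopf\<close>
      and \<open>hopf_frame\<close> are even, so the frames form a closed loop.\<close>
    show "(unchart p (hopf_frame (h (k, 1))), unchart p (- hopf (h (k, 1))), - p)
      = (unchart p (hopf_frame (h (k, 0))), unchart p (- hopf (h (k, 0))), - p)" if "k \<in> {0..1}" for k
      using h(5) that \<xi>(3) by (simp add: pathstart_def pathfinish_def hopf_minus)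
  qed (use h(3,4) rot in simp_all)
qed

text \<open>A knot that covers the 3-sphere would be a homeomorphism onto it, but the circle is not
  simply connected.\<close>

lemma exists_pole:
  assumes "f \<in> Emb"
  obtains p where "norm p = 1" "p \<notin> f ` circle"
proof -
  have "f ` circle \<noteq> sphere 0 1"
  proof
    assume eq: "f ` circle = sphere 0 1"
    have "continuous_on circle f"
      using smooth_on_circle_continuous[of f 0] assms by (simp add: Emb_def)
    moreover have "inj_on f circle" using assms by (simp add: Emb_def)
    ultimately have "circle homeomorphic (sphere 0 1 :: (real^4) set)"
      using homeomorphic_compact[OF compact_sphere _ eq] by blast
    then have "simply_connected circle"
      using homeomorphic_simply_connected_eq simply_connected_sphere[of "0 :: real^4" 1] by force
    then show False by (simp add: simply_connected_sphere_eq)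
  qed
  moreover have "f ` circle \<subseteq> sphere 0 1" using assms by (simp add: Emb_def)
  ultimately obtain p where "p \<in> sphere 0 1" "p \<notin> f ` circle" by blast
  then show ?thesis using that by simp
qed

text \<open>The segment from \<open>x\<close> to \<open>- p\<close> could meet the ray through
  \<open>p\<close> only if \<open>x\<close> had the direction of \<open>p\<close>, which equal norms
  and \<open>x \<noteq> p\<close> exclude. So it can be normalised, and the result misses
  \<open>p\<close>.\<close>

lemma shrink_to_antipode:
  fixes x p :: "'a::real_inner"
  assumes "norm x = 1" "norm p = 1" "x \<noteq> p" "k \<in> {0..1}"
  defines "y \<equiv> (1 - k) *\<^sub>R x - k *\<^sub>R p"
  shows "y \<noteq> 0" "norm ((1 / norm y) *\<^sub>R y) = 1" "(1 / norm y) *\<^sub>R y \<noteq> p"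
proof -
  have neq: "(1 - k) *\<^sub>R x \<noteq> c *\<^sub>R p" if c: "c \<ge> 0" "c > 0 \<or> k \<noteq> 1" for c
  proof
    assume *: "(1 - k) *\<^sub>R x = c *\<^sub>R p"
    then have "norm ((1 - k) *\<^sub>R x) = norm (c *\<^sub>R p)" by simp
    then have "1 - k = c" using assms c by simp
    then have "c \<noteq> 0" using c by auto
    then show False using * \<open>1 - k = c\<close> assms(3) by simp
  qed
  show y0: "y \<noteq> 0"
  proof
    assume "y = 0"
    then have "(1 - k) *\<^sub>R x = k *\<^sub>R p" by (simp add: y_def)
    moreover have "k > 0 \<or> k \<noteq> 1" by linarith
    ultimately show False using neq[of k] assms(4) by simp
  qed
  then show "norm ((1 / norm y) *\<^sub>R y) = 1" by simp
  show "(1 / norm y) *\<^sub>R y \<noteq> p"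
  proof
    assume "(1 / norm y) *\<^sub>R y = p"
    then have "norm y *\<^sub>R p = y" using y0 by auto
    then have "(1 - k) *\<^sub>R x = (norm y + k) *\<^sub>R p" unfolding y_def by (simp add: algebra_simps)
    moreover have "norm y + k > 0" using y0 assms(4) by (simp add: add_pos_nonneg)
    ultimately show False using neq[of "norm y + k"] by simp
  qed
qed

text \<open>Transport of the frame along the contraction of the complement of the pole to its antipode.\<close>

lemma homotopic_loops_reflect:
  fixes T n x :: "real \<Rightarrow> real^4"
  assumes p: "norm p = 1" and on: "\<And>t. orthonormal3 (T t) (n t) (x t)" and xp: "\<And>t. x t \<noteq> p"
    and cont: "continuous_on {0..1} T" "continuous_on {0..1} n" "continuous_on {0..1} x"
    and per: "T 1 = T 0" "n 1 = n 0" "x 1 = x 0"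
  shows "homotopic_loops orthonormal_triples (\<lambda>t. (T t, n t, x t))
    (\<lambda>t. (reflect (x t) p (T t), reflect (x t) p (n t), - p))"
proof -
  have nx: "norm (x t) = 1" for t using on[of t] by (simp add: orthonormal3_def)
  define y where "y = (\<lambda>s. (1 - fst s) *\<^sub>R x (snd s) - fst s *\<^sub>R p)"
  define z where "z = (\<lambda>s. (1 / norm (y s)) *\<^sub>R y s)"
  have z: "y s \<noteq> 0" "norm (z s) = 1" "z s \<noteq> p" "z s \<bullet> p \<noteq> 1" if "fst s \<in> {0..1}" for s
  proof -
    show 1: "y s \<noteq> 0" "norm (z s) = 1" "z s \<noteq> p"
      using shrink_to_antipode[OF nx p xp that, of "snd s"] unfolding z_def y_def by blast+
    show "z s \<bullet> p \<noteq> 1" using unit_inner_less_1[OF 1(2) p 1(3)] by simp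
  qed
  let ?I = "{0..1::real} \<times> {0..1::real}"
  have cy: "continuous_on ?I y"
    unfolding y_def by (intro continuous_intros continuous_on_compose2[OF cont(3)]) auto
  have "norm (y s) \<noteq> 0" if "s \<in> ?I" for s using z(1)[of s] that by auto
  then have cz: "continuous_on ?I z"
    unfolding z_def by (intro continuous_intros cy) blast
  have xp1: "x t \<bullet> p \<noteq> 1" for t using unit_inner_less_1[OF nx p xp, of t] by simp
  have cT: "continuous_on ?I (\<lambda>s. reflect (x (snd s)) p (T (snd s)))" "continuous_on ?I (\<lambda>s. reflect (x (snd s)) p (n (snd s)))"
    by (rule continuous_on_reflect; (intro continuous_on_compose2[OF cont(1)] continuous_on_compose2[OF cont(2)]
      continuous_on_compose2[OF cont(3)] continuous_intros)?; (use xp1 in auto)?)+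
  have zp: "z s \<bullet> p \<noteq> 1" if "s \<in> ?I" for s using z(4)[of s] that by auto
  \<comment> \<open>The vectors are first reflected into the complement of \<open>p\<close>, then
    into that of the moving point \<open>z\<close>. At the start the two reflections cancel; at the
    end \<open>z = - p\<close>, and the second one fixes the complement of \<open>p\<close>.\<close>
  show ?thesis
  proof (rule homotopic_loopsI[of "\<lambda>s. (reflect (z s) p (reflect (x (snd s)) p (T (snd s))),
      reflect (z s) p (reflect (x (snd s)) p (n (snd s))), z s)"])
    show "continuous_on ?I (\<lambda>s. (reflect (z s) p (reflect (x (snd s)) p (T (snd s))),
      reflect (z s) p (reflect (x (snd s)) p (n (snd s))), z s))"
      by (intro continuous_on_Pair continuous_on_reflect cz cT zp)
    show "(reflect (z (k, t)) p (reflect (x (snd (k, t))) p (T (snd (k, t)))),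
      reflect (z (k, t)) p (reflect (x (snd (k, t))) p (n (snd (k, t)))), z (k, t)) \<in> orthonormal_triples"
      if "k \<in> {0..1}" "t \<in> {0..1}" for k t
    proof -
      have k: "fst (k, t) \<in> {0..1}" using that by simp
      have "orthonormal3 (reflect (x t) p (T t)) (reflect (x t) p (n t)) p"
        by (rule orthonormal3_reflect[OF nx p xp on])
      from orthonormal3_reflect'[OF z(2)[OF k] p z(3)[OF k] this] show ?thesis
        by (simp add: orthonormal_triples_def)
    qed
    fix t :: real
    have z0: "z (0, t) = x t" using nx by (simp add: z_def y_def)
    show "(reflect (z (0, t)) p (reflect (x (snd (0, t))) p (T (snd (0, t)))),
      reflect (z (0, t)) p (reflect (x (snd (0, t))) p (n (snd (0, t)))), z (0, t)) = (T t, n t, x t)"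
      unfolding z0 by (simp add: reflect_reflect[OF nx p xp])
    have z1: "z (1, t) = - p" using p by (simp add: z_def y_def)
    have "reflect (x t) p (T t) \<bullet> p = 0" "reflect (x t) p (n t) \<bullet> p = 0"
      using reflect_orthogonal[OF nx p xp] on[of t] by (simp_all add: orthonormal3_def)
    then show "(reflect (z (1, t)) p (reflect (x (snd (1, t))) p (T (snd (1, t)))),
      reflect (z (1, t)) p (reflect (x (snd (1, t))) p (n (snd (1, t)))), z (1, t))
      = (reflect (x t) p (T t), reflect (x t) p (n t), - p)"
      unfolding z1 by (simp add: reflect_antipode[OF p])
  next
    fix k :: real
    have "z (k, 1) = z (k, 0)" by (simp add: z_def y_def per)
    then show "(reflect (z (k, 1)) p (reflect (x (snd (k, 1))) p (T (snd (k, 1)))),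
        reflect (z (k, 1)) p (reflect (x (snd (k, 1))) p (n (snd (k, 1)))), z (k, 1))
      = (reflect (z (k, 0)) p (reflect (x (snd (k, 0))) p (T (snd (k, 0)))),
        reflect (z (k, 0)) p (reflect (x (snd (k, 0))) p (n (snd (k, 0)))), z (k, 0))"
      by (simp add: per)
  qed
qed

text \<open>Linear interpolation followed by Gram-Schmidt, where the normal comes first. At the end
  \<open>X t\<close> is a combination of \<open>Y t\<close> and \<open>E t\<close> with a positive
  coefficient of \<open>E t\<close>, so orthonormalisation returns exactly
  \<open>E t\<close>.\<close>

lemma homotopic_loops_gram_schmidt:
  fixes a b X Y :: "real \<Rightarrow> vec3"
  assumes p: "norm p = 1" and ab: "\<And>t. norm (a t) = 1" "\<And>t. norm (b t) = 1" "\<And>t. a t \<bullet> b t = 0"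
    and X: "\<And>t. norm (X t - a t) \<le> 1 / 4" and Y: "\<And>t. norm (Y t - b t) \<le> 1 / 4"
    and cont: "continuous_on {0..1} a" "continuous_on {0..1} b" "continuous_on {0..1} X" "continuous_on {0..1} Y"
    and per: "a 1 = a 0" "b 1 = b 0" "X 1 = X 0" "Y 1 = Y 0"
    and E: "\<And>t. norm (E t) = 1" "\<And>t. norm (Y t) = 1" "\<And>t. E t \<bullet> Y t = 0"
      "\<And>t. t \<in> {0..1} \<Longrightarrow> \<exists>c. \<exists>d>0. X t = c *\<^sub>R Y t + d *\<^sub>R E t"
  shows "homotopic_loops orthonormal_triples (\<lambda>t. (unchart p (a t), unchart p (b t), - p))
    (\<lambda>t. (unchart p (E t), unchart p (Y t), - p))"
proof -
  let ?I = "{0..1::real} \<times> {0..1::real}"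
  define y where "y = (\<lambda>s. (1 - fst s) *\<^sub>R b (snd s) + fst s *\<^sub>R Y (snd s))"
  define x where "x = (\<lambda>s. (1 - fst s) *\<^sub>R a (snd s) + fst s *\<^sub>R X (snd s))"
  define w where "w = (\<lambda>s. x s - (x s \<bullet> y s / (y s \<bullet> y s)) *\<^sub>R y s)"
  have conv: "norm ((1 - k) *\<^sub>R u + k *\<^sub>R v - u) \<le> 1 / 4" if "norm (v - u) \<le> 1 / 4" "k \<in> {0..1}" for k and u v :: vec3
  proof -
    have "(1 - k) *\<^sub>R u + k *\<^sub>R v - u = k *\<^sub>R (v - u)" by (simp add: algebra_simps)
    then have "norm ((1 - k) *\<^sub>R u + k *\<^sub>R v - u) \<le> 1 * norm (v - u)"
      using that(2) by (simp add: mult_left_le_one_le)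
    then show ?thesis using that(1) by simp
  qed
  have nz: "y s \<noteq> 0" "w s \<noteq> 0" if "s \<in> ?I" for s
  proof -
    have "fst s \<in> {0..1}" using that by auto
    from perturbed_frame[OF ab(1)[of "snd s"] ab(2)[of "snd s"] ab(3)[of "snd s"] conv[OF X this] conv[OF Y this]]
    show "y s \<noteq> 0" "w s \<noteq> 0" unfolding y_def x_def w_def by blast+
  qed
  have cy: "continuous_on ?I y" "continuous_on ?I x"
    unfolding y_def x_def
    by (intro continuous_intros continuous_on_compose2[OF cont(1)] continuous_on_compose2[OF cont(2)]
      continuous_on_compose2[OF cont(3)] continuous_on_compose2[OF cont(4)]; auto)+
  have "y s \<bullet> y s \<noteq> 0" "norm (y s) \<noteq> 0" "norm (w s) \<noteq> 0" if "s \<in> ?I" for s using nz[OF that] by simp_all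
  note nz' = this
  have cw: "continuous_on ?I w"
    unfolding w_def by (intro continuous_intros cy) (use nz'(1) in blast)
  have yw: "w s \<bullet> y s = 0" if "s \<in> ?I" for s
    using nz'(1)[OF that] by (simp add: w_def inner_diff_left)
  define sg where "sg = (\<lambda>v::vec3. (1 / norm v) *\<^sub>R v)"
  have sg1: "sg v = v" if "norm v = 1" for v using that by (simp add: sg_def)
  show ?thesis
  proof (rule homotopic_loopsI[of "\<lambda>s. (unchart p (sg (w s)), unchart p (sg (y s)), - p)"])
    show "continuous_on ?I (\<lambda>s. (unchart p (sg (w s)), unchart p (sg (y s)), - p))"
      unfolding sg_def by (intro continuous_on_Pair continuous_on_unchart continuous_intros cw cy) (use nz' in blast)+
    show "(unchart p (sg (w (k, t))), unchart p (sg (y (k, t))), - p) \<in> orthonormal_triples"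
      if "k \<in> {0..1}" "t \<in> {0..1}" for k t
    proof -
      have s: "(k, t) \<in> ?I" using that by simp
      have "norm (sg (w (k, t))) = 1" "norm (sg (y (k, t))) = 1" "sg (w (k, t)) \<bullet> sg (y (k, t)) = 0"
        using nz[OF s] yw[OF s] by (simp_all add: sg_def)
      from orthonormal3_unchart[OF p this] show ?thesis by (simp add: orthonormal_triples_def)
    qed
    fix t :: real assume t: "t \<in> {0..1}"
    have "y (0, t) = b t" "x (0, t) = a t" by (simp_all add: y_def x_def)
    then show "(unchart p (sg (w (0, t))), unchart p (sg (y (0, t))), - p) = (unchart p (a t), unchart p (b t), - p)"
      using ab[of t] by (simp add: w_def sg1)
    have y1: "y (1, t) = Y t" "x (1, t) = X t" by (simp_all add: y_def x_def)
    obtain c d where cd: "d > 0" "X t = c *\<^sub>R Y t + d *\<^sub>R E t" using E(4)[OF t] by blast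
    have YY: "Y t \<bullet> Y t = 1" using E(2)[of t] by (simp add: norm_eq_1)
    have "X t \<bullet> Y t = c" unfolding cd(2) inner_add_left by (simp add: YY E(3))
    then have "w (1, t) = d *\<^sub>R E t" unfolding w_def y1 YY by (simp add: cd(2))
    then have "sg (w (1, t)) = E t" using cd(1) E(1)[of t] by (simp add: sg_def)
    then show "(unchart p (sg (w (1, t))), unchart p (sg (y (1, t))), - p) = (unchart p (E t), unchart p (Y t), - p)"
      unfolding y1 by (simp add: sg1 E(2))
  next
    fix k :: real
    have "y (k, 1) = y (k, 0)" "w (k, 1) = w (k, 0)" by (simp_all add: y_def w_def x_def per)
    then show "(unchart p (sg (w (k, 1))), unchart p (sg (y (k, 1))), - p) = (unchart p (sg (w (k, 0))), unchart p (sg (y (k, 0))), - p)"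
      by simp
  qed
qed

text \<open>Three free homotopies lead from the triples of the knot to the orbit of one fixed triple
  under \<open>conj_rotation\<close>. By equivariance its frames are \<open>?Q t ** B\<close> with
  constant \<open>B\<close>, which cancels once the loops are based at the identity.\<close>

theorem frame_loop_homotopic_rotation:
  assumes f: "f \<in> Emb" and N: "unit_normal_field f N" and fr: "has_framing_number f N 0"
  shows "homotopic_paths {M. orthogonal_matrix M}
    (\<lambda>t. frame f N (cis (2 * pi * t)) ** transpose (frame f N 1)) (\<lambda>t. rotation (2 * pi * t))"
    "continuous_on {0..1} (\<lambda>t. frame f N (cis (2 * pi * t)))"
    "\<And>t. orthogonal_matrix (frame f N (cis t))"
proof -
  obtain p where p: "norm p = 1" "p \<notin> f ` circle" using exists_pole[OF f] by blast
  define x where "x = (\<lambda>t. f (cis (2 * pi * t)))"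
  define n where "n = (\<lambda>t. N (cis (2 * pi * t)))"
  define T where "T = (\<lambda>t. unit_tangent f (cis (2 * pi * t)))"
  define a where "a = (\<lambda>t. chart p (reflect (f (cis t)) p (unit_tangent f (cis t))))"
  define b where "b = (\<lambda>t. chart p (reflect (f (cis t)) p (N (cis t))))"
  obtain \<xi> X Y where \<xi>: "continuous_on {0..2 * pi} \<xi>" "\<And>t. norm (\<xi> t) = 1" "\<xi> (2 * pi) = - \<xi> 0"
    and XY: "continuous_on UNIV X" "continuous_on UNIV Y" "X (2 * pi) = X 0" "Y (2 * pi) = Y 0"
      "\<And>t. norm (X t - a t) \<le> 1 / 16" "\<And>t. norm (Y t - b t) < 1 / 4" "\<And>t. Y t = - hopf (\<xi> t)"
      "\<And>t. t \<in> {0..2 * pi} \<Longrightarrow> \<exists>c. \<exists>d>0. X t = c *\<^sub>R hopf (\<xi> t) + d *\<^sub>R hopf_frame (\<xi> t)"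
    using knot_spin_frame[OF f N fr p] unfolding a_def b_def by blast
  have on: "orthonormal3 (unit_tangent f (cis t)) (N (cis t)) (f (cis t))" for t
    using knot_orthonormal(1)[OF f N] by simp
  have on': "orthonormal3 (T t) (n t) (x t)" for t unfolding T_def n_def x_def by (rule on)
  have xp: "x t \<noteq> p" for t using p(2) by (auto simp: x_def)
  have nx: "norm (x t) = 1" for t using on'[of t] by (simp add: orthonormal3_def)
  have sm: "smooth_on_circle f" "smooth_on_circle N" using f N by (simp_all add: Emb_def unit_normal_field_def)
  have cg: "continuous_on {0..1} (\<lambda>t::real. g (cis (2 * pi * t)))" if "continuous_on circle g" for g :: "complex \<Rightarrow> real^4"
    unfolding cis_conv_exp by (rule continuous_on_compose2[OF that]) (auto intro!: continuous_intros)
  have nz: "circle_deriv f z \<noteq> 0" if "z \<in> circle" for z using f that by (simp add: Emb_def)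
  have "continuous_on circle (unit_tangent f)"
    unfolding unit_tangent_def using smooth_on_circle_continuous[OF sm(1), of 1]
    by (intro continuous_intros) (use nz in auto)
  then have cT: "continuous_on {0..1} T" unfolding T_def by (rule cg)
  have cn: "continuous_on {0..1} n" unfolding n_def using smooth_on_circle_continuous[OF sm(2), of 0] by (intro cg) simp
  have cx: "continuous_on {0..1} x" unfolding x_def using smooth_on_circle_continuous[OF sm(1), of 0] by (intro cg) simp
  have per: "T 1 = T 0" "n 1 = n 0" "x 1 = x 0" by (simp_all add: T_def n_def x_def)
  have F: "frame f N (cis (2 * pi * t)) = frame4 (T t) (n t) (x t)" for t
    unfolding T_def n_def x_def by (rule frame_eq_frame4, rule on)
  show "continuous_on {0..1} (\<lambda>t. frame f N (cis (2 * pi * t)))"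
    unfolding F by (intro continuous_on_frame4 cT cn cx)
  show "orthogonal_matrix (frame f N (cis t))" for t
    using rotation_matrix_frame4[OF on[of t]] frame_eq_frame4[of f "cis t" N] on[of t] by (simp add: rotation_matrix_def)
  let ?a = "\<lambda>t. a (2 * pi * t)" and ?b = "\<lambda>t. b (2 * pi * t)"
  have ab: "?a t = chart p (reflect (x t) p (T t))" "?b t = chart p (reflect (x t) p (n t))" for t
    by (simp_all add: a_def b_def x_def T_def n_def)
  have r: "orthonormal3 (reflect (x t) p (T t)) (reflect (x t) p (n t)) p" for t
    by (rule orthonormal3_reflect[OF nx p(1) xp on'])
  have ab1: "norm (?a t) = 1" "norm (?b t) = 1" "?a t \<bullet> ?b t = 0" for t
    using r[of t] p(1) unfolding ab by (simp_all add: orthonormal3_def norm_chart chart_inner)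
  have un: "reflect (x t) p (T t) = unchart p (?a t)" "reflect (x t) p (n t) = unchart p (?b t)" for t
    using r[of t] p(1) unfolding ab by (simp_all add: orthonormal3_def unchart_chart norm_eq_1)
  have xp1: "x t \<bullet> p \<noteq> 1" for t using unit_inner_less_1[OF nx p(1) xp, of t] by simp
  have cab: "continuous_on {0..1} ?a" "continuous_on {0..1} ?b"
    unfolding ab by (intro bounded_linear.continuous_on[OF linear_chart] continuous_on_reflect cT cn cx xp1)+
  have perab: "?a 1 = ?a 0" "?b 1 = ?b 0" unfolding ab per by simp_all
  have 1: "homotopic_loops orthonormal_triples (\<lambda>t. (T t, n t, x t)) (\<lambda>t. (unchart p (?a t), unchart p (?b t), - p))"
    using homotopic_loops_reflect[OF p(1) on' xp cT cn cx per] unfolding un .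
  have 2: "homotopic_loops orthonormal_triples (\<lambda>t. (unchart p (?a t), unchart p (?b t), - p))
    (\<lambda>t. (unchart p (hopf_frame (\<xi> (2 * pi * t))), unchart p (Y (2 * pi * t)), - p))"
  proof (rule homotopic_loops_gram_schmidt[where X = "\<lambda>t. X (2 * pi * t)", OF p(1) ab1 _ _ cab _ _ perab])
    show "norm (X (2 * pi * t) - a (2 * pi * t)) \<le> 1 / 4" for t using XY(5)[of "2 * pi * t"] by linarith
    show "norm (Y (2 * pi * t) - b (2 * pi * t)) \<le> 1 / 4" for t using XY(6)[of "2 * pi * t"] by linarith
    show "continuous_on {0..1} (\<lambda>t. X (2 * pi * t))" "continuous_on {0..1} (\<lambda>t. Y (2 * pi * t))"
      by (rule continuous_on_compose2[OF XY(1)] continuous_on_compose2[OF XY(2)]; auto intro!: continuous_intros)+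
    show "X (2 * pi * 1) = X (2 * pi * 0)" "Y (2 * pi * 1) = Y (2 * pi * 0)" using XY(3,4) by simp_all
    show "norm (hopf_frame (\<xi> (2 * pi * t))) = 1" "norm (Y (2 * pi * t)) = 1" "hopf_frame (\<xi> (2 * pi * t)) \<bullet> Y (2 * pi * t) = 0" for t
      using hopf_frame_orthogonal[of "\<xi> (2 * pi * t)"] by (simp_all add: XY(7) norm_hopf norm_hopf_frame \<xi>(2) inner_commute)
    fix t :: real assume "t \<in> {0..1}"
    then have "2 * pi * t \<in> {0..2 * pi}" by (simp add: mult_le_cancel_left2)
    from XY(8)[OF this] obtain c d where cd: "d > 0" "X (2 * pi * t) = c *\<^sub>R hopf (\<xi> (2 * pi * t)) + d *\<^sub>R hopf_frame (\<xi> (2 * pi * t))"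
      by blast
    then have "X (2 * pi * t) = (- c) *\<^sub>R Y (2 * pi * t) + d *\<^sub>R hopf_frame (\<xi> (2 * pi * t))" by (simp add: XY(7))
    then show "\<exists>c. \<exists>d>0. X (2 * pi * t) = c *\<^sub>R Y (2 * pi * t) + d *\<^sub>R hopf_frame (\<xi> (2 * pi * t))"
      using cd(1) by blast
  qed
  let ?Q = "\<lambda>t. conj_rotation p (2 * pi * t)"
  let ?E = "unchart p (hopf_frame (\<xi> 0))" and ?H = "unchart p (- hopf (\<xi> 0))"
  have 3: "homotopic_loops orthonormal_triples (\<lambda>t. (T t, n t, x t)) (\<lambda>t. (?Q t *v ?E, ?Q t *v ?H, ?Q t *v (- p)))"
    using homotopic_loops_trans[OF homotopic_loops_trans[OF 1 2] homotopic_loops_spinor[OF p(1) \<xi>, folded XY(7)]]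
    unfolding XY(7) .
  have o3: "orthonormal3 ?E ?H (- p)"
    using hopf_frame_orthogonal[of "\<xi> 0"]
    by (intro orthonormal3_unchart[OF p(1)]) (simp_all add: norm_hopf norm_hopf_frame \<xi>(2) inner_commute)
  define B where "B = frame4 ?E ?H (- p)"
  have oB: "orthogonal_matrix B" using rotation_matrix_frame4[OF o3] by (simp add: B_def rotation_matrix_def)
  have QB: "frame4 (?Q t *v ?E) (?Q t *v ?H) (?Q t *v (- p)) = ?Q t ** B" for t
    unfolding B_def by (rule frame4_equivariant[OF rotation_matrix_conj_rotation[OF p(1)] o3])
  have "homotopic_loops {M. orthogonal_matrix M} (\<lambda>t. frame f N (cis (2 * pi * t))) (\<lambda>t. ?Q t ** B)"
    using homotopic_loops_frame4[OF 3] unfolding fst_conv snd_conv QB F .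
  from homotopic_loops_based[OF this]
  have "homotopic_paths {M. orthogonal_matrix M} (\<lambda>t. frame f N (cis (2 * pi * t)) ** transpose (frame f N 1))
    (\<lambda>t. ?Q t ** B ** transpose (?Q 0 ** B))" by simp
  moreover have "?Q t ** B ** transpose (?Q 0 ** B) = ?Q t" for t
  proof -
    have "?Q 0 = mat 1"
      using orthogonal_matrix_mult_transpose(2)[OF orthogonal_chart_matrix[OF p(1)]] rotation_0[of 0]
      by (simp add: conj_rotation_def)
    then show ?thesis
      using orthogonal_matrix_mult_transpose(1)[OF oB] by (simp flip: matrix_mul_assoc)
  qed
  ultimately show "homotopic_paths {M. orthogonal_matrix M}
    (\<lambda>t. frame f N (cis (2 * pi * t)) ** transpose (frame f N 1)) (\<lambda>t. rotation (2 * pi * t))"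
    using homotopic_paths_trans[OF _ homotopic_conj_rotation[OF p(1)]] by simp
qed

theorem theorem4:
  fixes f N :: "complex \<Rightarrow> real ^ 4"
  assumes "f \<in> Emb"
    and "unit_normal_field f N" and "has_framing_number f N 0"
  shows "{Emb_class f (Repar f), Emb_class f (Roll N f), Emb_class f (Rot f)} \<subseteq> carrier (pi1_Emb f)
    \<and> Emb_class f (Repar f) = Emb_class f (Roll N f) \<otimes>\<^bsub>pi1_Emb f\<^esub> Emb_class f (Rot f)
    \<and> Emb_class f (Repar f) = Emb_class f (Rot f) \<otimes>\<^bsub>pi1_Emb f\<^esub> Emb_class f (Roll N f)"
proof -
  note f = assms(1)
  let ?I = "{0..1::real}" and ?X = Emb_topology
  let ?A = "\<lambda>t. frame f N (cis (2 * pi * t))" and ?O = "{M :: real^4^4. orthogonal_matrix M}"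
  define L where "L = (\<lambda>t. ?A t ** transpose (frame f N 1))"
  define G where "G = (\<lambda>M \<tau>. \<lambda>z\<in>circle. (M :: real^4^4) *v f (cis \<tau> * z))"
  note frame = frame_loop_homotopic_rotation[OF assms]
  have oA: "orthogonal_matrix (?A t)" "orthogonal_matrix (frame f N 1)" for t
    using frame(3)[of "2 * pi * t"] frame(3)[of 0] by simp_all
  have oL: "orthogonal_matrix (L t)" for t
    unfolding L_def using oA by (intro orthogonal_matrix_mul) auto
  have cL: "continuous_on ?I L"
    unfolding L_def by (intro continuous_on_matrix_matrix_mult frame(2) continuous_intros)
  have L01: "L 0 = mat 1" "L 1 = mat 1"
    using orthogonal_matrix_mult_transpose(1)[OF oA(2)] by (simp_all add: L_def)
  have oR: "orthogonal_matrix (rotation t)" for t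
    using rotation_matrix_rotation[of t] by (simp add: rotation_matrix_def)
  have R01: "rotation (2 * pi * 0) = mat 1" "rotation (2 * pi * 1) = mat 1"
    using rotation_0[of 0] rotation_0[of 1] by simp_all
  obtain h :: "real \<times> real \<Rightarrow> real^4^4" where h: "continuous_on (?I \<times> ?I) h" "h \<in> (?I \<times> ?I) \<rightarrow> ?O"
    "\<forall>t\<in>?I. h (0, t) = L t" "\<forall>t\<in>?I. h (1, t) = rotation (2 * pi * t)"
    "\<forall>k\<in>?I. pathstart (h \<circ> Pair k) = pathstart L \<and> pathfinish (h \<circ> Pair k) = pathfinish L"
    using frame(1)[folded L_def] unfolding homotopic_paths by blast
  have h01: "h (k, 0) = mat 1" "h (k, 1) = mat 1" if "k \<in> ?I" for k
    using h(5) that L01 by (simp_all add: pathstart_def pathfinish_def)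
  have oh: "orthogonal_matrix (h x)" if "x \<in> ?I \<times> ?I" for x using h(2) that by blast
  have cG: "continuous_map (top_of_set S) ?X (\<lambda>y. G (M y) (\<tau> y))"
    if "\<And>y. y \<in> S \<Longrightarrow> orthogonal_matrix (M y)" "continuous_on S M" "continuous_on S \<tau>"
    for S :: "'b::metric_space set" and M \<tau>
    unfolding G_def by (rule continuous_map_matrix_rotate[OF f that])
  have G0: "G (mat 1) 0 = f" "G (mat 1) (2 * pi) = f"
    using f by (auto simp: G_def Emb_def extensional_def fun_eq_iff)
  have G2pi: "G M (2 * pi * 1) = G M (2 * pi * 0)" for M by (simp add: G_def)
  have Repar: "Repar f t = G (mat 1) (2 * pi * t)" for t by (simp add: Repar_def G_def)
  have Rot: "Rot f t = G (rotation (2 * pi * t)) 0" for t by (simp add: Rot_def G_def)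
  \<comment> \<open>An orthogonal frame has its transpose as inverse, so the matrix in
    \<open>Roll\<close> is the transpose of \<open>L t\<close>.\<close>
  have Roll: "Roll N f t = G (transpose (L t)) (2 * pi * t)" for t
    unfolding Roll_def G_def L_def orthogonal_matrix_mult_transpose(3)[OF oA(1)]
    by (simp add: matrix_transpose_mul)
  define \<Phi> where "\<Phi> = (\<lambda>x. G (rotation (2 * pi * fst x) ** transpose (L (snd x))) (2 * pi * snd x))"
  have cLs: "continuous_on (?I \<times> ?I) (\<lambda>x. transpose (L (snd x)))"
    by (intro continuous_on_transpose continuous_on_compose2[OF cL] continuous_intros) auto
  have c\<Phi>: "continuous_map (top_of_set (?I \<times> ?I)) ?X \<Phi>"
    unfolding \<Phi>_def
    by (intro cG orthogonal_matrix_mul continuous_on_matrix_matrix_mult continuous_on_rotation cLs continuous_intros)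
      (simp_all add: oR oL)
  define d where "d = (\<lambda>t. \<Phi> (t, t))"
  have \<Phi>1: "\<Phi> (t, 0) = Rot f t" "\<Phi> (t, 1) = Rot f t" "\<Phi> (0, t) = Roll N f t" "\<Phi> (1, t) = Roll N f t" for t
    unfolding \<Phi>_def Rot Roll fst_conv snd_conv L01 R01 G2pi by (simp_all add: transpose_mat)
  have f\<Phi>: "\<Phi> (0, 0) = f" "\<Phi> (1, 1) = f"
    unfolding \<Phi>_def fst_conv snd_conv L01 R01 G2pi by (simp_all add: transpose_mat G0)
  note join = diagonal_homotopy_join[of ?X \<Phi> "Rot f" "Roll N f" d f, OF c\<Phi> \<Phi>1 _ f\<Phi>]
  have join: "(d, loop_join (Rot f) (Roll N f)) \<in> loop_homotopy ?X f" "(d, loop_join (Roll N f) (Rot f)) \<in> loop_homotopy ?X f"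
    by (rule join; simp add: d_def)+
  \<comment> \<open>The homotopy \<open>h\<close> replaces \<open>L\<close> by the rotation loop
    while the factor \<open>transpose (L t)\<close> is kept: at one end the product is the identity,
    which gives \<open>Repar\<close>, at the other end it is the diagonal of
    \<open>\<Phi>\<close>.\<close>
  have "(Repar f, d) \<in> loop_homotopy ?X f"
  proof (rule loop_homotopyI[of _ "\<lambda>x. G (h x ** transpose (L (snd x))) (2 * pi * snd x)"])
    show "continuous_map (top_of_set (?I \<times> ?I)) ?X (\<lambda>x. G (h x ** transpose (L (snd x))) (2 * pi * snd x))"
      by (intro cG orthogonal_matrix_mul continuous_on_matrix_matrix_mult h(1) cLs continuous_intros)
        (simp_all add: oh oL)
    show "G (h (0, t) ** transpose (L (snd (0, t)))) (2 * pi * snd (0, t)) = Repar f t" if "t \<in> ?I" for t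
      using that h(3) orthogonal_matrix_mult_transpose(1)[OF oL] by (simp add: Repar)
    show "G (h (1, t) ** transpose (L (snd (1, t)))) (2 * pi * snd (1, t)) = d t" if "t \<in> ?I" for t
      using that h(4) by (simp add: d_def \<Phi>_def)
    show "G (h (k, 0) ** transpose (L (snd (k, 0)))) (2 * pi * snd (k, 0)) = f"
      "G (h (k, 1) ** transpose (L (snd (k, 1)))) (2 * pi * snd (k, 1)) = f" if "k \<in> ?I" for k
      using h01[OF that] by (simp_all add: L01 transpose_mat G0)
  qed
  note eqv = equiv_loop_homotopy[of ?X f]
  have rj: "(Repar f, loop_join (Rot f) (Roll N f)) \<in> loop_homotopy ?X f" "(Repar f, loop_join (Roll N f) (Rot f)) \<in> loop_homotopy ?X f"
    using \<open>(Repar f, d) \<in> loop_homotopy ?X f\<close> join eqv by (meson equivE transE)+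
  have "pathin ?X (Rot f)" "pathin ?X (Roll N f)"
    unfolding pathin_def Rot[abs_def] Roll[abs_def]
    by (intro cG continuous_on_rotation continuous_on_transpose cL continuous_intros; simp add: oR oL)+
  moreover have "Rot f 0 = f" "Rot f 1 = f" "Roll N f 0 = f" "Roll N f 1 = f"
    using R01 by (simp_all add: Rot Roll G0 L01 transpose_mat)
  ultimately have loops: "Rot f \<in> based_loops ?X f" "Roll N f \<in> based_loops ?X f" "Repar f \<in> based_loops ?X f"
    using rj(1) by (simp_all add: based_loops_def loop_homotopy_def)
  have "Emb_class f q \<in> carrier (pi1_Emb f)" if "q \<in> based_loops ?X f" for q
    using that by (simp add: fundamental_group_def loop_class_def quotientI)
  then have "{Emb_class f (Repar f), Emb_class f (Roll N f), Emb_class f (Rot f)} \<subseteq> carrier (pi1_Emb f)"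
    using loops by blast
  moreover have "Emb_class f (Repar f) = Emb_class f (loop_join (Roll N f) (Rot f))"
    "Emb_class f (Repar f) = Emb_class f (loop_join (Rot f) (Roll N f))"
    using rj equiv_class_eq[OF eqv] unfolding loop_class_def by blast+
  ultimately show ?thesis
    unfolding mult_fundamental_group[OF loops(2,1)] mult_fundamental_group[OF loops(1,2)] by blast
qed

end
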